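(* Let $0\ne y_d\in H_0^s(\Omega)$ with $s\in[0,1]$, or $0\neq y_d\in H^s(\Omega)\cap H_0^1(\Omega)$ with $s\in(1,2]$. Consider the nested iteration in which, on each level $\ell=1,\dots,L$, the mass-lumped Schur-complement system $S_\ell\mathbf{y}_\ell=\mathbf{y}_{d\ell}$ is treated by $k_\ell$ steps of the preconditioned conjugate gradient (PCG) method with preconditioner $D_\ell$, with initial guess $\mathbf{y}_1^0=\mathbf{0}$ on level $1$ and initial guess $y_\ell^0=y_{\ell-1}^{k_{\ell-1}}\in V_{\ell-1}\subset V_\ell$ on levels $\ell=2,\dots,L$. Suppose that $k_1$ PCG iterations on level $1$ yield $$\|y_d-y_1^{k_1}\|_{L_2(\Omega)}\le h_1^s\,c(y_d),$$ and that $k_2=\dots=k_L=k_*$, where $k_*$ is a fixed integer (independent of $L$) with $$k_*\ge\frac{\ln\big(q(y_d)^{-1}\big)}{\ln q^{-1}},\qquad q(y_d)=\frac{\|y_d\|_{L_2(\Omega)}}{(1+2^s)\,c\,\|y_d\|_{H^s(\Omega)}+2^{1+s}\,\overline{c}_{SM}^{1/2}\,\|y_d\|_{L_2(\Omega)}}.$$ Then the last iterate $y_L^{k_L}\in V_L$ on the finest level satisfies $$\|y_d-y_L^{k_L}\|_{L_2(\Omega)}\le h_L^s\,c(y_d).$$ Moreover, the computation of $y_L^{k_L}$ requires not more than $O(n_L)=O(h_L^{-d})$ arithmetical operations and memory (with constants independent of $L$).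
   Context: $\Omega\subset\mathbb{R}^d$, $d\in\{1,2,3\}$, is a bounded Lipschitz domain (an interval for $d=1$, polygonally bounded for $d=2$, polyhedrally bounded for $d=3$). $\mathcal{T}_\ell$, $\ell=1,\dots,L$, is a sequence of nested, uniformly refined, admissible simplicial meshes of $\Omega$, shape-regular and globally quasi-uniform uniformly in $\ell$, with global mesh sizes $h_\ell=h_{\ell-1}/2$ for $\ell\ge2$, and regularization parameters $\varrho_\ell=h_\ell^4$. On $\mathcal{T}_\ell$, $\{\varphi_j^\ell\}_{j=1}^{\overline n_\ell}$ are the continuous piecewise linear nodal (hat) basis functions, with indices $j\le n_\ell$ belonging to interior vertices; $V_\ell=\mathrm{span}\{\varphi_j^\ell\}_{j=1}^{n_\ell}\subset H_0^1(\Omega)$, so that $V_{\ell-1}\subset V_\ell$. Functions in $V_\ell$ are identified with their nodal coefficient vectors in $\mathbb{R}^{n_\ell}$ ($y_\ell^k\leftrightarrow\mathbf{y}_\ell^k$ for the $k$-th PCG iterate). For $i,j\le n_\ell$: $M_\ell[i,j]=\int_\Omega\varphi_j^\ell\varphi_i^\ell\,dx$, $K_\ell[i,j]=\int_\Omega\nabla\varphi_j^\ell\cdot\nabla\varphi_i^\ell\,dx$, $D_\ell[i,j]=\delta_{i,j}\sum_{k=1}^{\overline n_\ell}\int_\Omega\varphi_k^\ell\varphi_i^\ell\,dx$ (diagonal lumped mass matrix), $\mathbf{y}_{d\ell}[i]=\int_\Omega y_d\varphi_i^\ell\,dx$, and $S_\ell=\varrho_\ell K_\ell D_\ell^{-1}K_\ell+M_\ell$,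 a symmetric positive definite matrix. Constants: $c_{\mathrm{inv}}>0$ is such that $\|\nabla w\|_{L_2(\tau_e)}\le c_{\mathrm{inv}}h_\ell^{-1}\|w\|_{L_2(\tau_e)}$ for all $w\in V_\ell$, $\tau_e\in\mathcal{T}_\ell$ and all $\ell$; $\overline{c}_{SM}=c_{\mathrm{inv}}^4+1$; $q=(\sqrt{\kappa}-1)/(\sqrt{\kappa}+1)<1$ with $\kappa=(d+2)(c_{\mathrm{inv}}^4+1)$, a level-independent bound for the spectral condition number of $D_\ell^{-1}S_\ell$; $c>0$ is the level-independent constant in the discretization error estimate $\|\hat y_\ell-y_d\|_{L_2(\Omega)}\le c\,h_\ell^s\|y_d\|_{H^s(\Omega)}$, where $\hat y_\ell\in V_\ell$ is the function whose coefficient vector is the exact solution of $S_\ell\mathbf{y}_\ell=\mathbf{y}_{d\ell}$; and $c(y_d)=c\,\|y_d\|_{H^s(\Omega)}+2\,\overline{c}_{SM}^{1/2}\,\|y_d\|_{L_2(\Omega)}$. For $s\in[0,1]$, $H_0^s(\Omega)$ denotes the interpolation space between $L_2(\Omega)$ and $H_0^1(\Omega)$, with $\|\cdot\|_{H^s(\Omega)}$ read as its norm. *)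

theory Defs
  imports "HOL-Analysis.Analysis"
begin

section \<open>Domains and meshes\<close>

definition lipschitz_boundary :: "'a::euclidean_space set \<Rightarrow> bool" where
  "lipschitz_boundary \<Omega> \<longleftrightarrow>
     (\<forall>x\<in>frontier \<Omega>. \<exists>r>0. \<exists>e g K. norm e = 1 \<and> K-lipschitz_on {z. z \<bullet> e = 0} g \<and>
        \<Omega> \<inter> ball x r = {y \<in> ball x r. g (y - (y \<bullet> e) *\<^sub>R e) < y \<bullet> e})"

text \<open>In dimension 1 these are exactly the bounded open intervals.\<close>

definition lipschitz_polyhedral_domain :: "'a::euclidean_space set \<Rightarrow> bool" where
  "lipschitz_polyhedral_domain \<Omega> \<longleftrightarrow>
     open \<Omega> \<and> connected \<Omega> \<and> bounded \<Omega> \<and> \<Omega> \<noteq> {} \<and> lipschitz_boundary \<Omega> \<and>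
     (\<exists>\<P>. finite \<P> \<and> (\<forall>P\<in>\<P>. polytope P) \<and> closure \<Omega> = \<Union>\<P>)"

text \<open>A mesh is the set of its closed, full-dimensional elements; admissibility (no hanging
  nodes) is the face-to-face condition contained in \<^const>\<open>triangulation\<close>.\<close>

definition admissible_mesh :: "'a::euclidean_space set \<Rightarrow> 'a set set \<Rightarrow> bool" where
  "admissible_mesh \<Omega> T \<longleftrightarrow>
     triangulation T \<and> (\<forall>\<tau>\<in>T. int DIM('a) simplex \<tau>) \<and> \<Union>T = closure \<Omega>"

definition simplex_vertices :: "'a::euclidean_space set \<Rightarrow> 'a set" where
  "simplex_vertices \<tau> = {v. v extreme_point_of \<tau>}"

definition mesh_vertices :: "'a::euclidean_space set set \<Rightarrow> 'a set" where
  "mesh_vertices T = (\<Union>\<tau>\<in>T. simplex_vertices \<tau>)"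

definition interior_vertices :: "'a::euclidean_space set \<Rightarrow> 'a set set \<Rightarrow> 'a set" where
  "interior_vertices \<Omega> T = mesh_vertices T \<inter> \<Omega>"

definition shape_regular :: "real \<Rightarrow> 'a::euclidean_space set set \<Rightarrow> bool" where
  "shape_regular \<sigma> T \<longleftrightarrow>
     (\<forall>\<tau>\<in>T. \<exists>x r. 0 < r \<and> cball x r \<subseteq> \<tau> \<and> diameter \<tau> \<le> \<sigma> * r)"

text \<open>The global mesh size \<open>h\<close> is only required to be comparable with all element diameters.
  On shape-regular, quasi-uniform meshes this covers both customary choices, the maximum of the
  diameters and the maximum of \<open>|\<tau>|\<close> to the power \<open>1/d\<close>. Only the latter is halved exactly by
  every uniform refinement in dimension 3.\<close>

definition quasi_uniform :: "real \<Rightarrow> real \<Rightarrow> 'a::euclidean_space set set \<Rightarrow> bool" where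
  "quasi_uniform \<gamma> h T \<longleftrightarrow> 0 < h \<and> (\<forall>\<tau>\<in>T. h \<le> \<gamma> * diameter \<tau> \<and> diameter \<tau> \<le> \<gamma> * h)"

text \<open>Every element is split into \<open>2^d\<close> children whose vertices are vertices or edge midpoints
  of the parent (\<open>v = w\<close> gives the vertices themselves).\<close>

definition uniform_refinement :: "'a::euclidean_space set set \<Rightarrow> 'a set set \<Rightarrow> bool" where
  "uniform_refinement T T' \<longleftrightarrow>
     (\<forall>\<tau>'\<in>T'. \<exists>\<tau>\<in>T. \<tau>' \<subseteq> \<tau>) \<and>
     (\<forall>\<tau>\<in>T. \<tau> = \<Union>{\<tau>'\<in>T'. \<tau>' \<subseteq> \<tau>} \<and> card {\<tau>'\<in>T'. \<tau>' \<subseteq> \<tau>} = 2 ^ DIM('a) \<and>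
        (\<forall>\<tau>'\<in>T'. \<tau>' \<subseteq> \<tau> \<longrightarrow> simplex_vertices \<tau>' \<subseteq>
           {midpoint v w | v w. v \<in> simplex_vertices \<tau> \<and> w \<in> simplex_vertices \<tau>}))"

definition mesh_hierarchy ::
  "'a::euclidean_space set \<Rightarrow> real \<Rightarrow> real \<Rightarrow> nat \<Rightarrow> (nat \<Rightarrow> 'a set set) \<Rightarrow> (nat \<Rightarrow> real) \<Rightarrow> bool" where
  "mesh_hierarchy \<Omega> \<sigma> \<gamma> L T h \<longleftrightarrow>
     (\<forall>l\<in>{1..L}. admissible_mesh \<Omega> (T l) \<and> shape_regular \<sigma> (T l) \<and> quasi_uniform \<gamma> (h l) (T l)) \<and>
     (\<forall>l\<in>{2..L}. uniform_refinement (T (l - 1)) (T l) \<and> h l = h (l - 1) / 2)"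


section \<open>Function spaces and norms\<close>

definition L2_space :: "'a::euclidean_space set \<Rightarrow> ('a \<Rightarrow> real) set" where
  "L2_space \<Omega> = {u. u \<in> borel_measurable (lebesgue_on \<Omega>) \<and>
                    integrable (lebesgue_on \<Omega>) (\<lambda>x. (u x)\<^sup>2)}"

definition L2_norm :: "'a::euclidean_space set \<Rightarrow> ('a \<Rightarrow> 'b::real_normed_vector) \<Rightarrow> real" where
  "L2_norm S f = sqrt (LINT x|lebesgue_on S. (norm (f x))\<^sup>2)"

primrec partial_deriv :: "'a::euclidean_space list \<Rightarrow> ('a \<Rightarrow> real) \<Rightarrow> 'a \<Rightarrow> real" where
  "partial_deriv [] f = f"
| "partial_deriv (b # bs) f = (\<lambda>x. frechet_derivative (partial_deriv bs f) (at x) b)"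

text \<open>Differentiability of all iterated partial derivatives implies their continuity, so these
  are the smooth functions with compact support in \<open>\<Omega>\<close>.\<close>

definition test_functions :: "'a::euclidean_space set \<Rightarrow> ('a \<Rightarrow> real) set" where
  "test_functions \<Omega> =
     {\<phi>. (\<forall>bs. set bs \<subseteq> Basis \<longrightarrow> partial_deriv bs \<phi> differentiable_on UNIV) \<and>
         (\<exists>K. compact K \<and> K \<subseteq> \<Omega> \<and> (\<forall>x. x \<notin> K \<longrightarrow> \<phi> x = 0))}"

definition weak_gradient ::
  "'a::euclidean_space set \<Rightarrow> ('a \<Rightarrow> real) \<Rightarrow> ('a \<Rightarrow> 'a) \<Rightarrow> bool" where
  "weak_gradient \<Omega> u g \<longleftrightarrow>
     (\<forall>b\<in>Basis. (\<lambda>x. g x \<bullet> b) \<in> L2_space \<Omega> \<and>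
        (\<forall>\<phi>\<in>test_functions \<Omega>.
           (LINT x|lebesgue_on \<Omega>. u x * partial_deriv [b] \<phi> x) =
           - (LINT x|lebesgue_on \<Omega>. (g x \<bullet> b) * \<phi> x)))"

definition wgrad :: "'a::euclidean_space set \<Rightarrow> ('a \<Rightarrow> real) \<Rightarrow> 'a \<Rightarrow> 'a" where
  "wgrad \<Omega> u = (SOME g. weak_gradient \<Omega> u g)"

definition H1_space :: "'a::euclidean_space set \<Rightarrow> ('a \<Rightarrow> real) set" where
  "H1_space \<Omega> = {u \<in> L2_space \<Omega>. \<exists>g. weak_gradient \<Omega> u g}"

definition H1_norm :: "'a::euclidean_space set \<Rightarrow> ('a \<Rightarrow> real) \<Rightarrow> real" where
  "H1_norm \<Omega> u = sqrt ((L2_norm \<Omega> u)\<^sup>2 + (L2_norm \<Omega> (wgrad \<Omega> u))\<^sup>2)"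

definition H1_zero_space :: "'a::euclidean_space set \<Rightarrow> ('a \<Rightarrow> real) set" where
  "H1_zero_space \<Omega> =
     {u \<in> H1_space \<Omega>. \<forall>\<epsilon>>0. \<exists>\<phi>\<in>test_functions \<Omega>. H1_norm \<Omega> (\<lambda>x. u x - \<phi> x) < \<epsilon>}"

text \<open>Real interpolation between \<open>L\<^sub>2\<close> and \<open>H\<^sub>0\<^sup>1\<close> by the quadratic K-functional. The factor
  \<open>2 sin(\<pi>\<theta>)/\<pi>\<close> makes the result the Hilbert-scale norm, in which an eigenfunction with eigenvalue
  \<open>\<lambda>\<close> of the pair of squared norms gets the weight \<open>\<lambda>\<close> to the power \<open>\<theta>\<close>.\<close>

definition K_functional_sq :: "'a::euclidean_space set \<Rightarrow> real \<Rightarrow> ('a \<Rightarrow> real) \<Rightarrow> real" where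
  "K_functional_sq \<Omega> t u =
     (INF v\<in>H1_zero_space \<Omega>. (L2_norm \<Omega> (\<lambda>x. u x - v x))\<^sup>2 + t\<^sup>2 * (H1_norm \<Omega> v)\<^sup>2)"

definition interpolation_norm_sq :: "'a::euclidean_space set \<Rightarrow> real \<Rightarrow> ('a \<Rightarrow> real) \<Rightarrow> ennreal" where
  "interpolation_norm_sq \<Omega> \<theta> u =
     ennreal (2 * sin (pi * \<theta>) / pi) *
     (\<integral>\<^sup>+ t\<in>{0<..}. ennreal (t powr (- 2 * \<theta> - 1) * K_functional_sq \<Omega> t u) \<partial>lborel)"

definition H0s_space :: "'a::euclidean_space set \<Rightarrow> real \<Rightarrow> ('a \<Rightarrow> real) set" where
  "H0s_space \<Omega> s =
     (if s = 0 then L2_space \<Omega> else if s = 1 then H1_zero_space \<Omega>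
      else {u \<in> L2_space \<Omega>. interpolation_norm_sq \<Omega> s u < \<infinity>})"

definition slobodeckij_sq :: "'a::euclidean_space set \<Rightarrow> real \<Rightarrow> ('a \<Rightarrow> real) \<Rightarrow> ennreal" where
  "slobodeckij_sq \<Omega> \<theta> w =
     (\<integral>\<^sup>+ x. \<integral>\<^sup>+ y. ennreal ((w x - w y)\<^sup>2 / norm (x - y) powr (real DIM('a) + 2 * \<theta>))
        \<partial>lebesgue_on \<Omega> \<partial>lebesgue_on \<Omega>)"

text \<open>Meant for \<open>1 < s \<le> 2\<close> only.\<close>

definition Hs_space :: "'a::euclidean_space set \<Rightarrow> real \<Rightarrow> ('a \<Rightarrow> real) set" where
  "Hs_space \<Omega> s =
     {u \<in> H1_space \<Omega>. \<forall>b\<in>Basis.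
        if s = 2 then (\<lambda>x. wgrad \<Omega> u x \<bullet> b) \<in> H1_space \<Omega>
        else slobodeckij_sq \<Omega> (s - 1) (\<lambda>x. wgrad \<Omega> u x \<bullet> b) < \<infinity>}"

definition data_space :: "'a::euclidean_space set \<Rightarrow> real \<Rightarrow> ('a \<Rightarrow> real) set" where
  "data_space \<Omega> s = (if s \<le> 1 then H0s_space \<Omega> s else Hs_space \<Omega> s \<inter> H1_zero_space \<Omega>)"

definition Hs_norm :: "'a::euclidean_space set \<Rightarrow> real \<Rightarrow> ('a \<Rightarrow> real) \<Rightarrow> real" where
  "Hs_norm \<Omega> s u =
     (if s = 0 then L2_norm \<Omega> u
      else if s < 1 then sqrt (enn2real (interpolation_norm_sq \<Omega> s u))
      else if s = 1 then H1_norm \<Omega> u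
      else if s < 2 then
        sqrt ((H1_norm \<Omega> u)\<^sup>2 +
              (\<Sum>b\<in>Basis. enn2real (slobodeckij_sq \<Omega> (s - 1) (\<lambda>x. wgrad \<Omega> u x \<bullet> b))))
      else
        sqrt ((H1_norm \<Omega> u)\<^sup>2 +
              (\<Sum>b\<in>Basis. (L2_norm \<Omega> (wgrad \<Omega> (\<lambda>x. wgrad \<Omega> u x \<bullet> b)))\<^sup>2)))"


section \<open>Piecewise linear finite elements\<close>

definition P1_functions :: "'a::euclidean_space set set \<Rightarrow> ('a \<Rightarrow> real) set" where
  "P1_functions T =
     {u. continuous_on (\<Union>T) u \<and> (\<forall>\<tau>\<in>T. \<exists>a \<beta>. \<forall>x\<in>\<tau>. u x = a \<bullet> x + \<beta>) \<and> (\<forall>x. x \<notin> \<Union>T \<longrightarrow> u x = 0)}"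

text \<open>Basis functions, and hence vectors and matrices, are indexed by the vertices themselves
  instead of by a numbering of them. Coefficients outside the index set are irrelevant.\<close>

definition hat :: "'a::euclidean_space set set \<Rightarrow> 'a \<Rightarrow> 'a \<Rightarrow> real" where
  "hat T v = (THE \<phi>. \<phi> \<in> P1_functions T \<and> (\<forall>w\<in>mesh_vertices T. \<phi> w = (if w = v then 1 else 0)))"

definition fe_function :: "'a::euclidean_space set \<Rightarrow> 'a set set \<Rightarrow> ('a \<Rightarrow> real) \<Rightarrow> 'a \<Rightarrow> real" where
  "fe_function \<Omega> T y = (\<lambda>x. \<Sum>v\<in>interior_vertices \<Omega> T. y v * hat T v x)"

definition fe_space :: "'a::euclidean_space set \<Rightarrow> 'a set set \<Rightarrow> ('a \<Rightarrow> real) set" where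
  "fe_space \<Omega> T = range (fe_function \<Omega> T)"

text \<open>Classical gradient; finite element functions have it almost everywhere.\<close>

definition grad :: "('a::euclidean_space \<Rightarrow> real) \<Rightarrow> 'a \<Rightarrow> 'a" where
  "grad u x = (\<Sum>b\<in>Basis. frechet_derivative u (at x) b *\<^sub>R b)"

definition mass_matrix :: "'a::euclidean_space set \<Rightarrow> 'a set set \<Rightarrow> 'a \<Rightarrow> 'a \<Rightarrow> real" where
  "mass_matrix \<Omega> T v w = (LINT x|lebesgue_on \<Omega>. hat T w x * hat T v x)"

definition stiffness_matrix :: "'a::euclidean_space set \<Rightarrow> 'a set set \<Rightarrow> 'a \<Rightarrow> 'a \<Rightarrow> real" where
  "stiffness_matrix \<Omega> T v w = (LINT x|lebesgue_on \<Omega>. grad (hat T w) x \<bullet> grad (hat T v) x)"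

definition lumped_matrix :: "'a::euclidean_space set \<Rightarrow> 'a set set \<Rightarrow> 'a \<Rightarrow> 'a \<Rightarrow> real" where
  "lumped_matrix \<Omega> T v w =
     (if v = w then \<Sum>u\<in>mesh_vertices T. LINT x|lebesgue_on \<Omega>. hat T u x * hat T v x else 0)"

definition load_vector :: "'a::euclidean_space set \<Rightarrow> 'a set set \<Rightarrow> ('a \<Rightarrow> real) \<Rightarrow> 'a \<Rightarrow> real" where
  "load_vector \<Omega> T yd v = (LINT x|lebesgue_on \<Omega>. yd x * hat T v x)"

definition schur_matrix ::
  "'a::euclidean_space set \<Rightarrow> 'a set set \<Rightarrow> real \<Rightarrow> 'a \<Rightarrow> 'a \<Rightarrow> real" where
  "schur_matrix \<Omega> T \<rho> v w =
     \<rho> * (\<Sum>u\<in>interior_vertices \<Omega> T.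
            stiffness_matrix \<Omega> T v u * inverse (lumped_matrix \<Omega> T u u) * stiffness_matrix \<Omega> T u w)
     + mass_matrix \<Omega> T v w"

definition mat_vec :: "'v set \<Rightarrow> ('v \<Rightarrow> 'v \<Rightarrow> real) \<Rightarrow> ('v \<Rightarrow> real) \<Rightarrow> 'v \<Rightarrow> real" where
  "mat_vec I A x v = (\<Sum>w\<in>I. A v w * x w)"

definition schur_solution ::
  "'a::euclidean_space set \<Rightarrow> 'a set set \<Rightarrow> real \<Rightarrow> ('a \<Rightarrow> real) \<Rightarrow> ('a \<Rightarrow> real) \<Rightarrow> bool" where
  "schur_solution \<Omega> T \<rho> yd y \<longleftrightarrow>
     (\<forall>v\<in>interior_vertices \<Omega> T.
        mat_vec (interior_vertices \<Omega> T) (schur_matrix \<Omega> T \<rho>) y v = load_vector \<Omega> T yd v)"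


section \<open>Preconditioned conjugate gradients and nested iteration\<close>

definition inner_on :: "'v set \<Rightarrow> ('v \<Rightarrow> real) \<Rightarrow> ('v \<Rightarrow> real) \<Rightarrow> real" where
  "inner_on I x y = (\<Sum>v\<in>I. x v * y v)"

text \<open>PCG for \<open>A x = b\<close> with a diagonal preconditioner \<open>D\<close>; a state consists of the iterate, its
  residual and the search direction. Once the residual vanishes, \<open>0 / 0 = 0\<close> makes the iterates
  stay at the exact solution.\<close>

definition pcg_init ::
  "'v set \<Rightarrow> ('v \<Rightarrow> 'v \<Rightarrow> real) \<Rightarrow> ('v \<Rightarrow> 'v \<Rightarrow> real) \<Rightarrow> ('v \<Rightarrow> real) \<Rightarrow> ('v \<Rightarrow> real) \<Rightarrow>
   ('v \<Rightarrow> real) \<times> ('v \<Rightarrow> real) \<times> ('v \<Rightarrow> real)" where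
  "pcg_init I A D b x0 =
     (let r = (\<lambda>v. b v - mat_vec I A x0 v) in (x0, r, \<lambda>v. r v / D v v))"

definition pcg_step ::
  "'v set \<Rightarrow> ('v \<Rightarrow> 'v \<Rightarrow> real) \<Rightarrow> ('v \<Rightarrow> 'v \<Rightarrow> real) \<Rightarrow>
   ('v \<Rightarrow> real) \<times> ('v \<Rightarrow> real) \<times> ('v \<Rightarrow> real) \<Rightarrow> ('v \<Rightarrow> real) \<times> ('v \<Rightarrow> real) \<times> ('v \<Rightarrow> real)" where
  "pcg_step I A D = (\<lambda>(x, r, p).
     let z = (\<lambda>v. r v / D v v);
         Ap = mat_vec I A p;
         \<alpha> = inner_on I r z / inner_on I p Ap;
         r' = (\<lambda>v. r v - \<alpha> * Ap v);
         z' = (\<lambda>v. r' v / D v v);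
         \<beta> = inner_on I r' z' / inner_on I r z
     in (\<lambda>v. x v + \<alpha> * p v, r', \<lambda>v. z' v + \<beta> * p v))"

definition pcg ::
  "'v set \<Rightarrow> ('v \<Rightarrow> 'v \<Rightarrow> real) \<Rightarrow> ('v \<Rightarrow> 'v \<Rightarrow> real) \<Rightarrow> ('v \<Rightarrow> real) \<Rightarrow> ('v \<Rightarrow> real) \<Rightarrow> nat \<Rightarrow> 'v \<Rightarrow> real" where
  "pcg I A D b x0 k = fst ((pcg_step I A D ^^ k) (pcg_init I A D b x0))"

text \<open>\<open>nested_iterate \<dots> l\<close> is the coefficient vector of the last iterate on level \<open>l \<ge> 1\<close>. A coarse
  function is transferred to the next level by evaluating it at the vertices of the finer mesh,
  which yields its nodal coefficients there.\<close>

primrec nested_iterate ::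
  "'a::euclidean_space set \<Rightarrow> (nat \<Rightarrow> 'a set set) \<Rightarrow> (nat \<Rightarrow> real) \<Rightarrow> (nat \<Rightarrow> nat) \<Rightarrow> ('a \<Rightarrow> real) \<Rightarrow>
   nat \<Rightarrow> 'a \<Rightarrow> real" where
  "nested_iterate \<Omega> T h k yd 0 = (\<lambda>v. 0)"
| "nested_iterate \<Omega> T h k yd (Suc l) =
     pcg (interior_vertices \<Omega> (T (Suc l)))
       (schur_matrix \<Omega> (T (Suc l)) (h (Suc l) ^ 4)) (lumped_matrix \<Omega> (T (Suc l)))
       (load_vector \<Omega> (T (Suc l)) yd)
       (if l = 0 then (\<lambda>v. 0) else fe_function \<Omega> (T l) (nested_iterate \<Omega> T h k yd l))
       (k (Suc l))"


section \<open>Constants\<close>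

definition c_SM :: "real \<Rightarrow> real" where
  "c_SM cinv = cinv ^ 4 + 1"

definition \<kappa> :: "nat \<Rightarrow> real \<Rightarrow> real" where
  "\<kappa> d cinv = (real d + 2) * (cinv ^ 4 + 1)"

definition q_pcg :: "nat \<Rightarrow> real \<Rightarrow> real" where
  "q_pcg d cinv = (sqrt (\<kappa> d cinv) - 1) / (sqrt (\<kappa> d cinv) + 1)"

definition c_data :: "'a::euclidean_space set \<Rightarrow> real \<Rightarrow> real \<Rightarrow> real \<Rightarrow> ('a \<Rightarrow> real) \<Rightarrow> real" where
  "c_data \<Omega> s c cinv yd = c * Hs_norm \<Omega> s yd + 2 * sqrt (c_SM cinv) * L2_norm \<Omega> yd"

definition q_data :: "'a::euclidean_space set \<Rightarrow> real \<Rightarrow> real \<Rightarrow> real \<Rightarrow> ('a \<Rightarrow> real) \<Rightarrow> real" where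
  "q_data \<Omega> s c cinv yd =
     L2_norm \<Omega> yd /
     ((1 + 2 powr s) * c * Hs_norm \<Omega> s yd + 2 powr (1 + s) * sqrt (c_SM cinv) * L2_norm \<Omega> yd)"

definition inverse_inequality ::
  "'a::euclidean_space set \<Rightarrow> nat \<Rightarrow> (nat \<Rightarrow> 'a set set) \<Rightarrow> (nat \<Rightarrow> real) \<Rightarrow> real \<Rightarrow> bool" where
  "inverse_inequality \<Omega> L T h cinv \<longleftrightarrow>
     (\<forall>l\<in>{1..L}. \<forall>w\<in>fe_space \<Omega> (T l). \<forall>\<tau>\<in>T l.
        L2_norm \<tau> (grad w) \<le> cinv * inverse (h l) * L2_norm \<tau> w)"

definition discretization_error_estimate ::
  "'a::euclidean_space set \<Rightarrow> nat \<Rightarrow> (nat \<Rightarrow> 'a set set) \<Rightarrow> (nat \<Rightarrow> real) \<Rightarrow> real \<Rightarrow> real \<Rightarrow>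
   ('a \<Rightarrow> real) \<Rightarrow> bool" where
  "discretization_error_estimate \<Omega> L T h s c yd \<longleftrightarrow>
     (\<forall>l\<in>{1..L}. \<forall>y. schur_solution \<Omega> (T l) (h l ^ 4) yd y \<longrightarrow>
        L2_norm \<Omega> (\<lambda>x. fe_function \<Omega> (T l) y x - yd x) \<le> c * h l powr s * Hs_norm \<Omega> s yd)"


section \<open>Arithmetic cost\<close>

text \<open>Straight-line programs over the reals without any constants. Cells are addressed by level
  and vertices, so that a program for a given mesh hierarchy touches only those matrix entries
  it needs; its running time is its length and its memory is the number of distinct cells
  occurring in it, input and output included.\<close>

datatype 'v cell =
    Mass nat 'v 'v
  | Stiffness nat 'v 'v
  | Lumped nat 'v
  | Transfer nat 'v 'v
  | Load nat 'v
  | Rho nat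
  | Work nat
  | Output 'v

datatype arith_op = Add | Sub | Mul | Div

datatype 'v instr = Instr (target: "'v cell") arith_op (left_arg: "'v cell") (right_arg: "'v cell")

primrec apply_op :: "arith_op \<Rightarrow> real \<Rightarrow> real \<Rightarrow> real" where
  "apply_op Add a b = a + b"
| "apply_op Sub a b = a - b"
| "apply_op Mul a b = a * b"
| "apply_op Div a b = a / b"

primrec exec_instr :: "'v instr \<Rightarrow> ('v cell \<Rightarrow> real) \<Rightarrow> 'v cell \<Rightarrow> real" where
  "exec_instr (Instr t f a b) m = m(t := apply_op f (m a) (m b))"

definition run :: "'v instr list \<Rightarrow> ('v cell \<Rightarrow> real) \<Rightarrow> 'v cell \<Rightarrow> real" where
  "run p m = fold exec_instr p m"

definition operations :: "'v instr list \<Rightarrow> nat" where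
  "operations p = length p"

definition memory :: "'v instr list \<Rightarrow> nat" where
  "memory p = card (\<Union>i\<in>set p. {target i, left_arg i, right_arg i})"

text \<open>\<open>Transfer l v w\<close> holds the value of the coarse hat function \<open>w\<close> (level \<open>l - 1\<close>) at the
  vertex \<open>v\<close> of level \<open>l\<close>.\<close>

primrec input_memory ::
  "'a::euclidean_space set \<Rightarrow> (nat \<Rightarrow> 'a set set) \<Rightarrow> (nat \<Rightarrow> real) \<Rightarrow> ('a \<Rightarrow> real) \<Rightarrow> 'a cell \<Rightarrow> real" where
  "input_memory \<Omega> T h yd (Mass l v w) = mass_matrix \<Omega> (T l) v w"
| "input_memory \<Omega> T h yd (Stiffness l v w) = stiffness_matrix \<Omega> (T l) v w"
| "input_memory \<Omega> T h yd (Lumped l v) = lumped_matrix \<Omega> (T l) v v"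
| "input_memory \<Omega> T h yd (Transfer l v w) = hat (T (l - 1)) w v"
| "input_memory \<Omega> T h yd (Load l v) = load_vector \<Omega> (T l) yd v"
| "input_memory \<Omega> T h yd (Rho l) = h l ^ 4"
| "input_memory \<Omega> T h yd (Work n) = 0"
| "input_memory \<Omega> T h yd (Output v) = 0"

text \<open>One and the same program has to serve all right-hand sides, so the result cannot be
  encoded in the program.\<close>

definition computes_nested_iterate ::
  "'a::euclidean_space set \<Rightarrow> nat \<Rightarrow> (nat \<Rightarrow> 'a set set) \<Rightarrow> (nat \<Rightarrow> real) \<Rightarrow> (nat \<Rightarrow> nat) \<Rightarrow>
   'a instr list \<Rightarrow> bool" where
  "computes_nested_iterate \<Omega> L T h k p \<longleftrightarrow>
     (\<forall>yd\<in>L2_space \<Omega>. \<forall>v\<in>interior_vertices \<Omega> (T L).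
        run p (input_memory \<Omega> T h yd) (Output v) = nested_iterate \<Omega> T h k yd L v)"

end

theory Submission
  imports Defs
begin

text \<open>On one level the error splits into the discretization error and the PCG error. The latter is
  reduced by the factor \<open>2 q\<^sup>k\<close> in the energy norm, which is equivalent to the \<open>L\<^sub>2\<close> norm because of
  \<open>M \<le> S \<le> c_SM M\<close> (inverse inequality and \<open>M \<le> D\<close>); the initial error is the error of the coarser level
  plus a discretization error, and the lower bound on the number of steps is what makes the sum
  reproduce the bound of the coarser level with \<open>h\<close> halved. The condition number follows from
  \<open>D / (d + 2) \<le> M\<close>, which holds element by element since on a simplex the mass integrals satisfy
  \<open>m(v,v) = 2 m(v,w)\<close> for \<open>v \<noteq> w\<close>.

  For the cost, shape regularity bounds the number of elements at a point by comparing volumes of balls,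
  so all matrices have boundedly many entries per row, and the numbers of unknowns of the levels form a
  geometric series up to constants.\<close>

section \<open>Preconditioned conjugate gradients\<close>

text \<open>The factor \<open>2 q^k\<close> is the Chebyshev bound, proved without eigenvectors: the
  preconditioned matrix is mapped affinely to an operator \<open>Z\<close> that is self-adjoint and
  contractive in the energy product, and a polynomial identity bounds \<open>T_k(Z) e\<close>.
  Orthogonality of the residuals compares this with the PCG error; the normalisation is the value of
  \<open>T_k\<close> at the image of 0, which is at least \<open>q^(-k) / 2\<close>. Two points
  shape the geometry. Nestedness of the spaces needs hat functions of interior vertices to vanish on
  the whole frontier, which rests on the domain lying on one side of its boundary. And meshes may
  have no interior vertex at all, so the cost of all levels is compared with
  \<open>h_L^(-d)\<close>, and only afterwards, for a nonempty finest level, with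
  \<open>n_L\<close>. The cost constant is chosen before the number of levels, the meshes and the
  data. It may therefore depend only on the dimension, a ball around the domain, a ball inside it,
  \<open>\<sigma>\<close>, \<open>\<gamma>\<close> and the step numbers \<open>k\<close>.\<close>

lemma inner_on_commute: "inner_on I x y = inner_on I y x"
  by (simp add: inner_on_def mult.commute)

lemma inner_on_cong: "(\<And>v. v \<in> I \<Longrightarrow> x v = x' v) \<Longrightarrow> (\<And>v. v \<in> I \<Longrightarrow> y v = y' v) \<Longrightarrow> inner_on I x y = inner_on I x' y'"
  by (simp add: inner_on_def cong: sum.cong)

lemma inner_on_linear:
  "inner_on I x (\<lambda>v. y v + z v) = inner_on I x y + inner_on I x z"
  "inner_on I x (\<lambda>v. y v - z v) = inner_on I x y - inner_on I x z"
  "inner_on I x (\<lambda>v. c * y v) = c * inner_on I x y"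
  "inner_on I (\<lambda>v. y v + z v) x = inner_on I y x + inner_on I z x"
  "inner_on I (\<lambda>v. y v - z v) x = inner_on I y x - inner_on I z x"
  "inner_on I (\<lambda>v. c * y v) x = c * inner_on I y x"
  by (simp_all add: inner_on_def algebra_simps sum.distrib sum_subtractf sum_distrib_left)

lemma inner_on_sum_left: "inner_on I (\<lambda>v. \<Sum>j\<in>J. f j v) y = (\<Sum>j\<in>J. inner_on I (f j) y)"
  unfolding inner_on_def sum_distrib_right by (rule sum.swap)

lemma mat_vec_linear:
  "mat_vec I A (\<lambda>v. y v + z v) = (\<lambda>v. mat_vec I A y v + mat_vec I A z v)"
  "mat_vec I A (\<lambda>v. y v - z v) = (\<lambda>v. mat_vec I A y v - mat_vec I A z v)"
  "mat_vec I A (\<lambda>v. c * y v) = (\<lambda>v. c * mat_vec I A y v)"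
  by (simp_all add: mat_vec_def fun_eq_iff algebra_simps sum.distrib sum_subtractf sum_distrib_left)

lemma mat_vec_zero: "mat_vec I A (\<lambda>v. 0) = (\<lambda>v. 0)"
  by (simp add: mat_vec_def fun_eq_iff)

lemma mat_vec_sum:
  "mat_vec I A (\<lambda>v. \<Sum>j\<in>J. c j * f j v) = (\<lambda>v. \<Sum>j\<in>J. c j * mat_vec I A (f j) v)"
proof
  fix v
  have "(\<Sum>w\<in>I. A v w * (\<Sum>j\<in>J. c j * f j w)) = (\<Sum>w\<in>I. \<Sum>j\<in>J. c j * (A v w * f j w))"
    by (simp add: sum_distrib_left algebra_simps)
  also have "\<dots> = (\<Sum>j\<in>J. \<Sum>w\<in>I. c j * (A v w * f j w))"
    by (rule sum.swap)
  finally show "mat_vec I A (\<lambda>v. \<Sum>j\<in>J. c j * f j v) v = (\<Sum>j\<in>J. c j * mat_vec I A (f j) v)"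
    by (simp add: mat_vec_def sum_distrib_left)
qed

lemma inner_on_mat_vec_commute:
  assumes "\<And>v w. v \<in> I \<Longrightarrow> w \<in> I \<Longrightarrow> A v w = A w v"
  shows "inner_on I x (mat_vec I A y) = inner_on I (mat_vec I A x) y"
proof -
  have "inner_on I x (mat_vec I A y) = (\<Sum>v\<in>I. \<Sum>w\<in>I. x v * A v w * y w)"
    by (simp add: inner_on_def mat_vec_def sum_distrib_left algebra_simps)
  also have "\<dots> = (\<Sum>w\<in>I. \<Sum>v\<in>I. x v * A v w * y w)"
    by (rule sum.swap)
  also have "\<dots> = (\<Sum>w\<in>I. \<Sum>v\<in>I. x v * A w v * y w)"
    using assms by (intro sum.cong refl) auto
  also have "\<dots> = inner_on I (mat_vec I A x) y"
    by (simp add: inner_on_def mat_vec_def sum_distrib_left sum_distrib_right mult_ac)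
  finally show ?thesis .
qed

lemma nonneg_quadratic_discriminant:
  fixes a b c :: real
  assumes "\<And>t. 0 \<le> a + 2 * t * b + t\<^sup>2 * c" and "0 \<le> c"
  shows "b\<^sup>2 \<le> a * c"
proof (cases "c = 0")
  case True
  \<comment> \<open>For \<open>b \<noteq> 0\<close> the chosen \<open>t\<close> gives the affine
    function the value -1.\<close>
  then have "b = 0"
    using assms(1)[of "- (a + 1) / (2 * b)"] by (cases "b = 0") (simp_all add: field_simps)
  then show ?thesis using True by simp
next
  case False
  then have "0 < c" using assms(2) by simp
  have "0 \<le> a + 2 * (- b / c) * b + (- b / c)\<^sup>2 * c" by (rule assms)
  also have "\<dots> = a - b\<^sup>2 / c" using \<open>0 < c\<close> by (simp add: field_simps power2_eq_square)
  finally show ?thesis using \<open>0 < c\<close> by (simp add: field_simps)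
qed

text \<open>Gaussian elimination of the unknown \<open>a\<close>; the Schur complement is again positive definite.\<close>

lemma positive_definite_solvable:
  assumes "finite I"
    and "\<And>x. (\<exists>v\<in>I. x v \<noteq> 0) \<Longrightarrow> 0 < inner_on I x (mat_vec I A x)"
  shows "\<exists>x. \<forall>v\<in>I. mat_vec I A x v = b v"
  using assms
proof (induction I arbitrary: A b rule: finite_induct)
  case empty
  then show ?case by simp
next
  case (insert a I)
  have pos: "0 < A a a"
  proof -
    define x where "x = (\<lambda>v. if v = a then 1 else 0 :: real)"
    have "x v = 0" if "v \<in> I" for v using that insert.hyps by (auto simp: x_def)
    then have "inner_on (insert a I) x (mat_vec (insert a I) A x) = A a a"
      using insert.hyps by (simp add: inner_on_def mat_vec_def) (simp add: x_def)
    then show ?thesis using insert.prems[of x] by (simp add: x_def)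
  qed
  define A' where "A' v w = A v w - A v a * A a w / A a a" for v w
  \<comment> \<open>The value at the pivot \<open>a\<close> is chosen so that row \<open>a\<close>
    of the product equals \<open>t\<close>: \<open>t = 0\<close> serves positivity of the Schur
    complement, \<open>t = b a\<close> the back substitution.\<close>
  define ext where "ext x t = (\<lambda>v. if v = a then (t - mat_vec I A x a) / A a a else x v)" for x t
  have ext_I: "mat_vec I A (ext x t) = mat_vec I A x" for x t
    using insert.hyps by (auto simp: ext_def mat_vec_def fun_eq_iff intro!: sum.cong)
  have mv: "mat_vec (insert a I) A (ext x t) v = A v a * (t - mat_vec I A x a) / A a a + mat_vec I A x v" for x t v
    using insert.hyps ext_I[of x t] by (simp add: mat_vec_def fun_eq_iff) (simp add: ext_def mat_vec_def)
  have mv_a: "mat_vec (insert a I) A (ext x t) a = t" for x t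
    using pos by (simp add: mv)
  have mv': "mat_vec I A' x v = mat_vec I A x v - A v a * mat_vec I A x a / A a a" for x v
    by (simp add: mat_vec_def A'_def left_diff_distrib sum_subtractf sum_distrib_left sum_divide_distrib mult.assoc)
  have "\<exists>x. \<forall>v\<in>I. mat_vec I A' x v = b v - A v a * b a / A a a"
  proof (rule insert.IH)
    fix x :: "'a \<Rightarrow> real"
    assume "\<exists>v\<in>I. x v \<noteq> 0"
    then have "\<exists>v\<in>insert a I. ext x 0 v \<noteq> 0"
      using insert.hyps by (auto simp: ext_def)
    then have "0 < inner_on (insert a I) (ext x 0) (mat_vec (insert a I) A (ext x 0))"
      by (rule insert.prems)
    also have "\<dots> = inner_on I (ext x 0) (mat_vec (insert a I) A (ext x 0))"
      using insert.hyps by (simp add: inner_on_def mv_a)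
    also have "\<dots> = inner_on I x (mat_vec I A' x)"
      using insert.hyps by (intro inner_on_cong) (auto simp: mv mv', auto simp: ext_def)
    finally show "0 < inner_on I x (mat_vec I A' x)" .
  qed
  then obtain x where x: "\<forall>v\<in>I. mat_vec I A' x v = b v - A v a * b a / A a a" by blast
  have "mat_vec (insert a I) A (ext x (b a)) v = b v" if "v \<in> insert a I" for v
  proof (cases "v = a")
    case False
    then have "mat_vec I A x v = b v - A v a * b a / A a a + A v a * mat_vec I A x a / A a a"
      using that x mv'[of x v] by simp
    then show ?thesis by (simp add: mv right_diff_distrib diff_divide_distrib)
  qed (simp add: mv_a)
  then show ?case by blast
qed

section \<open>The energy product of a symmetric positive definite pencil\<close>

locale spd_pencil =
  fixes I :: "'v set" and A D :: "'v \<Rightarrow> 'v \<Rightarrow> real" and lmin lmax :: real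
  assumes finite_I: "finite I"
    and sym: "v \<in> I \<Longrightarrow> w \<in> I \<Longrightarrow> A v w = A w v"
    and D_pos: "v \<in> I \<Longrightarrow> 0 < D v v"
    and lmin_pos: "0 < lmin" and lmin_less: "lmin < lmax"
    and lower: "lmin * (\<Sum>v\<in>I. D v v * (x v)\<^sup>2) \<le> inner_on I x (mat_vec I A x)"
    and upper: "inner_on I x (mat_vec I A x) \<le> lmax * (\<Sum>v\<in>I. D v v * (x v)\<^sup>2)"
begin

abbreviation ip where "ip \<equiv> inner_on I"
abbreviation mv where "mv \<equiv> mat_vec I A"

definition energy :: "('v \<Rightarrow> real) \<Rightarrow> ('v \<Rightarrow> real) \<Rightarrow> real" where
  "energy x y = ip x (mv y)"

text \<open>The preconditioned matrix \<open>D^(-1) A\<close>, which is self-adjoint in the energy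
  product (\<open>energy_B_commute\<close>), though in general not in the Euclidean one.\<close>

definition B :: "('v \<Rightarrow> real) \<Rightarrow> 'v \<Rightarrow> real" where
  "B x = (\<lambda>v. mv x v / D v v)"

definition Dnorm2 :: "('v \<Rightarrow> real) \<Rightarrow> real" where
  "Dnorm2 x = (\<Sum>v\<in>I. D v v * (x v)\<^sup>2)"

lemma energy_linear:
  "energy x (\<lambda>v. y v + z v) = energy x y + energy x z"
  "energy x (\<lambda>v. y v - z v) = energy x y - energy x z"
  "energy x (\<lambda>v. c * y v) = c * energy x y"
  "energy (\<lambda>v. y v + z v) x = energy y x + energy z x"
  "energy (\<lambda>v. y v - z v) x = energy y x - energy z x"
  "energy (\<lambda>v. c * y v) x = c * energy y x"
  by (simp_all add: energy_def inner_on_linear mat_vec_linear)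

lemma energy_commute: "energy x y = energy y x"
  unfolding energy_def by (metis inner_on_commute inner_on_mat_vec_commute sym)

lemma B_linear:
  "B (\<lambda>v. y v + z v) = (\<lambda>v. B y v + B z v)"
  "B (\<lambda>v. y v - z v) = (\<lambda>v. B y v - B z v)"
  "B (\<lambda>v. c * y v) = (\<lambda>v. c * B y v)"
  by (simp_all add: B_def mat_vec_linear fun_eq_iff add_divide_distrib diff_divide_distrib)

lemma Dnorm2_nonneg: "0 \<le> Dnorm2 x"
  unfolding Dnorm2_def using D_pos by (intro sum_nonneg) (simp add: less_imp_le)

lemma energy_lower: "lmin * Dnorm2 x \<le> energy x x"
  and energy_upper: "energy x x \<le> lmax * Dnorm2 x"
  using lower upper by (simp_all add: energy_def Dnorm2_def)

lemma energy_nonneg: "0 \<le> energy x x"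
  using energy_lower[of x] Dnorm2_nonneg[of x] lmin_pos by (smt (verit) mult_nonneg_nonneg)

lemma energy_Cauchy_Schwarz: "(energy x y)\<^sup>2 \<le> energy x x * energy y y"
proof (rule nonneg_quadratic_discriminant)
  fix t
  have "0 \<le> energy (\<lambda>v. x v + t * y v) (\<lambda>v. x v + t * y v)" by (rule energy_nonneg)
  also have "\<dots> = energy x x + 2 * t * energy x y + t\<^sup>2 * energy y y"
    by (simp add: energy_linear energy_commute[of y x] power2_eq_square algebra_simps)
  finally show "0 \<le> energy x x + 2 * t * energy x y + t\<^sup>2 * energy y y" .
qed (rule energy_nonneg)

lemma energy_B: "energy x (B y) = (\<Sum>v\<in>I. D v v * B x v * B y v)"
proof -
  have "energy x (B y) = ip (mv x) (B y)"
    unfolding energy_def by (rule inner_on_mat_vec_commute) (rule sym)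
  also have "\<dots> = (\<Sum>v\<in>I. D v v * B x v * B y v)"
    unfolding inner_on_def B_def using D_pos by (intro sum.cong refl) force
  finally show ?thesis .
qed

lemma energy_B_commute: "energy (B x) y = energy x (B y)"
  by (subst energy_commute, simp add: energy_B mult.commute mult.left_commute)

lemma energy_B_self: "energy x (B x) = Dnorm2 (B x)"
  by (simp add: energy_B Dnorm2_def power2_eq_square mult.assoc)

text \<open>The form bounds of the locale move to the energy product: as
  \<open>energy x (B x) = Dnorm2 (B x)\<close>, Cauchy-Schwarz for \<open>x\<close> and
  \<open>B x\<close> and the upper bound at the vector \<open>B x\<close> leave one common factor
  \<open>Dnorm2 (B x)\<close> to cancel.\<close>

lemma energy_B_upper: "energy x (B x) \<le> lmax * energy x x"
proof -
  have "(Dnorm2 (B x))\<^sup>2 \<le> energy x x * energy (B x) (B x)"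
    using energy_Cauchy_Schwarz[of x "B x"] by (simp add: energy_B_self)
  also have "\<dots> \<le> energy x x * (lmax * Dnorm2 (B x))"
    by (intro mult_left_mono energy_upper energy_nonneg)
  finally have "Dnorm2 (B x) * Dnorm2 (B x) \<le> (lmax * energy x x) * Dnorm2 (B x)"
    by (simp add: power2_eq_square algebra_simps)
  moreover have "0 \<le> lmax * energy x x"
    using energy_nonneg[of x] lmin_pos lmin_less by simp
  ultimately show ?thesis
    using Dnorm2_nonneg[of "B x"] mult_le_cancel_right
    unfolding energy_B_self by (metis order_le_less)
qed

text \<open>\<open>energy x x\<close> is the \<open>D\<close>-weighted product of \<open>x\<close>
  and \<open>B x\<close>; Cauchy-Schwarz for that product and the lower bound at \<open>x\<close>
  give the claim after cancelling \<open>energy x x\<close>.\<close>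

lemma energy_B_lower: "lmin * energy x x \<le> energy x (B x)"
proof -
  have *: "energy x x = (\<Sum>v\<in>I. D v v * x v * B x v)"
    unfolding energy_def inner_on_def B_def using D_pos by (intro sum.cong refl) force
  have "(energy x x)\<^sup>2 \<le> Dnorm2 x * Dnorm2 (B x)"
  proof (rule nonneg_quadratic_discriminant)
    fix t
    have "0 \<le> Dnorm2 (\<lambda>v. x v + t * B x v)" by (rule Dnorm2_nonneg)
    also have "\<dots> = Dnorm2 x + 2 * t * energy x x + t\<^sup>2 * Dnorm2 (B x)"
      unfolding * by (simp add: Dnorm2_def power2_eq_square algebra_simps sum.distrib sum_distrib_left)
    finally show "0 \<le> Dnorm2 x + 2 * t * energy x x + t\<^sup>2 * Dnorm2 (B x)" .
  qed (rule Dnorm2_nonneg)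
  then have "lmin * (energy x x * energy x x) \<le> lmin * Dnorm2 x * Dnorm2 (B x)"
    using lmin_pos by (simp add: power2_eq_square)
  also have "\<dots> \<le> energy x x * Dnorm2 (B x)"
    by (intro mult_right_mono energy_lower Dnorm2_nonneg)
  finally have "lmin * energy x x * energy x x \<le> Dnorm2 (B x) * energy x x"
    by (simp add: algebra_simps)
  then show ?thesis
    using energy_nonneg[of x] Dnorm2_nonneg[of "B x"] mult_le_cancel_right
    unfolding energy_B_self by (metis mult_zero_right order_le_less)
qed

section \<open>Chebyshev polynomials of the preconditioned matrix\<close>

definition mid :: real where "mid = (lmax + lmin) / (lmax - lmin)"

definition slope :: real where "slope = 2 / (lmax - lmin)"

text \<open>The map \<open>t \<mapsto> mid - slope * t\<close> sends \<open>lmin\<close> to 1,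
  \<open>lmax\<close> to -1 and 0 to \<open>mid\<close>. So \<open>Z\<close> corresponds to a
  spectrum in \<open>[-1, 1]\<close>, and \<open>mid\<close> is the point at which the error
  polynomials are normalised.\<close>

definition Z :: "('v \<Rightarrow> real) \<Rightarrow> 'v \<Rightarrow> real" where
  "Z x = (\<lambda>v. mid * x v - slope * B x v)"

lemma Z_linear:
  "Z (\<lambda>v. y v + z v) = (\<lambda>v. Z y v + Z z v)"
  "Z (\<lambda>v. y v - z v) = (\<lambda>v. Z y v - Z z v)"
  "Z (\<lambda>v. c * y v) = (\<lambda>v. c * Z y v)"
  unfolding Z_def B_linear by (simp_all add: fun_eq_iff algebra_simps)

lemma Z_zero: "Z (\<lambda>v. 0) = (\<lambda>v. 0)"
  by (simp add: Z_def B_def mat_vec_zero fun_eq_iff)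

lemma energy_Z_commute: "energy (Z x) y = energy x (Z y)"
  unfolding Z_def energy_linear by (simp only: energy_B_commute)

lemma energy_Z_abs: "\<bar>energy x (Z x)\<bar> \<le> energy x x"
proof -
  have e: "(lmax - lmin) * energy x (Z x) = (lmax + lmin) * energy x x - 2 * energy x (B x)"
  proof -
    define g where "g = lmax - lmin"
    have "g \<noteq> 0" using lmin_less by (simp add: g_def)
    have "energy x (Z x) = mid * energy x x - 2 / g * energy x (B x)"
      unfolding g_def slope_def[symmetric] by (simp only: Z_def energy_linear)
    then have "g * energy x (Z x) = (g * mid) * energy x x - 2 * energy x (B x)"
      using \<open>g \<noteq> 0\<close> by (simp add: right_diff_distrib)
    moreover have "g * mid = lmax + lmin" using lmin_less by (simp add: mid_def g_def)
    ultimately show ?thesis by (simp add: g_def)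
  qed
  have "(lmax - lmin) * energy x (Z x) \<le> (lmax - lmin) * energy x x"
    and "- ((lmax - lmin) * energy x (Z x)) \<le> (lmax - lmin) * energy x x"
    unfolding e using energy_B_lower[of x] energy_B_upper[of x] by (simp_all add: algebra_simps)
  then have "energy x (Z x) \<le> energy x x" and "- energy x (Z x) \<le> energy x x"
    using lmin_less mult_le_cancel_left_pos[of "lmax - lmin" "- energy x (Z x)" "energy x x"] by simp_all
  then show ?thesis by linarith
qed

text \<open>For a self-adjoint operator the quadratic form controls the norm: polarisation and the
  parallelogram law turn \<open>energy_Z_abs\<close> into a bound for \<open>energy y (Z x)\<close>,
  and \<open>y = Z x\<close> gives the norm.\<close>

lemma energy_Z_contraction: "energy (Z x) (Z x) \<le> energy x x"
proof -
  have polar: "4 * energy y (Z x) \<le> 2 * (energy x x + energy y y)" for y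
  proof -
    have "4 * energy y (Z x) = energy (\<lambda>v. x v + y v) (Z (\<lambda>v. x v + y v)) - energy (\<lambda>v. x v - y v) (Z (\<lambda>v. x v - y v))"
      by (simp add: Z_linear energy_linear energy_Z_commute[of y x, symmetric] energy_commute[of "Z y" x] algebra_simps)
    also have "\<dots> \<le> energy (\<lambda>v. x v + y v) (\<lambda>v. x v + y v) + energy (\<lambda>v. x v - y v) (\<lambda>v. x v - y v)"
      using energy_Z_abs[of "\<lambda>v. x v + y v"] energy_Z_abs[of "\<lambda>v. x v - y v"] by linarith
    also have "\<dots> = 2 * (energy x x + energy y y)"
      by (simp add: energy_linear algebra_simps)
    finally show ?thesis .
  qed
  from polar[of "Z x"] show ?thesis by simp
qed

text \<open>\<open>cheb e k\<close> is the pair \<open>(T\<^sub>k(Z) e, U\<^sub>k\<^sub>-\<^sub>1(Z) e)\<close> of Chebyshev polynomials of both kinds.\<close>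

primrec cheb :: "('v \<Rightarrow> real) \<Rightarrow> nat \<Rightarrow> ('v \<Rightarrow> real) \<times> ('v \<Rightarrow> real)" where
  "cheb e 0 = (e, \<lambda>v. 0)"
| "cheb e (Suc k) =
     (let U = (\<lambda>v. fst (cheb e k) v + Z (snd (cheb e k)) v)
      in (\<lambda>v. Z U v - snd (cheb e k) v, U))"

text \<open>This is \<open>T\<^sub>k\<^sup>2 + (1 - Z\<^sup>2) U\<^sub>k\<^sub>-\<^sub>1\<^sup>2 = 1\<close>, which together with the contractivity of \<open>Z\<close>
  replaces the spectral theorem.\<close>

lemma cheb_pythagoras:
  "energy (fst (cheb e k)) (fst (cheb e k)) + energy (snd (cheb e k)) (snd (cheb e k))
     - energy (Z (snd (cheb e k))) (Z (snd (cheb e k))) = energy e e"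
proof (induction k)
  case 0
  have "energy (\<lambda>v. 0) x = 0" for x by (simp add: energy_def inner_on_def)
  then show ?case by (simp add: Z_zero)
next
  case (Suc k)
  define T U where "T = fst (cheb e k)" and "U = snd (cheb e k)"
  define W where "W = (\<lambda>v. T v + Z U v)"
  have "energy (\<lambda>v. Z W v - U v) (\<lambda>v. Z W v - U v) + energy W W - energy (Z W) (Z W)
    = energy W W - 2 * energy (Z W) U + energy U U"
    by (simp add: energy_linear energy_commute[of U "Z W"])
  also have "\<dots> = energy W W - 2 * energy W (Z U) + energy U U"
    by (simp add: energy_Z_commute)
  also have "\<dots> = energy T T + energy U U - energy (Z U) (Z U)"
    by (simp add: W_def energy_linear energy_commute[of "Z U" T])
  finally show ?case
    using Suc.IH by (simp add: Let_def T_def U_def W_def)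
qed

text \<open>The operator form of \<open>|T_k| \<le> 1\<close> on \<open>[-1, 1]\<close>: by
  contractivity the two terms with the second component together contribute a nonnegative amount to
  \<open>cheb_pythagoras\<close>.\<close>

lemma energy_cheb_le: "energy (fst (cheb e k)) (fst (cheb e k)) \<le> energy e e"
  using cheb_pythagoras[of e k] energy_Z_contraction[of "snd (cheb e k)"] by linarith

definition rate :: real where
  "rate = (sqrt (lmax / lmin) - 1) / (sqrt (lmax / lmin) + 1)"

text \<open>\<open>mid_rate\<close> says that \<open>mid = cosh \<theta>\<close> with
  \<open>rate = exp (- \<theta>)\<close>. It turns Chebyshev polynomials at \<open>mid\<close> into
  sums of powers of \<open>rate\<close>, and it is where the square root of the condition number
  enters.\<close>

lemma rate_pos: "0 < rate" and mid_rate: "mid = (inverse rate + rate) / 2" and rate_less_1: "rate < 1"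
proof -
  define s where "s = sqrt (lmax / lmin)"
  have s: "1 < s" and s2: "lmax = s\<^sup>2 * lmin"
    using lmin_pos lmin_less by (simp_all add: s_def)
  have r: "rate = (s - 1) / (s + 1)" by (simp add: rate_def s_def)
  show "0 < rate" "rate < 1" using s by (simp_all add: r)
  have "mid = (lmax + lmin) / (lmax - lmin)" by (rule mid_def)
  also have "\<dots> = (s\<^sup>2 * lmin + lmin) / (s\<^sup>2 * lmin - lmin)"
    using arg_cong[OF s2, of "\<lambda>t. (t + lmin) / (t - lmin)"] .
  also have "\<dots> = (lmin * (s\<^sup>2 + 1)) / (lmin * (s\<^sup>2 - 1))" by (simp add: algebra_simps)
  also have "\<dots> = (s\<^sup>2 + 1) / (s\<^sup>2 - 1)" using lmin_pos by simp
  finally have m: "mid = (s\<^sup>2 + 1) / (s\<^sup>2 - 1)" .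
  have "s\<^sup>2 - 1 = (s - 1) * (s + 1)" by (simp add: power2_eq_square algebra_simps)
  then show "mid = (inverse rate + rate) / 2"
    unfolding m r using s by (simp add: divide_simps) (simp add: power2_eq_square algebra_simps)
qed

text \<open>With that \<open>\<theta>\<close> this is \<open>cosh (k \<theta>)\<close>, that is
  \<open>T_k(mid)\<close>; likewise \<open>cheb_U k\<close> is
  \<open>sinh (k \<theta>) / sinh \<theta>\<close>, that is \<open>U_(k-1)(mid)\<close> with the
  same index shift as in \<open>cheb\<close>.\<close>

definition cheb_T :: "nat \<Rightarrow> real" where
  "cheb_T k = (inverse rate ^ k + rate ^ k) / 2"

definition cheb_U :: "nat \<Rightarrow> real" where
  "cheb_U k = (inverse rate ^ k - rate ^ k) / (inverse rate - rate)"

text \<open>The recursion of \<open>cheb\<close> with \<open>Z\<close> replaced by the number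
  \<open>mid\<close>, which lets \<open>cheb_krylov\<close> follow vectors and scalars in
  parallel.\<close>

lemma cheb_real_Suc:
  "cheb_U (Suc k) = cheb_T k + mid * cheb_U k"
  "cheb_T (Suc k) = mid * cheb_U (Suc k) - cheb_U k"
proof -
  define a c i where "a = inverse rate ^ k" and "c = rate ^ k" and "i = inverse rate"
  have ir: "i * rate = 1" using rate_pos by (simp add: i_def)
  have ne: "i - rate \<noteq> 0"
    using rate_pos rate_less_1 one_less_inverse[of rate] by (simp add: i_def)
  have U: "cheb_U (Suc k) = (i * a - rate * c) / (i - rate)" and u: "cheb_U k = (a - c) / (i - rate)"
    and T: "cheb_T (Suc k) = (i * a + rate * c) / 2" and t: "cheb_T k = (a + c) / 2" and m: "mid = (i + rate) / 2"
    by (simp_all add: cheb_U_def cheb_T_def mid_rate a_def c_def i_def)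
  show "cheb_U (Suc k) = cheb_T k + mid * cheb_U k"
    unfolding U u t m using ne by (simp add: divide_simps) (simp add: algebra_simps)
  have "(i * a + rate * c) * (i - rate) = (i + rate) * (i * a - rate * c) - 2 * (i * rate) * (a - c)"
    by (simp add: algebra_simps)
  then have "i * a + rate * c = ((i + rate) * (i * a - rate * c) - 2 * (a - c)) / (i - rate)"
    using ne by (simp add: eq_divide_eq ir)
  moreover have "((p * N - 2 * L) / g) / 2 = p / 2 * (N / g) - L / g" for p N L g :: real
    by (simp add: diff_divide_distrib)
  ultimately show "cheb_T (Suc k) = mid * cheb_U (Suc k) - cheb_U k"
    unfolding U u T m by (simp only:)
qed

lemma energy_pos:
  assumes "v \<in> I" and "x v \<noteq> 0"
  shows "0 < energy x x"
proof -
  have "0 < D v v * (x v)\<^sup>2" using assms D_pos by simp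
  also have "\<dots> \<le> Dnorm2 x"
    unfolding Dnorm2_def using assms finite_I D_pos
    by (intro member_le_sum) (auto simp: less_imp_le)
  finally have "0 < lmin * Dnorm2 x" using lmin_pos by simp
  with energy_lower[of x] show ?thesis by linarith
qed

section \<open>PCG as a Krylov space method\<close>

context
  fixes b x0 y :: "'v \<Rightarrow> real"
  assumes exact: "v \<in> I \<Longrightarrow> mv y v = b v"
begin

definition state where "state k = (pcg_step I A D ^^ k) (pcg_init I A D b x0)"
definition X where "X k = fst (state k)"
definition R where "R k = fst (snd (state k))"
definition P where "P k = snd (snd (state k))"
definition pre where "pre k = (\<lambda>v. R k v / D v v)"
definition rz where "rz k = ip (R k) (pre k)"
definition step where "step k = rz k / energy (P k) (P k)"

lemma state_0: "X 0 = x0" "R 0 = (\<lambda>v. b v - mv x0 v)" "P 0 = pre 0"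
  by (simp_all add: X_def R_def P_def pre_def state_def pcg_init_def Let_def)

lemma state_Suc:
  "X (Suc k) = (\<lambda>v. X k v + step k * P k v)"
  "R (Suc k) = (\<lambda>v. R k v - step k * mv (P k) v)"
  "P (Suc k) = (\<lambda>v. pre (Suc k) v + rz (Suc k) / rz k * P k v)"
  by (simp_all add: X_def R_def P_def pre_def rz_def step_def energy_def state_def pcg_step_def Let_def case_prod_beta)

lemma R_eq: "R k = (\<lambda>v. b v - mv (X k) v)"
  by (induction k) (simp_all add: state_0 state_Suc mat_vec_linear algebra_simps)

lemma pre_Suc: "pre (Suc k) = (\<lambda>v. pre k v - step k * B (P k) v)"
  by (simp add: pre_def state_Suc B_def diff_divide_distrib)

lemma rz_eq: "rz k = Dnorm2 (pre k)"
  unfolding rz_def Dnorm2_def inner_on_def pre_def using D_pos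
  by (intro sum.cong refl) (force simp: power2_eq_square)

lemma rz_zero: "rz k = 0 \<Longrightarrow> v \<in> I \<Longrightarrow> R k v = 0"
proof -
  assume "rz k = 0" "v \<in> I"
  then have "D v v * (pre k v)\<^sup>2 = 0"
    unfolding rz_eq Dnorm2_def using D_pos finite_I
    by (subst (asm) sum_nonneg_eq_0_iff) (auto simp: less_imp_le)
  then show ?thesis using D_pos[OF \<open>v \<in> I\<close>] by (simp add: pre_def)
qed

text \<open>The quotient in \<open>step k\<close> then has numerator 0, so the residual stays zero
  for ever. Only runs whose earlier \<open>rz\<close> are all nonzero need the Krylov
  argument.\<close>

lemma rz_zero_Suc: "rz k = 0 \<Longrightarrow> rz (Suc k) = 0"
  by (simp add: rz_def[of "Suc k"] inner_on_def state_Suc step_def rz_zero)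

text \<open>Spanned by the search directions, which makes orthogonality easy to use; that
  \<open>B\<close> moves this space only to the next larger one is the content of
  \<open>B_krylov\<close>. Equality is asked on \<open>I\<close> only, since coefficients outside
  \<open>I\<close> carry no meaning.\<close>

definition krylov :: "nat \<Rightarrow> ('v \<Rightarrow> real) set" where
  "krylov k = {x. \<exists>c. \<forall>v\<in>I. x v = (\<Sum>j<k. c j * P j v)}"

lemma krylov_cong: "x \<in> krylov k \<Longrightarrow> (\<And>v. v \<in> I \<Longrightarrow> z v = x v) \<Longrightarrow> z \<in> krylov k"
  by (simp add: krylov_def)

lemma krylov_zero: "(\<lambda>v. 0) \<in> krylov k"
  unfolding krylov_def by (rule CollectI, rule exI[of _ "\<lambda>j. 0"]) simp

lemma krylov_add: "x \<in> krylov k \<Longrightarrow> z \<in> krylov k \<Longrightarrow> (\<lambda>v. x v + z v) \<in> krylov k"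
proof -
  assume "x \<in> krylov k" "z \<in> krylov k"
  then obtain c d where "\<forall>v\<in>I. x v = (\<Sum>j<k. c j * P j v)" "\<forall>v\<in>I. z v = (\<Sum>j<k. d j * P j v)"
    unfolding krylov_def by blast
  then have "\<forall>v\<in>I. x v + z v = (\<Sum>j<k. (c j + d j) * P j v)"
    by (simp add: algebra_simps sum.distrib)
  then show ?thesis unfolding krylov_def mem_Collect_eq by (rule exI[of _ "\<lambda>j. c j + d j"])
qed

lemma krylov_scale: "x \<in> krylov k \<Longrightarrow> (\<lambda>v. a * x v) \<in> krylov k"
proof -
  assume "x \<in> krylov k"
  then obtain c where "\<forall>v\<in>I. x v = (\<Sum>j<k. c j * P j v)"
    unfolding krylov_def by blast
  then have "\<forall>v\<in>I. a * x v = (\<Sum>j<k. (a * c j) * P j v)"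
    by (simp add: algebra_simps sum_distrib_left)
  then show ?thesis unfolding krylov_def mem_Collect_eq by (rule exI[of _ "\<lambda>j. a * c j"])
qed

lemma krylov_diff: "x \<in> krylov k \<Longrightarrow> z \<in> krylov k \<Longrightarrow> (\<lambda>v. x v - z v) \<in> krylov k"
  using krylov_add[OF _ krylov_scale[of z k "-1"]] by simp

lemma krylov_sum: "finite J \<Longrightarrow> (\<And>j. j \<in> J \<Longrightarrow> f j \<in> krylov k) \<Longrightarrow> (\<lambda>v. \<Sum>j\<in>J. f j v) \<in> krylov k"
  by (induction J rule: finite_induct) (simp_all add: krylov_zero krylov_add)

lemma P_in_krylov: "j < k \<Longrightarrow> P j \<in> krylov k"
  unfolding krylov_def
  by (rule CollectI, rule exI[of _ "\<lambda>i. if i = j then 1 else 0"])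
    (simp add: if_distrib[of "\<lambda>t. t * _"] cong: if_cong)

lemma krylovE:
  assumes "x \<in> krylov k"
  obtains c where "\<forall>v\<in>I. x v = (\<Sum>j<k. c j * P j v)"
  using assms unfolding krylov_def by blast

lemma krylov_mono:
  assumes "x \<in> krylov k" and "k \<le> l"
  shows "x \<in> krylov l"
proof -
  obtain c where "\<forall>v\<in>I. x v = (\<Sum>j<k. c j * P j v)"
    using assms(1) by (rule krylovE)
  moreover have "(\<lambda>v. \<Sum>j<k. c j * P j v) \<in> krylov l"
    using assms(2) by (intro krylov_sum krylov_scale P_in_krylov) auto
  ultimately show ?thesis by (metis (no_types, lifting) krylov_cong)
qed

lemma pre_in_krylov: "pre j \<in> krylov (Suc j)"
proof (cases j)
  case 0
  then show ?thesis using P_in_krylov[of 0 1] by (simp add: state_0)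
next
  case (Suc i)
  have "pre (Suc i) = (\<lambda>v. P (Suc i) v - rz (Suc i) / rz i * P i v)"
    by (simp add: state_Suc)
  also have "\<dots> \<in> krylov (Suc j)"
    unfolding Suc by (intro krylov_diff krylov_scale P_in_krylov) auto
  finally show ?thesis unfolding Suc .
qed

lemma krylov_orthogonal:
  assumes "\<And>i. i < k \<Longrightarrow> ip r (P i) = 0" and "x \<in> krylov k"
  shows "ip r x = 0"
proof -
  obtain c where c: "\<forall>v\<in>I. x v = (\<Sum>j<k. c j * P j v)"
    using assms(2) by (rule krylovE)
  have "ip r x = ip r (\<lambda>v. \<Sum>j<k. c j * P j v)"
    by (intro inner_on_cong) (simp_all add: c)
  also have "\<dots> = 0"
    using assms(1) by (simp add: inner_on_commute[of I r] inner_on_sum_left inner_on_linear)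
  finally show ?thesis .
qed

text \<open>No breakdown before the residual vanishes: of \<open>P k\<close> only the part
  \<open>pre k\<close> has a nonzero product with \<open>R k\<close>, so this product is
  \<open>rz k\<close>, \<open>P k\<close> is nonzero on \<open>I\<close>, and definiteness
  applies.\<close>

lemma step_pos:
  assumes "\<And>i. i < k \<Longrightarrow> ip (R k) (P i) = 0" and "rz k \<noteq> 0"
  shows "ip (R k) (P k) = rz k" and "0 < energy (P k) (P k)" and "0 < step k"
proof -
  show eq: "ip (R k) (P k) = rz k"
  proof (cases k)
    case 0
    then show ?thesis by (simp add: state_0 rz_def)
  next
    case (Suc i)
    have "ip (R k) (P k) = ip (R k) (pre k) + rz k / rz i * ip (R k) (P i)"
      unfolding Suc state_Suc(3) by (simp only: inner_on_linear)
    then show ?thesis using assms(1)[of i] Suc by (simp add: rz_def)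
  qed
  have "\<exists>v\<in>I. P k v \<noteq> 0"
  proof (rule ccontr)
    assume "\<not> (\<exists>v\<in>I. P k v \<noteq> 0)"
    then have "ip (R k) (P k) = 0" by (simp add: inner_on_def)
    then show False using eq assms(2) by simp
  qed
  then show e: "0 < energy (P k) (P k)" using energy_pos by blast
  have "0 < rz k" using assms(2) Dnorm2_nonneg[of "pre k"] by (simp add: rz_eq)
  then show "0 < step k" using e by (simp add: step_def)
qed

text \<open>Residual orthogonality and conjugacy are proved in one strong induction because each
  feeds the other. Against the latest direction they hold by the choice of the step length and of
  the direction coefficient, against older ones by the short recurrences.\<close>

lemma pcg_orthogonal:
  assumes "\<And>j. j < k \<Longrightarrow> rz j \<noteq> 0"
  shows "(\<forall>i<k. ip (R k) (P i) = 0) \<and> (\<forall>i<k. energy (P k) (P i) = 0)"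
  using assms
proof (induction k rule: less_induct)
  case (less n)
  show ?case
  proof (cases n)
    case (Suc k)
    have IH: "ip (R j) (P i) = 0" "energy (P j) (P i) = 0" if "i < j" "j < n" for i j
      using less.IH[of j] less.prems that by auto
    have stp: "ip (R j) (P j) = rz j" "0 < energy (P j) (P j)" "0 < step j" if "j < n" for j
      using step_pos[of j] IH that less.prems by auto
    have k: "k < n" using Suc by simp
    have R: "ip (R n) (P i) = 0" if "i < n" for i
    proof (cases "i = k")
      case True
      then show ?thesis
        using stp[OF k] unfolding Suc state_Suc inner_on_linear inner_on_commute[of I "mv _"] energy_def[symmetric]
        by (simp add: step_def)
    next
      case False
      then have "i < k" using that Suc by simp
      then show ?thesis
        using IH[of i k] k unfolding Suc state_Suc inner_on_linear inner_on_commute[of I "mv _"] energy_def[symmetric]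
        by (simp add: energy_commute[of "P i" "P k"])
    qed
    \<comment> \<open>Solved from the residual update, so that conjugacy of directions reduces to
      products of \<open>pre n\<close> with residuals.\<close>
    have mv: "ip w (mv (P i)) = (ip w (R i) - ip w (R (Suc i))) / step i" if "i < n" for i w
      using stp(3)[OF that] by (simp add: state_Suc inner_on_linear)
    \<comment> \<open>The diagonal preconditioner changes sides, and \<open>pre j\<close> is a
      combination of the directions \<open>P 0, ..., P j\<close>, to which \<open>R n\<close> is
      orthogonal.\<close>
    have pre_pre: "ip (pre n) (R j) = 0" if "j < n" for j
    proof -
      have "ip (pre n) (R j) = ip (R n) (pre j)"
        by (simp add: pre_def inner_on_def mult.commute)
      also have "\<dots> = 0"
        using R by (rule krylov_orthogonal) (use that krylov_mono[OF pre_in_krylov[of j]] in auto)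
      finally show ?thesis .
    qed
    have "energy (P n) (P i) = 0" if "i < n" for i
    proof (cases "i = k")
      case True
      have "energy (P n) (P k) = ip (pre n) (mv (P k)) + rz n / rz k * energy (P k) (P k)"
        unfolding Suc state_Suc energy_def by (simp only: inner_on_linear)
      also have "ip (pre n) (mv (P k)) = - rz n / step k"
        using pre_pre[OF k] by (simp add: mv[OF k] Suc[symmetric] rz_def inner_on_commute)
      also have "- rz n / step k + rz n / rz k * energy (P k) (P k) = 0"
        using stp[OF k] by (simp add: step_def)
      finally show ?thesis using True by simp
    next
      case False
      then have "i < k" using that Suc by simp
      then have "energy (P k) (P i) = 0" using IH k by simp
      moreover have "energy (P n) (P i) = ip (pre n) (mv (P i)) + rz n / rz k * energy (P k) (P i)"
        unfolding Suc state_Suc energy_def by (simp only: inner_on_linear)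
      ultimately have "energy (P n) (P i) = ip (pre n) (mv (P i))" by simp
      also have "\<dots> = 0"
        using pre_pre[of i] pre_pre[of "Suc i"] \<open>i < k\<close> Suc by (simp add: mv[OF that])
      finally show ?thesis .
    qed
    with R show ?thesis by blast
  qed simp
qed

text \<open>Before termination the step lengths are nonzero, so the update of the preconditioned
  residual can be solved for \<open>B (P i)\<close> as a combination of \<open>pre i\<close> and
  \<open>pre (Suc i)\<close>.\<close>

lemma B_krylov:
  assumes "\<And>j. j < k \<Longrightarrow> rz j \<noteq> 0" and "x \<in> krylov j" and "j \<le> k"
  shows "B x \<in> krylov (Suc j)"
proof -
  have BP: "B (P i) \<in> krylov (Suc j)" if "i < j" for i
  proof -
    have "0 < step i"
      using step_pos[of i] pcg_orthogonal[of i] assms that by auto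
    then have "B (P i) = (\<lambda>v. (1 / step i) * (pre i v - pre (Suc i) v))"
      by (simp add: pre_Suc)
    also have "\<dots> \<in> krylov (Suc j)"
      using that by (intro krylov_scale krylov_diff krylov_mono[OF pre_in_krylov]) auto
    finally show ?thesis .
  qed
  obtain c where c: "\<forall>v\<in>I. x v = (\<Sum>i<j. c i * P i v)"
    using assms(2) by (rule krylovE)
  have "mv x = mv (\<lambda>v. \<Sum>i<j. c i * P i v)"
    unfolding mat_vec_def by (intro ext sum.cong refl) (simp add: c)
  then have "B x = (\<lambda>v. \<Sum>i<j. c i * B (P i) v)"
    by (simp add: B_def mat_vec_sum sum_divide_distrib)
  also have "\<dots> \<in> krylov (Suc j)"
    by (intro krylov_sum krylov_scale BP) auto
  finally show ?thesis .
qed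

definition e0 where "e0 = (\<lambda>v. y v - x0 v)"

text \<open>A vector \<open>t * e0\<close> modulo \<open>krylov j\<close> stands for
  \<open>p(Z) e0\<close> with \<open>p\<close> of degree at most \<open>j\<close> and
  \<open>p(mid) = t\<close>, because \<open>Z\<close> is \<open>mid\<close> up to a multiple of
  \<open>B\<close> and \<open>B\<close> maps into the Krylov spaces. Multiplying \<open>p\<close> by
  its variable multiplies \<open>t\<close> by \<open>mid\<close> and raises the degree by
  one.\<close>

lemma B_cheb_krylov:
  assumes "\<And>j. j < k \<Longrightarrow> rz j \<noteq> 0" and "j \<le> k"
    and "(\<lambda>v. x v - t * e0 v) \<in> krylov j"
  shows "(\<lambda>v. Z x v - mid * t * e0 v) \<in> krylov (Suc j)"
proof -
  \<comment> \<open>The initial error need not lie in the Krylov space, but its image under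
    \<open>B\<close> is the first preconditioned residual, since \<open>y\<close> solves the
    system.\<close>
  have "B e0 v = pre 0 v" if "v \<in> I" for v
    unfolding B_def e0_def mat_vec_linear pre_def state_0 exact[OF that] ..
  then have Be0: "B e0 \<in> krylov (Suc j)"
    using krylov_mono[OF pre_in_krylov[of 0], of "Suc j"] by (rule krylov_cong[rotated]) auto
  define w where "w = (\<lambda>v. x v - t * e0 v)"
  have w: "w \<in> krylov (Suc j)" and Bw: "B w \<in> krylov (Suc j)"
    using krylov_mono[OF assms(3), of "Suc j"] B_krylov[OF assms(1) assms(3,2)] by (simp_all add: w_def)
  have "(\<lambda>v. mid * w v - slope * (B w v + t * B e0 v)) \<in> krylov (Suc j)"
    by (rule krylov_diff[OF krylov_scale[OF w] krylov_scale[OF krylov_add[OF Bw krylov_scale[OF Be0]]]])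
  moreover have "Z x v - mid * t * e0 v = mid * w v - slope * (B w v + t * B e0 v)" for v
    unfolding Z_def w_def B_linear by (simp add: algebra_simps)
  ultimately show ?thesis by simp
qed

text \<open>The third clause concerns the polynomial \<open>U_j\<close> of degree \<open>j\<close>,
  which \<open>cheb\<close> stores at position \<open>Suc j\<close>; \<open>T_(j+1)\<close> arises
  from it by one application of \<open>Z\<close>, so the induction must carry it.\<close>

lemma cheb_krylov:
  assumes "\<And>j. j < k \<Longrightarrow> rz j \<noteq> 0" and "j \<le> k"
  shows "(\<lambda>v. fst (cheb e0 j) v - cheb_T j * e0 v) \<in> krylov j \<and>
    (\<lambda>v. snd (cheb e0 j) v - cheb_U j * e0 v) \<in> krylov j \<and>
    (\<lambda>v. snd (cheb e0 (Suc j)) v - cheb_U (Suc j) * e0 v) \<in> krylov j"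
  using assms(2)
proof (induction j)
  case 0
  then show ?case by (simp add: krylov_zero Let_def Z_zero cheb_real_Suc(1)) (simp add: krylov_zero cheb_T_def cheb_U_def)
next
  case (Suc j)
  define T U W t u w where "T = fst (cheb e0 j)" and "U = snd (cheb e0 j)" and "W = snd (cheb e0 (Suc j))"
    and "t = cheb_T j" and "u = cheb_U j" and "w = cheb_U (Suc j)"
  have IH: "(\<lambda>v. U v - u * e0 v) \<in> krylov j" "(\<lambda>v. W v - w * e0 v) \<in> krylov j"
    using Suc by (simp_all add: U_def W_def u_def w_def)
  have T': "fst (cheb e0 (Suc j)) = (\<lambda>v. Z W v - U v)" and t': "cheb_T (Suc j) = mid * w - u"
    by (simp_all add: W_def w_def U_def u_def Let_def cheb_real_Suc)
  have ZW: "(\<lambda>v. Z W v - mid * w * e0 v) \<in> krylov (Suc j)"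
    using assms(1) _ IH(2) by (rule B_cheb_krylov) (use Suc.prems in auto)
  have 1: "(\<lambda>v. (Z W v - U v) - (mid * w - u) * e0 v) \<in> krylov (Suc j)"
    using krylov_diff[OF ZW krylov_mono[OF IH(1), of "Suc j"]] by (simp add: algebra_simps)
  have 2: "(\<lambda>v. (Z W v - U v + Z W v) - (mid * w - u + mid * w) * e0 v) \<in> krylov (Suc j)"
    using krylov_add[OF 1 ZW] by (simp add: algebra_simps)
  have "snd (cheb e0 (Suc (Suc j))) = (\<lambda>v. Z W v - U v + Z W v)"
    and "cheb_U (Suc (Suc j)) = mid * w - u + mid * w"
    by (simp_all add: W_def w_def U_def u_def Let_def cheb_real_Suc)
  with 1 2 krylov_mono[OF IH(2), of "Suc j"] show ?case
    unfolding T' t' W_def w_def by simp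
qed

lemma error_krylov: "(\<lambda>v. (y v - X k v) - e0 v) \<in> krylov k"
proof (induction k)
  case 0
  then show ?case by (simp add: e0_def state_0 krylov_zero)
next
  case (Suc k)
  have "(\<lambda>v. ((y v - X k v) - e0 v) - step k * P k v) \<in> krylov (Suc k)"
    by (rule krylov_diff[OF krylov_mono[OF Suc] krylov_scale[OF P_in_krylov]]) auto
  then show ?case by (simp add: state_Suc algebra_simps)
qed

text \<open>Optimality of PCG in the form of a Pythagorean identity: with
  \<open>t = T_k(mid)\<close> the vector \<open>T_k(Z) e0 - t * e\<close> lies in the Krylov space,
  to which the error \<open>e\<close> is energy-orthogonal. Hence
  \<open>t^2 |e|^2 \<le> |T_k(Z) e0|^2 \<le> |e0|^2\<close> in the energy norm.\<close>

lemma pcg_error_pow2: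
  "energy (\<lambda>v. y v - X k v) (\<lambda>v. y v - X k v) \<le> (2 * rate ^ k)\<^sup>2 * energy e0 e0"
proof (cases "\<forall>j<k. rz j \<noteq> 0")
  case False
  then obtain j where "j < k" "rz j = 0" by auto
  then have "rz k = 0"
    by (induction k) (auto simp: less_Suc_eq rz_zero_Suc)
  then have "R k v = 0" if "v \<in> I" for v using rz_zero that by blast
  then have "mv (\<lambda>v. y v - X k v) v = 0" if "v \<in> I" for v
    using that exact[OF that] by (simp add: R_eq mat_vec_linear)
  then have "energy (\<lambda>v. y v - X k v) (\<lambda>v. y v - X k v) = 0"
    by (simp add: energy_def inner_on_def)
  then show ?thesis using energy_nonneg by simp
next
  case True
  define e t where "e = (\<lambda>v. y v - X k v)" and "t = cheb_T k"
  define w where "w = (\<lambda>v. t * e v - fst (cheb e0 k) v)"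
  have "(\<lambda>v. t * (e v - e0 v) - (fst (cheb e0 k) v - t * e0 v)) \<in> krylov k"
    unfolding e_def t_def using cheb_krylov[of k k] True
    by (intro krylov_diff[OF krylov_scale[OF error_krylov]]) auto
  then have "w \<in> krylov k" by (simp add: w_def algebra_simps)
  then have "ip (R k) w = 0"
    using krylov_orthogonal pcg_orthogonal[of k] True by blast
  moreover have "R k v = mv e v" if "v \<in> I" for v
    using exact[OF that] by (simp add: R_eq e_def mat_vec_linear)
  then have "ip w (mv e) = ip w (R k)"
    by (intro inner_on_cong) auto
  ultimately have "energy w e = 0"
    by (simp add: energy_def inner_on_commute)
  moreover have "fst (cheb e0 k) = (\<lambda>v. t * e v - w v)" by (simp add: w_def)
  ultimately have "energy (fst (cheb e0 k)) (fst (cheb e0 k)) = t\<^sup>2 * energy e e + energy w w"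
    by (simp add: energy_linear energy_commute[of e w] power2_eq_square)
  then have le: "t\<^sup>2 * energy e e \<le> energy e0 e0"
    using energy_cheb_le[of e0 k] energy_nonneg[of w] by linarith
  \<comment> \<open>Discarding \<open>rate ^ k\<close> in \<open>T_k(mid)\<close> leaves
    \<open>1 / t \<le> 2 * rate ^ k\<close>, the origin of the factor 2.\<close>
  have "1 = (inverse rate ^ k) * rate ^ k" using rate_pos by (simp add: power_mult_distrib[symmetric])
  also have "\<dots> \<le> (2 * t) * rate ^ k"
    using rate_pos unfolding t_def cheb_T_def by (intro mult_right_mono) auto
  finally have "1 \<le> (2 * rate ^ k) * t" by (simp add: mult_ac)
  then have "1 \<le> ((2 * rate ^ k) * t)\<^sup>2" by (simp add: one_le_power)
  then have "1 * energy e e \<le> ((2 * rate ^ k) * t)\<^sup>2 * energy e e"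
    by (rule mult_right_mono) (rule energy_nonneg)
  also have "\<dots> = (2 * rate ^ k)\<^sup>2 * (t\<^sup>2 * energy e e)" by (simp add: power_mult_distrib)
  also have "\<dots> \<le> (2 * rate ^ k)\<^sup>2 * energy e0 e0" by (intro mult_left_mono le) simp
  finally show ?thesis by (simp add: e_def)
qed

end

theorem pcg_error:
  assumes "\<And>v. v \<in> I \<Longrightarrow> mv y v = b v"
  shows "energy (\<lambda>v. y v - pcg I A D b x0 k v) (\<lambda>v. y v - pcg I A D b x0 k v)
    \<le> (2 * rate ^ k)\<^sup>2 * energy (\<lambda>v. y v - x0 v) (\<lambda>v. y v - x0 v)"
proof -
  have "X b x0 k = pcg I A D b x0 k" by (simp add: pcg_def X_def[OF assms] state_def[OF assms])
  with pcg_error_pow2[OF assms, where k = k and ?x0.0 = x0] show ?thesis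
    by (simp add: e0_def[OF assms])
qed

end

section \<open>Straight-line programs\<close>

locale straight_line =
  fixes inp :: "'j \<Rightarrow> 'v cell \<Rightarrow> real" and J :: "'j set"
begin

text \<open>Instruction number \<open>i\<close>, counted from 1, of an \<open>ssa\<close> program
  writes \<open>Work i\<close>. After \<open>n\<close> instructions these cells are therefore the
  ones that no continuation overwrites. \<open>Work 0\<close> is never a target and supplies the
  constant 0; \<open>Output\<close> cells are reserved for the last pass.\<close>

definition untouched :: "nat \<Rightarrow> 'v cell \<Rightarrow> bool" where
  "untouched n c \<longleftrightarrow> (\<forall>i>n. c \<noteq> Work i) \<and> (\<forall>v. c \<noteq> Output v)"

definition ssa :: "'v instr list \<Rightarrow> bool" where
  "ssa p \<longleftrightarrow> (\<forall>i<length p. target (p ! i) = Work (Suc i))"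

definition holds_in :: "'v instr list \<Rightarrow> 'v cell \<Rightarrow> ('j \<Rightarrow> real) \<Rightarrow> bool" where
  "holds_in p c f \<longleftrightarrow> untouched (length p) c \<and> (\<forall>j\<in>J. run p (inp j) c = f j)"

text \<open>A value is a function of the parameter of the input, so a single program serves all inputs; by
  \<open>ssa\<close> it is never overwritten.\<close>

definition avail :: "nat \<Rightarrow> ('j \<Rightarrow> real) set \<Rightarrow> bool" where
  "avail n F \<longleftrightarrow> (\<exists>p. length p \<le> n \<and> ssa p \<and> (\<forall>f\<in>F. \<exists>c. holds_in p c f))"

definition inputs :: "('j \<Rightarrow> real) set" where
  "inputs = {\<lambda>j. inp j c | c. untouched 0 c}"

definition vec :: "'w set \<Rightarrow> ('j \<Rightarrow> 'w \<Rightarrow> real) \<Rightarrow> ('j \<Rightarrow> real) set" where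
  "vec I x = (\<lambda>v j. x j v) ` I"

lemma vecD: "vec I x \<subseteq> F \<Longrightarrow> v \<in> I \<Longrightarrow> (\<lambda>j. x j v) \<in> F"
  by (auto simp: vec_def)

lemma vec_subset: "(\<And>v. v \<in> I \<Longrightarrow> (\<lambda>j. x j v) \<in> F) \<Longrightarrow> vec I x \<subseteq> F"
  by (auto simp: vec_def)

lemma avail_mono: "avail n F \<Longrightarrow> n \<le> n' \<Longrightarrow> F' \<subseteq> F \<Longrightarrow> avail n' F'"
  unfolding avail_def by (meson order_trans subsetD)

lemma avail_inputs: "avail 0 inputs"
  unfolding avail_def inputs_def holds_in_def ssa_def by (rule exI[of _ "[]"]) (auto simp: run_def)

lemma avail_op:
  assumes "avail n F" and "f \<in> F" and "g \<in> F"
  shows "avail (Suc n) (insert (\<lambda>j. apply_op opr (f j) (g j)) F)"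
proof -
  obtain p where p: "length p \<le> n" "ssa p" "\<And>f. f \<in> F \<Longrightarrow> \<exists>c. holds_in p c f"
    using assms(1) unfolding avail_def by blast
  obtain a b where a: "holds_in p a f" and b: "holds_in p b g"
    using p(3) assms by meson
  define q where "q = p @ [Instr (Work (Suc (length p))) opr a b]"
  have run_q: "run q m = (run p m)(Work (Suc (length p)) := apply_op opr (run p m a) (run p m b))" for m
    by (simp add: q_def run_def)
  have len: "length q = Suc (length p)" by (simp add: q_def)
  have "holds_in q c h" if "holds_in p c h" for c h
    using that by (auto simp: holds_in_def run_q untouched_def len)
  moreover have "holds_in q (Work (Suc (length p))) (\<lambda>j. apply_op opr (f j) (g j))"
    using a b by (auto simp: holds_in_def run_q untouched_def len)
  moreover have "ssa q"
    using p(2) by (auto simp: ssa_def q_def nth_append less_Suc_eq)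
  moreover have "length q \<le> Suc n" using p(1) by (simp add: q_def)
  ultimately show ?thesis
    unfolding avail_def using p(3) by (intro exI[of _ q]) blast
qed

lemma extend_scalar:
  assumes "avail n F" and "f \<in> F" and "g \<in> F"
  obtains F' where "avail (Suc n) F'" "F \<subseteq> F'" "(\<lambda>j. apply_op opr (f j) (g j)) \<in> F'"
  using avail_op[OF assms] by blast

text \<open>The hypothesis allows any larger set \<open>F'\<close> and any count \<open>n'\<close>,
  since the components are appended one after another, each to a program that already computes the
  previous ones.\<close>

lemma extend_vec:
  assumes "finite I" and "avail n F"
    and "\<And>v n' F'. v \<in> I \<Longrightarrow> F \<subseteq> F' \<Longrightarrow> avail n' F' \<Longrightarrow> \<exists>F''. F' \<subseteq> F'' \<and> (\<lambda>j. x j v) \<in> F'' \<and> avail (n' + c) F''"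
  shows "\<exists>F'. avail (n + card I * c) F' \<and> F \<subseteq> F' \<and> vec I x \<subseteq> F'"
  using assms(1,3)
proof (induction I rule: finite_induct)
  case empty
  then show ?case using assms(2) by (auto simp: vec_def)
next
  case (insert v I)
  then obtain F1 where F1: "avail (n + card I * c) F1" "F \<subseteq> F1" "vec I x \<subseteq> F1" by auto
  then obtain F2 where "F1 \<subseteq> F2" "(\<lambda>j. x j v) \<in> F2" "avail (n + card I * c + c) F2"
    using insert.prems[of v F1] by blast
  then show ?case
    using F1 insert.hyps by (intro exI[of _ F2]) (auto simp: vec_def algebra_simps)
qed

lemma extend_vec_op:
  assumes "finite I" and "avail n F" and "vec I x \<subseteq> F" and "vec I y \<subseteq> F"
  obtains F' where "avail (n + card I) F'" "F \<subseteq> F'" "vec I (\<lambda>j v. apply_op opr (x j v) (y j v)) \<subseteq> F'"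
proof -
  have "\<exists>F'. avail (n + card I * 1) F' \<and> F \<subseteq> F' \<and> vec I (\<lambda>j v. apply_op opr (x j v) (y j v)) \<subseteq> F'"
    using assms(1,2)
  proof (rule extend_vec)
    fix v n' F'
    assume "v \<in> I" "F \<subseteq> F'" "avail n' F'"
    then have "avail (Suc n') (insert (\<lambda>j. apply_op opr (x j v) (y j v)) F')"
      using vecD[OF assms(3)] vecD[OF assms(4)] by (intro avail_op) auto
    then show "\<exists>F''. F' \<subseteq> F'' \<and> (\<lambda>j. apply_op opr (x j v) (y j v)) \<in> F'' \<and> avail (n' + 1) F''"
      by (metis Suc_eq_plus1 insertI1 subset_insertI)
  qed
  then show thesis using that by auto
qed

lemma extend_vec_scale:
  assumes "finite I" and "avail n F" and "c \<in> F" and "vec I y \<subseteq> F"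
  obtains F' where "avail (n + card I) F'" "F \<subseteq> F'" "vec I (\<lambda>j v. c j * y j v) \<subseteq> F'"
  using extend_vec_op[OF assms(1,2) _ assms(4), where x = "\<lambda>j v. c j" and opr = Mul] assms(3)
  by (auto simp: vec_def image_subset_iff)

lemma extend_vec_axpy:
  assumes "finite I" and "avail n F" and "c \<in> F" and "vec I x \<subseteq> F" and "vec I y \<subseteq> F" and "opr \<in> {Add, Sub}"
  obtains F' where "avail (n + 2 * card I) F'" "F \<subseteq> F'"
    "vec I (\<lambda>j v. apply_op opr (x j v) (c j * y j v)) \<subseteq> F'"
proof -
  obtain F1 where 1: "avail (n + card I) F1" "F \<subseteq> F1" "vec I (\<lambda>j v. c j * y j v) \<subseteq> F1"
    using extend_vec_scale[OF assms(1,2,3,5)] .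
  obtain F2 where 2: "avail (n + card I + card I) F2" "F1 \<subseteq> F2" "vec I (\<lambda>j v. apply_op opr (x j v) (c j * y j v)) \<subseteq> F2"
    using extend_vec_op[OF assms(1) 1(1) order_trans[OF assms(4) 1(2)] 1(3)] .
  show thesis using 1(2) 2 by (intro that[of F2]) (auto simp: mult_2 add.assoc)
qed

text \<open>Two operations per term, the accumulation starting from the available constant 0, which
  is also the value for empty \<open>W\<close>.\<close>

lemma extend_sum:
  assumes "finite W" and "avail n F" and "\<And>w. w \<in> W \<Longrightarrow> f w \<in> F" and "\<And>w. w \<in> W \<Longrightarrow> g w \<in> F"
    and "(\<lambda>j. 0) \<in> F"
  shows "\<exists>F'. avail (n + 2 * card W) F' \<and> F \<subseteq> F' \<and> (\<lambda>j. \<Sum>w\<in>W. f w j * g w j) \<in> F'"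
  using assms(1,3,4)
proof (induction W rule: finite_induct)
  case empty
  then show ?case using assms(2,5) by auto
next
  case (insert a W)
  then obtain F1 where 1: "avail (n + 2 * card W) F1" "F \<subseteq> F1" "(\<lambda>j. \<Sum>w\<in>W. f w j * g w j) \<in> F1"
    by auto
  obtain F2 where 2: "avail (Suc (n + 2 * card W)) F2" "F1 \<subseteq> F2" "(\<lambda>j. apply_op Mul (f a j) (g a j)) \<in> F2"
    using extend_scalar[OF 1(1), of "f a" "g a" Mul] insert.prems 1(2) by blast
  obtain F3 where 3: "avail (Suc (Suc (n + 2 * card W))) F3" "F2 \<subseteq> F3"
    "(\<lambda>j. apply_op Add (apply_op Mul (f a j) (g a j)) (\<Sum>w\<in>W. f w j * g w j)) \<in> F3"
    using extend_scalar[OF 2(1) 2(3), of _ Add] 1(3) 2(2) by blast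
  show ?case
    using insert.hyps 1 2 3 by (intro exI[of _ F3]) auto
qed

lemma extend_inner:
  assumes "finite I" and "avail n F" and "vec I x \<subseteq> F" and "vec I y \<subseteq> F" and "(\<lambda>j. 0) \<in> F"
  obtains F' where "avail (n + 2 * card I) F'" "F \<subseteq> F'" "(\<lambda>j. inner_on I (x j) (y j)) \<in> F'"
proof -
  have "\<exists>F'. avail (n + 2 * card I) F' \<and> F \<subseteq> F' \<and> (\<lambda>j. \<Sum>v\<in>I. x j v * y j v) \<in> F'"
    using assms by (intro extend_sum) (simp_all add: vecD)
  then show thesis using that unfolding inner_on_def by blast
qed

text \<open>The program is written for a fixed mesh and may thus hard-wire the sparsity pattern: it
  visits only the at most \<open>\<Delta>\<close> nonzero entries of a row.\<close>

lemma extend_matrix: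
  assumes "finite I" and "avail n F" and "finite I'" and "vec I' x \<subseteq> F"
    and "\<And>v w. v \<in> I \<Longrightarrow> w \<in> I' \<Longrightarrow> (\<lambda>j. A v w) \<in> F" and "(\<lambda>j. 0) \<in> F"
    and sparse: "\<And>v. v \<in> I \<Longrightarrow> card {w \<in> I'. A v w \<noteq> 0} \<le> \<Delta>"
  obtains F' where "avail (n + card I * (2 * \<Delta>)) F'" "F \<subseteq> F'" "vec I (\<lambda>j v. \<Sum>w\<in>I'. A v w * x j w) \<subseteq> F'"
proof -
  have "\<exists>F'. avail (n + card I * (2 * \<Delta>)) F' \<and> F \<subseteq> F' \<and> vec I (\<lambda>j v. \<Sum>w\<in>I'. A v w * x j w) \<subseteq> F'"
    using assms(1,2)
  proof (rule extend_vec)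
    fix v n' F'
    assume v: "v \<in> I" "F \<subseteq> F'" "avail n' F'"
    define W where "W = {w \<in> I'. A v w \<noteq> 0}"
    have "\<exists>F''. avail (n' + 2 * card W) F'' \<and> F' \<subseteq> F'' \<and> (\<lambda>j. \<Sum>w\<in>W. A v w * x j w) \<in> F''"
    proof (rule extend_sum)
      show "finite W" using assms(3) by (simp add: W_def)
      show "(\<lambda>j. A v w) \<in> F'" "(\<lambda>j. x j w) \<in> F'" if "w \<in> W" for w
        using that v assms(5)[OF v(1), of w] vecD[OF assms(4), of w] by (auto simp: W_def)
      show "(\<lambda>j. 0) \<in> F'" using assms(6) v by blast
    qed (rule v)
    then obtain F'' where F'': "avail (n' + 2 * card W) F''" "F' \<subseteq> F''" "(\<lambda>j. \<Sum>w\<in>W. A v w * x j w) \<in> F''"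
      by blast
    have "(\<Sum>w\<in>W. A v w * x j w) = (\<Sum>w\<in>I'. A v w * x j w)" for j
      using assms(3) by (intro sum.mono_neutral_left) (auto simp: W_def)
    then have "(\<lambda>j. \<Sum>w\<in>I'. A v w * x j w) \<in> F''" using F''(3) by simp
    moreover have "avail (n' + 2 * \<Delta>) F''"
      using avail_mono[OF F''(1) _ order_refl] sparse[OF v(1)] by (simp add: W_def)
    ultimately show "\<exists>F''. F' \<subseteq> F'' \<and> (\<lambda>j. \<Sum>w\<in>I'. A v w * x j w) \<in> F'' \<and> avail (n' + 2 * \<Delta>) F''"
      using F''(2) by blast
  qed
  then show thesis using that by blast
qed

text \<open>The Schur complement is never assembled. \<open>K\<close>, the inverse of
  \<open>D\<close> and again \<open>K\<close> are applied in turn, so sparsity of \<open>K\<close>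
  and \<open>M\<close> suffices. Three sparse products cost \<open>6 * \<Delta>\<close> per row;
  division, scaling by \<open>\<rho>\<close> and the final addition give the 3.\<close>

lemma extend_schur:
  fixes I :: "'w set"
  assumes "finite I" and "avail n F" and "vec I x \<subseteq> F" and "(\<lambda>j. 0) \<in> F"
    and entries: "\<And>v w. v \<in> I \<Longrightarrow> w \<in> I \<Longrightarrow> (\<lambda>j. K v w) \<in> F" "\<And>v w. v \<in> I \<Longrightarrow> w \<in> I \<Longrightarrow> (\<lambda>j. M v w) \<in> F"
      "\<And>v. v \<in> I \<Longrightarrow> (\<lambda>j. D v v) \<in> F" "(\<lambda>j. \<rho>) \<in> F"
    and sparse: "\<And>v. v \<in> I \<Longrightarrow> card {w \<in> I. K v w \<noteq> 0} \<le> \<Delta>" "\<And>v. v \<in> I \<Longrightarrow> card {w \<in> I. M v w \<noteq> 0} \<le> \<Delta>"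
  obtains F' where "avail (n + card I * (6 * \<Delta> + 3)) F'" "F \<subseteq> F'"
    "vec I (\<lambda>j. mat_vec I (\<lambda>v w. \<rho> * (\<Sum>u\<in>I. K v u * inverse (D u u) * K u w) + M v w) (x j)) \<subseteq> F'"
proof -
  let ?n2 = "n + card I * (2 * \<Delta>) + card I"
  let ?n4 = "?n2 + card I * (2 * \<Delta>) + card I"
  let ?KDK = "\<lambda>j v. \<Sum>u\<in>I. K v u * apply_op Div (\<Sum>w\<in>I. K u w * x j w) (D u u)"
  obtain F1 where 1: "avail (n + card I * (2 * \<Delta>)) F1" "F \<subseteq> F1" "vec I (\<lambda>j v. \<Sum>w\<in>I. K v w * x j w) \<subseteq> F1"
    using extend_matrix[OF assms(1,2,1,3) entries(1) assms(4) sparse(1)] .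
  obtain F2 where 2: "avail (?n2) F2" "F1 \<subseteq> F2"
    "vec I (\<lambda>j v. apply_op Div (\<Sum>w\<in>I. K v w * x j w) (D v v)) \<subseteq> F2"
    using extend_vec_op[OF assms(1) 1(1) 1(3), of "\<lambda>j v. D v v" Div] entries(3) 1(2) vec_subset[of I "\<lambda>j v. D v v" F1] by blast
  obtain F3 where 3: "avail (?n2 + card I * (2 * \<Delta>)) F3" "F2 \<subseteq> F3"
    "vec I (\<lambda>j v. \<Sum>u\<in>I. K v u * apply_op Div (\<Sum>w\<in>I. K u w * x j w) (D u u)) \<subseteq> F3"
    using extend_matrix[OF assms(1) 2(1) assms(1) 2(3), where A = K and \<Delta> = \<Delta>] entries(1) assms(4) sparse(1) 1(2) 2(2) by blast
  obtain F4 where 4: "avail (?n4) F4" "F3 \<subseteq> F4"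
    "vec I (\<lambda>j v. \<rho> * ?KDK j v) \<subseteq> F4"
    using extend_vec_scale[OF assms(1) 3(1) _ 3(3), of "\<lambda>j. \<rho>"] entries(4) 1(2) 2(2) 3(2) by blast
  have F4: "F \<subseteq> F4" using 1(2) 2(2) 3(2) 4(2) by blast
  obtain F5 where 5: "avail (?n4 + card I * (2 * \<Delta>)) F5" "F4 \<subseteq> F5"
    "vec I (\<lambda>j v. \<Sum>w\<in>I. M v w * x j w) \<subseteq> F5"
    using extend_matrix[OF assms(1) 4(1) assms(1), where x = x and A = M and \<Delta> = \<Delta>] entries(2) assms(3,4) sparse(2) F4 by blast
  obtain F6 where 6: "avail (?n4 + card I * (2 * \<Delta>) + card I) F6" "F5 \<subseteq> F6"
    "vec I (\<lambda>j v. apply_op Add (\<rho> * ?KDK j v) (\<Sum>w\<in>I. M v w * x j w)) \<subseteq> F6"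
    using extend_vec_op[OF assms(1) 5(1) _ 5(3)] 4(3) 5(2) by blast
  have "apply_op Add (\<rho> * ?KDK j v) (\<Sum>w\<in>I. M v w * x j w)
    = mat_vec I (\<lambda>v w. \<rho> * (\<Sum>u\<in>I. K v u * inverse (D u u) * K u w) + M v w) (x j) v" for j v
  proof -
    have "(\<Sum>u\<in>I. K v u * ((\<Sum>w\<in>I. K u w * x j w) / D u u)) = (\<Sum>u\<in>I. \<Sum>w\<in>I. K v u * inverse (D u u) * K u w * x j w)"
      by (simp add: sum_distrib_left divide_inverse mult_ac)
    also have "\<dots> = (\<Sum>w\<in>I. \<Sum>u\<in>I. K v u * inverse (D u u) * K u w * x j w)"
      by (rule sum.swap)
    finally show ?thesis
      by (simp add: mat_vec_def distrib_right sum.distrib sum_distrib_left sum_distrib_right mult.assoc)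
  qed
  then have "vec I (\<lambda>j. mat_vec I (\<lambda>v w. \<rho> * (\<Sum>u\<in>I. K v u * inverse (D u u) * K u w) + M v w) (x j)) \<subseteq> F6"
    using 6(3) by simp
  moreover have "avail (n + card I * (6 * \<Delta> + 3)) F6"
    using 6(1) by (simp add: algebra_simps)
  ultimately show thesis using F4 5(2) 6(2) by (intro that[of F6]) auto
qed

text \<open>A step takes one matrix product, 14 operations per unknown and two scalar divisions; for
  nonempty \<open>I\<close> all but the product fit into 16 per unknown. Initialisation is cheaper
  and accounts for one of the \<open>k + 1\<close> units.\<close>

lemma extend_pcg:
  fixes I :: "'w set"
  assumes fin: "finite I" and av: "avail n F" and x0: "vec I x0 \<subseteq> F" and b: "vec I b \<subseteq> F"
    and zero: "(\<lambda>j. 0) \<in> F" and D: "\<And>v. v \<in> I \<Longrightarrow> (\<lambda>j. D v v) \<in> F"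
    and A: "\<And>n F' x. F \<subseteq> F' \<Longrightarrow> vec I x \<subseteq> F' \<Longrightarrow> avail n F' \<Longrightarrow>
      \<exists>F''. avail (n + card I * a) F'' \<and> F' \<subseteq> F'' \<and> vec I (\<lambda>j. mat_vec I A (x j)) \<subseteq> F''"
  shows "\<exists>F'. avail (n + (k + 1) * (card I * (a + 16))) F' \<and> F \<subseteq> F' \<and> vec I (\<lambda>j. pcg I A D (b j) (x0 j) k) \<subseteq> F'"
proof (cases "I = {}")
  case True
  then show ?thesis using av by (intro exI[of _ F]) (simp add: vec_def)
next
  case False
  let ?N = "card I"
  have N: "1 \<le> ?N" using False fin by (simp add: Suc_le_eq card_gt_0_iff)
  define st where "st j k = (pcg_step I A D ^^ k) (pcg_init I A D (b j) (x0 j))" for j k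
  define X R P where "X k j = fst (st j k)" and "R k j = fst (snd (st j k))" and "P k j = snd (snd (st j k))" for j k
  have D': "vec I (\<lambda>j v. D v v) \<subseteq> F" using D by (rule vec_subset)
  have "\<exists>F'. avail (n + (k + 1) * (?N * (a + 16))) F' \<and> F \<subseteq> F' \<and> vec I (X k) \<subseteq> F' \<and> vec I (R k) \<subseteq> F' \<and> vec I (P k) \<subseteq> F'"
  proof (induction k)
    case 0
    obtain F1 where 1: "avail (n + ?N * a) F1" "F \<subseteq> F1" "vec I (\<lambda>j. mat_vec I A (x0 j)) \<subseteq> F1"
      using A[OF order_refl x0 av] by blast
    let ?r = "\<lambda>j v. apply_op Sub (b j v) (mat_vec I A (x0 j) v)"
    obtain F2 where 2: "avail (n + ?N * a + ?N) F2" "F1 \<subseteq> F2" "vec I ?r \<subseteq> F2"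
      by (rule extend_vec_op[OF fin 1(1) order_trans[OF b 1(2)] 1(3)])
    let ?p = "\<lambda>j v. apply_op Div (?r j v) (D v v)"
    have s2: "F \<subseteq> F2" using 1(2) 2(2) by (rule order_trans)
    obtain F3 where 3: "avail (n + ?N * a + ?N + ?N) F3" "F2 \<subseteq> F3" "vec I ?p \<subseteq> F3"
      by (rule extend_vec_op[OF fin 2(1) 2(3) order_trans[OF D' s2]])
    have s3: "F \<subseteq> F3" using s2 3(2) by (rule order_trans)
    have eq: "X 0 = x0" "R 0 = ?r" "P 0 = ?p"
      by (simp_all add: X_def R_def P_def st_def pcg_init_def Let_def fun_eq_iff)
    have "n + ?N * a + ?N + ?N \<le> n + (0 + 1) * (?N * (a + 16))"
      by (simp add: algebra_simps)
    then have "avail (n + (0 + 1) * (?N * (a + 16))) F3"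
      using avail_mono[OF 3(1) _ order_refl] by blast
    then show ?case
      unfolding eq using s3 order_trans[OF x0 s3] order_trans[OF 2(3) 3(2)] 3(3) by (intro exI[of _ F3] conjI)
  next
    case (Suc k)
    define n0 where "n0 = n + (k + 1) * (?N * (a + 16))"
    let ?n2 = "n0 + ?N + ?N * a"
    let ?n5 = "Suc (?n2 + 2 * ?N + 2 * ?N)"
    let ?n9 = "Suc (?n5 + 2 * ?N + ?N + 2 * ?N)"
    obtain F0 where 0: "avail n0 F0" "F \<subseteq> F0" "vec I (X k) \<subseteq> F0" "vec I (R k) \<subseteq> F0" "vec I (P k) \<subseteq> F0"
      using Suc unfolding n0_def by blast
    have D0: "vec I (\<lambda>j v. D v v) \<subseteq> F0" and zero0: "(\<lambda>j. 0) \<in> F0"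
      using order_trans[OF D' 0(2)] subsetD[OF 0(2) zero] .
    let ?Z = "\<lambda>j v. apply_op Div (R k j v) (D v v)"
    obtain F1 where 1: "avail (n0 + ?N) F1" "F0 \<subseteq> F1" "vec I ?Z \<subseteq> F1"
      by (rule extend_vec_op[OF fin 0(1) 0(4) D0])
    let ?AP = "\<lambda>j. mat_vec I A (P k j)"
    obtain F2 where 2: "avail (?n2) F2" "F1 \<subseteq> F2" "vec I ?AP \<subseteq> F2"
      using A[OF order_trans[OF 0(2) 1(2)] order_trans[OF 0(5) 1(2)] 1(1)] by blast
    have s2: "F0 \<subseteq> F2" using 1(2) 2(2) by (rule order_trans)
    let ?rz = "\<lambda>j. inner_on I (R k j) (?Z j)"
    obtain F3 where 3: "avail (?n2 + 2 * ?N) F3" "F2 \<subseteq> F3" "?rz \<in> F3"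
      by (rule extend_inner[OF fin 2(1) order_trans[OF 0(4) s2] order_trans[OF 1(3) 2(2)] subsetD[OF s2 zero0]])
    have s3: "F0 \<subseteq> F3" using s2 3(2) by (rule order_trans)
    let ?pap = "\<lambda>j. inner_on I (P k j) (?AP j)"
    obtain F4 where 4: "avail (?n2 + 2 * ?N + 2 * ?N) F4" "F3 \<subseteq> F4" "?pap \<in> F4"
      by (rule extend_inner[OF fin 3(1) order_trans[OF 0(5) s3] order_trans[OF 2(3) 3(2)] subsetD[OF s3 zero0]])
    let ?al = "\<lambda>j. apply_op Div (?rz j) (?pap j)"
    obtain F5 where 5: "avail (?n5) F5" "F4 \<subseteq> F5" "?al \<in> F5"
      by (rule extend_scalar[OF 4(1) subsetD[OF 4(2) 3(3)] 4(3)])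
    have s5: "F3 \<subseteq> F5" "F2 \<subseteq> F5" "F0 \<subseteq> F5" using 3(2) 4(2) 5(2) s3 by auto
    let ?R' = "\<lambda>j v. apply_op Sub (R k j v) (?al j * ?AP j v)"
    obtain F6 where 6: "avail (?n5 + 2 * ?N) F6" "F5 \<subseteq> F6" "vec I ?R' \<subseteq> F6"
      by (rule extend_vec_axpy[OF fin 5(1) 5(3) order_trans[OF 0(4) s5(3)] order_trans[OF 2(3) s5(2)], of Sub]) simp
    have s6: "F0 \<subseteq> F6" using s5(3) 6(2) by (rule order_trans)
    let ?Z' = "\<lambda>j v. apply_op Div (?R' j v) (D v v)"
    obtain F7 where 7: "avail (?n5 + 2 * ?N + ?N) F7" "F6 \<subseteq> F7" "vec I ?Z' \<subseteq> F7"
      by (rule extend_vec_op[OF fin 6(1) 6(3) order_trans[OF D0 s6]])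
    have s7: "F0 \<subseteq> F7" "F3 \<subseteq> F7" using s5 s6 6(2) 7(2) by auto
    let ?rz' = "\<lambda>j. inner_on I (?R' j) (?Z' j)"
    obtain F8 where 8: "avail (?n5 + 2 * ?N + ?N + 2 * ?N) F8" "F7 \<subseteq> F8" "?rz' \<in> F8"
      by (rule extend_inner[OF fin 7(1) order_trans[OF 6(3) 7(2)] 7(3) subsetD[OF s7(1) zero0]])
    let ?be = "\<lambda>j. apply_op Div (?rz' j) (?rz j)"
    obtain F9 where 9: "avail (?n9) F9" "F8 \<subseteq> F9" "?be \<in> F9"
      by (rule extend_scalar[OF 8(1) 8(3) subsetD[OF order_trans[OF s7(2) 8(2)] 3(3)]])
    have s9: "F0 \<subseteq> F9" "F5 \<subseteq> F9" "F6 \<subseteq> F9" "F7 \<subseteq> F9" using s6 6(2) 7(2) 8(2) 9(2) by auto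
    let ?X' = "\<lambda>j v. apply_op Add (X k j v) (?al j * P k j v)"
    obtain F10 where 10: "avail (?n9 + 2 * ?N) F10" "F9 \<subseteq> F10"
      "vec I ?X' \<subseteq> F10"
      by (rule extend_vec_axpy[OF fin 9(1) subsetD[OF s9(2) 5(3)] order_trans[OF 0(3) s9(1)] order_trans[OF 0(5) s9(1)], of Add]) simp
    have s10: "F0 \<subseteq> F10" "F7 \<subseteq> F10" "F6 \<subseteq> F10" using s9 10(2) by auto
    let ?P' = "\<lambda>j v. apply_op Add (?Z' j v) (?be j * P k j v)"
    obtain F11 where 11: "avail (?n9 + 2 * ?N + 2 * ?N) F11" "F10 \<subseteq> F11"
      "vec I ?P' \<subseteq> F11"
      by (rule extend_vec_axpy[OF fin 10(1) subsetD[OF 10(2) 9(3)] order_trans[OF 7(3) s10(2)] order_trans[OF 0(5) s10(1)], of Add]) simp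
    have eq: "X (Suc k) = ?X'" "R (Suc k) = ?R'" "P (Suc k) = ?P'"
      by (simp_all add: X_def R_def P_def st_def pcg_step_def Let_def case_prod_beta fun_eq_iff)
    have s11: "F0 \<subseteq> F11" "F6 \<subseteq> F11" using s10 11(2) by auto
    have "?n9 + 2 * ?N + 2 * ?N \<le> n + (Suc k + 1) * (?N * (a + 16))"
      using N unfolding n0_def by (simp add: algebra_simps)
    then have "avail (n + (Suc k + 1) * (?N * (a + 16))) F11"
      using avail_mono[OF 11(1) _ order_refl] by blast
    then show ?case
      unfolding eq using order_trans[OF 0(2) s11(1)] order_trans[OF 10(3) 11(2)] order_trans[OF 6(3) s11(2)] 11(3)
      by (intro exI[of _ F11] conjI)
  qed
  moreover have "X k = (\<lambda>j. pcg I A D (b j) (x0 j) k)"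
    by (simp add: X_def st_def pcg_def fun_eq_iff)
  ultimately show ?thesis by auto
qed

lemma run_targets: "(\<And>i. i \<in> set q \<Longrightarrow> target i \<noteq> c) \<Longrightarrow> run q m c = m c"
proof (induction q arbitrary: m)
  case (Cons i q)
  have "target i \<noteq> c" by (rule Cons.prems) simp
  then show ?case using Cons.IH Cons.prems by (cases i) (simp add: run_def)
qed (simp add: run_def)

lemma run_outputs:
  assumes "distinct vs" and "\<And>v w. a v \<noteq> Output w"
  shows "v \<in> set vs \<Longrightarrow> run (map (\<lambda>v. Instr (Output v) Add (a v) (Work 0)) vs) m (Output v) = m (a v) + m (Work 0)"
  using assms(1)
proof (induction vs arbitrary: m)
  case (Cons w vs)
  define m' where "m' = m(Output w := m (a w) + m (Work 0))"
  have run: "run (map (\<lambda>v. Instr (Output v) Add (a v) (Work 0)) (w # vs)) m = run (map (\<lambda>v. Instr (Output v) Add (a v) (Work 0)) vs) m'"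
    by (simp add: run_def m'_def)
  show ?case
  proof (cases "v = w")
    case True
    then have "run (map (\<lambda>v. Instr (Output v) Add (a v) (Work 0)) vs) m' (Output v) = m' (Output v)"
      using Cons.prems by (intro run_targets) auto
    then show ?thesis unfolding run by (simp add: m'_def True)
  next
    case False
    then show ?thesis
      unfolding run using Cons assms(2)[of v w] by (auto simp: m'_def)
  qed
qed simp

text \<open>Available values may sit in any cell, even an input cell. A last pass copies them to
  their output cells by adding \<open>Work 0\<close>, which no earlier instruction has
  changed.\<close>

lemma avail_program:
  assumes "avail n F" and "finite I" and "vec I x \<subseteq> F" and zero: "\<And>j. j \<in> J \<Longrightarrow> inp j (Work 0) = 0"
  obtains p where "length p \<le> n + card I" and "\<And>j v. j \<in> J \<Longrightarrow> v \<in> I \<Longrightarrow> run p (inp j) (Output v) = x j v"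
proof -
  obtain p where p: "length p \<le> n" "ssa p" "\<And>f. f \<in> F \<Longrightarrow> \<exists>c. holds_in p c f"
    using assms(1) unfolding avail_def by blast
  \<comment> \<open>The default off \<open>I\<close> guarantees that no source is an
    \<open>Output\<close> cell, as \<open>run_outputs\<close> demands for every index.\<close>
  define a where "a v = (if v \<in> I then SOME c. holds_in p c (\<lambda>j. x j v) else Work 0)" for v
  have a: "holds_in p (a v) (\<lambda>j. x j v)" if "v \<in> I" for v
    using someI_ex[OF p(3)[OF vecD[OF assms(3) that]]] that by (simp add: a_def)
  have a_out: "a v \<noteq> Output w" for v w
    using a[of v] by (cases "v \<in> I") (auto simp: a_def holds_in_def untouched_def)
  obtain vs where vs: "set vs = I" "distinct vs" "length vs = card I"
    using finite_distinct_list[OF assms(2)] distinct_card by metis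
  define q where "q = p @ map (\<lambda>v. Instr (Output v) Add (a v) (Work 0)) vs"
  have "run q (inp j) (Output v) = x j v" if "j \<in> J" "v \<in> I" for j v
  proof -
    have "run p (inp j) (Work 0) = inp j (Work 0)"
      using p(2) by (intro run_targets) (auto simp: ssa_def in_set_conv_nth)
    moreover have "run q (inp j) = run (map (\<lambda>v. Instr (Output v) Add (a v) (Work 0)) vs) (run p (inp j))"
      by (simp add: q_def run_def)
    ultimately show ?thesis
      using run_outputs[of vs a v, OF vs(2) a_out] a[OF that(2)] that vs(1) zero[OF that(1)]
      by (simp add: holds_in_def)
  qed
  moreover have "length q \<le> n + card I" using p(1) vs(3) by (simp add: q_def)
  ultimately show thesis using that by blast
qed

end

lemma memory_le_operations: "memory p \<le> 3 * operations p"
proof -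
  have "memory p \<le> (\<Sum>i\<in>set p. card {target i, left_arg i, right_arg i})"
    unfolding memory_def by (rule card_UN_le) simp
  also have "\<dots> \<le> (\<Sum>i\<in>set p. 3)"
    by (intro sum_mono) (auto simp: card_insert_if)
  also have "\<dots> \<le> 3 * length p"
    using card_length[of p] by simp
  finally show ?thesis by (simp add: operations_def)
qed

section \<open>Barycentric coordinates\<close>

definition affine_fun :: "('a::euclidean_space \<Rightarrow> real) \<Rightarrow> bool" where
  "affine_fun g \<longleftrightarrow> (\<exists>a \<beta>. \<forall>x. g x = a \<bullet> x + \<beta>)"

lemma affine_funI: "(\<And>x. g x = a \<bullet> x + \<beta>) \<Longrightarrow> affine_fun g"
  by (auto simp: affine_fun_def)

lemma affine_fun_const: "affine_fun (\<lambda>x. c)"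
  by (rule affine_funI[of _ 0 c]) simp

lemma affine_fun_inner: "affine_fun (\<lambda>x. x \<bullet> b)"
  by (rule affine_funI[of _ b 0]) (simp add: inner_commute)

lemma affine_fun_add: "affine_fun f \<Longrightarrow> affine_fun g \<Longrightarrow> affine_fun (\<lambda>x. f x + g x)"
proof -
  assume "affine_fun f" "affine_fun g"
  then obtain a \<alpha> b \<beta> where "\<And>x. f x = a \<bullet> x + \<alpha>" "\<And>x. g x = b \<bullet> x + \<beta>"
    by (auto simp: affine_fun_def)
  then show ?thesis by (intro affine_funI[of _ "a + b" "\<alpha> + \<beta>"]) (simp add: inner_add_left)
qed

lemma affine_fun_cmult: "affine_fun f \<Longrightarrow> affine_fun (\<lambda>x. c * f x)"
proof -
  assume "affine_fun f"
  then obtain a \<alpha> where "\<And>x. f x = a \<bullet> x + \<alpha>" by (auto simp: affine_fun_def)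
  then show ?thesis by (intro affine_funI[of _ "c *\<^sub>R a" "c * \<alpha>"]) (simp add: algebra_simps)
qed

lemma affine_fun_sum: "(\<And>i. i \<in> S \<Longrightarrow> affine_fun (f i)) \<Longrightarrow> affine_fun (\<lambda>x. \<Sum>i\<in>S. f i x)"
proof (induction S rule: infinite_finite_induct)
  case (insert i S)
  then have "affine_fun (\<lambda>x. f i x + (\<Sum>i\<in>S. f i x))" by (intro affine_fun_add) auto
  then show ?case using insert.hyps by simp
qed (simp_all add: affine_fun_const)

lemma affine_fun_eq:
  assumes "affine_fun f" and "affine_fun g" and "affine hull V = UNIV" and "\<And>v. v \<in> V \<Longrightarrow> f v = g v"
  shows "f = g"
proof -
  have "affine_fun (\<lambda>x. f x + (-1) * g x)"
    using assms by (intro affine_fun_add affine_fun_cmult)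
  then obtain a \<beta> where d: "\<And>x. f x + (-1) * g x = a \<bullet> x + \<beta>" by (auto simp: affine_fun_def)
  have "V \<subseteq> {x. a \<bullet> x = - \<beta>}"
    using assms(4) by (auto simp flip: d simp: eq_neg_iff_add_eq_0)
  then have "affine hull V \<subseteq> {x. a \<bullet> x = - \<beta>}" by (intro hull_minimal affine_hyperplane)
  then have "a \<bullet> x = - \<beta>" for x using assms(3) by blast
  then have "f x - g x = 0" for x using d[of x] by simp
  then show ?thesis by (auto simp: fun_eq_iff)
qed

lemma affine_fun_convex_combination:
  assumes "affine_fun g" and "sum u V = 1"
  shows "g (\<Sum>v\<in>V. u v *\<^sub>R v) = (\<Sum>v\<in>V. u v * g v)"
proof -
  obtain a \<beta> where g: "\<And>x. g x = a \<bullet> x + \<beta>" using assms(1) by (auto simp: affine_fun_def)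
  have "(\<Sum>v\<in>V. u v * g v) = (\<Sum>v\<in>V. u v * (a \<bullet> v)) + \<beta> * sum u V"
    by (simp add: g algebra_simps sum.distrib sum_distrib_left)
  then show ?thesis using assms(2) by (simp add: g inner_sum_right)
qed

lemma continuous_on_affine_fun: "affine_fun g \<Longrightarrow> continuous_on S g"
proof -
  assume "affine_fun g"
  then obtain a \<beta> where "g = (\<lambda>x. a \<bullet> x + \<beta>)" by (auto simp: affine_fun_def)
  then show ?thesis by (auto intro!: continuous_intros)
qed

lemma linear_functional_inner:
  fixes h :: "'a::euclidean_space \<Rightarrow> real"
  assumes "linear h"
  shows "h y = (\<Sum>b\<in>Basis. h b *\<^sub>R b) \<bullet> y"
proof -
  have "h y = h (\<Sum>b\<in>Basis. (y \<bullet> b) *\<^sub>R b)" by (simp add: euclidean_representation)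
  also have "\<dots> = (\<Sum>b\<in>Basis. (y \<bullet> b) * h b)"
    using assms by (simp add: linear_sum linear_cmul)
  finally show ?thesis by (simp add: inner_sum_left inner_commute[of y] mult.commute)
qed

text \<open>After translation by a vertex \<open>a\<close>, affine independence is linear
  independence of the differences, on which a linear functional can be prescribed.\<close>

lemma affine_interpolation:
  fixes V :: "'a::euclidean_space set"
  assumes "\<not> affine_dependent V"
  shows "\<exists>g. affine_fun g \<and> (\<forall>v\<in>V. g v = f v)"
proof (cases "V = {}")
  case False
  then obtain a where a: "a \<in> V" by blast
  then have "independent ((\<lambda>x. - a + x) ` (V - {a}))"
    using affine_dependent_iff_dependent2[OF a] assms by simp
  then obtain h where h: "linear h" "\<forall>x\<in>(\<lambda>x. - a + x) ` (V - {a}). h x = f (a + x) - f a"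
    using linear_independent_extend[of _ "\<lambda>x. f (a + x) - f a"] by blast
  define g where "g x = (\<Sum>b\<in>Basis. h b *\<^sub>R b) \<bullet> x + (f a - h a)" for x
  have "affine_fun g" by (rule affine_funI) (rule g_def)
  moreover have "g v = f v" if "v \<in> V" for v
  proof (cases "v = a")
    case True
    then show ?thesis by (simp add: g_def flip: linear_functional_inner[OF h(1)])
  next
    case False
    then have "h (- a + v) = f v - f a" using h(2) that by auto
    then have "h v - h a = f v - f a" using linear_diff[OF h(1), of v a] by simp
    then show ?thesis by (simp add: g_def flip: linear_functional_inner[OF h(1)])
  qed
  ultimately show ?thesis by blast
qed (use affine_fun_const in auto)

text \<open>Affine on the whole space, so that it can be followed along lines that leave
  \<open>E\<close>. For \<open>v\<close> outside the vertices of a simplex all interpolated values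
  are 0 and so is the function, which lets one formula describe every hat function on every
  element.\<close>

definition bary :: "'a::euclidean_space set \<Rightarrow> 'a \<Rightarrow> 'a \<Rightarrow> real" where
  "bary E v = (SOME g. affine_fun g \<and> (\<forall>w\<in>simplex_vertices E. g w = (if w = v then 1 else 0)))"

definition bary_grad :: "'a::euclidean_space set \<Rightarrow> 'a \<Rightarrow> 'a" where
  "bary_grad E v = (SOME a. \<exists>\<beta>. \<forall>x. bary E v x = a \<bullet> x + \<beta>)"

locale full_simplex =
  fixes E :: "'a::euclidean_space set"
  assumes simplex: "int DIM('a) simplex E"
begin

abbreviation V where "V \<equiv> simplex_vertices E"

lemma vertices: "finite V" "\<not> affine_dependent V" "card V = DIM('a) + 1" "E = convex hull V"
proof -
  obtain C where C: "\<not> affine_dependent C" "int (card C) = int DIM('a) + 1" "E = convex hull C"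
    using simplex by (auto simp: simplex_def)
  then have "V = C"
    by (simp add: simplex_vertices_def extreme_point_of_convex_hull_affine_independent)
  with C show "\<not> affine_dependent V" "card V = DIM('a) + 1" "E = convex hull V" by auto
  then show "finite V" by (metis aff_independent_finite)
qed

lemma affine_hull_vertices: "affine hull V = UNIV"
  using aff_dim_affine_independent[OF vertices(2)] vertices(3) aff_dim_eq_full[of V] by simp

lemma vertices_subset: "V \<subseteq> E"
  using hull_subset[of V convex] vertices(4) by simp

lemma compact: "compact E" and convex: "convex E" and nonempty: "E \<noteq> {}"
proof -
  show "compact E" by (subst vertices(4)) (simp add: finite_imp_compact_convex_hull vertices(1))
  show "convex E" by (subst vertices(4)) simp
  show "E \<noteq> {}" using vertices_subset vertices(3) by fastforce
qed

lemma bary: "affine_fun (bary E v)" "w \<in> V \<Longrightarrow> bary E v w = (if w = v then 1 else 0)"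
  using someI_ex[OF affine_interpolation[OF vertices(2), of "\<lambda>w. if w = v then 1 else 0"], folded bary_def]
  by blast+

lemma bary_grad: "bary E v y - bary E v x = bary_grad E v \<bullet> (y - x)"
proof -
  have "\<exists>a \<beta>. \<forall>x. bary E v x = a \<bullet> x + \<beta>" using bary(1)[of v] by (simp add: affine_fun_def)
  from someI_ex[OF this, folded bary_grad_def] obtain \<beta> where "\<forall>x. bary E v x = bary_grad E v \<bullet> x + \<beta>" ..
  then show ?thesis by (simp add: inner_diff_right)
qed

lemma affine_eq: "affine_fun f \<Longrightarrow> affine_fun g \<Longrightarrow> (\<And>v. v \<in> V \<Longrightarrow> f v = g v) \<Longrightarrow> f = g"
  using affine_fun_eq[OF _ _ affine_hull_vertices] by blast

lemma affine_bary: "affine_fun g \<Longrightarrow> g x = (\<Sum>v\<in>V. bary E v x * g v)"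
proof -
  assume g: "affine_fun g"
  have "g = (\<lambda>x. \<Sum>v\<in>V. g v * bary E v x)"
    using g by (rule affine_eq) (auto intro!: affine_fun_sum affine_fun_cmult bary simp: bary(2) vertices(1) if_distrib cong: if_cong)
  then have "g x = (\<Sum>v\<in>V. g v * bary E v x)" by (rule fun_cong)
  then show ?thesis by (simp add: mult.commute)
qed

lemma bary_not_vertex:
  assumes "v \<notin> V"
  shows "bary E v x = 0"
proof -
  have "bary E v w = 0" if "w \<in> V" for w using bary(2)[OF that, of v] that assms by auto
  then have "bary E v = (\<lambda>x. 0)" by (rule affine_eq[OF bary(1) affine_fun_const])
  then show ?thesis by simp
qed

lemma bary_sum: "(\<Sum>v\<in>V. bary E v x) = 1"
  using affine_bary[OF affine_fun_const[of 1], of x] by simp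

lemma bary_combination: "(\<Sum>v\<in>V. bary E v x *\<^sub>R v) = x"
proof (rule euclidean_eqI)
  fix b :: 'a
  show "(\<Sum>v\<in>V. bary E v x *\<^sub>R v) \<bullet> b = x \<bullet> b"
    using affine_bary[OF affine_fun_inner[of b], of x] by (simp add: inner_sum_left)
qed

lemma bary_unique:
  assumes "sum u V = 1" and "(\<Sum>v\<in>V. u v *\<^sub>R v) = x" and "v \<in> V"
  shows "bary E v x = u v"
proof -
  have "bary E v x = (\<Sum>w\<in>V. u w * bary E v w)"
    using affine_fun_convex_combination[OF bary(1) assms(1)] assms(2) by simp
  then show ?thesis using assms(3) vertices(1) by (simp add: bary(2) if_distrib cong: if_cong)
qed

lemma mem_iff_bary: "x \<in> E \<longleftrightarrow> (\<forall>v\<in>V. 0 \<le> bary E v x)"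
proof -
  have "x \<in> E \<longleftrightarrow> x \<in> convex hull V" using arg_cong[OF vertices(4)] .
  also have "\<dots> \<longleftrightarrow> (\<exists>u. (\<forall>v\<in>V. 0 \<le> u v) \<and> sum u V = 1 \<and> (\<Sum>v\<in>V. u v *\<^sub>R v) = x)"
    by (simp add: convex_hull_finite[OF vertices(1)])
  also have "\<dots> \<longleftrightarrow> (\<forall>v\<in>V. 0 \<le> bary E v x)"
  proof
    assume "\<exists>u. (\<forall>v\<in>V. 0 \<le> u v) \<and> sum u V = 1 \<and> (\<Sum>v\<in>V. u v *\<^sub>R v) = x"
    then show "\<forall>v\<in>V. 0 \<le> bary E v x" using bary_unique by metis
  next
    assume "\<forall>v\<in>V. 0 \<le> bary E v x"
    then show "\<exists>u. (\<forall>v\<in>V. 0 \<le> u v) \<and> sum u V = 1 \<and> (\<Sum>v\<in>V. u v *\<^sub>R v) = x"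
      using bary_sum bary_combination by (intro exI[of _ "\<lambda>v. bary E v x"]) blast
  qed
  finally show ?thesis .
qed

lemma bary_nonneg: "x \<in> E \<Longrightarrow> 0 \<le> bary E v x"
  using mem_iff_bary[of x] bary_not_vertex[of v x] by (cases "v \<in> V") auto

lemma bary_le_1: "x \<in> E \<Longrightarrow> bary E v x \<le> 1"
proof (cases "v \<in> V")
  case True
  assume "x \<in> E"
  then have "bary E v x \<le> (\<Sum>v\<in>V. bary E v x)"
    using True vertices(1) bary_nonneg by (intro member_le_sum) auto
  then show ?thesis by (simp add: bary_sum)
qed (simp add: bary_not_vertex)

lemma bary_eq_1: "bary E v x = 1 \<Longrightarrow> x \<in> E \<Longrightarrow> x = v"
proof -
  assume *: "bary E v x = 1" "x \<in> E"
  then have v: "v \<in> V" using bary_not_vertex by force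
  have "(\<Sum>w\<in>V - {v}. bary E w x) = 0"
    using bary_sum[of x] * v vertices(1) by (simp add: sum.remove)
  then have "\<forall>w\<in>V - {v}. bary E w x = 0"
    using vertices(1) bary_nonneg[OF *(2)] by (subst (asm) sum_nonneg_eq_0_iff) auto
  then have "(\<Sum>w\<in>V. bary E w x *\<^sub>R w) = v"
    using v vertices(1) * by (simp add: sum.remove)
  then show ?thesis by (simp add: bary_combination)
qed

text \<open>Moving \<open>x\<close> away from \<open>v\<close> until the coordinate of
  \<open>v\<close> becomes 0 stays in \<open>E\<close> and ends at \<open>z\<close>. Then
  \<open>x\<close> is inside the segment from \<open>v\<close> to \<open>z\<close>, and a face
  containing an inner point of a segment in \<open>E\<close> contains its ends.\<close>

lemma face_contains_support:
  assumes "F face_of E" and "x \<in> F" and "0 < bary E v x"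
  shows "v \<in> F"
proof (cases "x = v")
  case False
  have x: "x \<in> E" using assms face_of_imp_subset by blast
  define t where "t = bary E v x"
  have v: "v \<in> V" using assms(3) bary_not_vertex by force
  have t: "0 < t" "t < 1"
    using assms(3) bary_le_1[OF x, of v] bary_eq_1[OF _ x, of v] False by (auto simp: t_def less_le)
  define z where "z = v + (1 / (1 - t)) *\<^sub>R (x - v)"
  have bz: "bary E w z = bary E w v + (1 / (1 - t)) * (bary E w x - bary E w v)" for w
    using bary_grad[of w z v] bary_grad[of w x v] by (simp add: z_def)
  have "z \<in> E" unfolding mem_iff_bary
  proof
    fix w assume w: "w \<in> V"
    show "0 \<le> bary E w z"
    proof (cases "w = v")
      case True
      then show ?thesis using t v by (simp add: bz bary(2) t_def field_simps)
    next
      case False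
      then show ?thesis using t v bary_nonneg[OF x, of w] by (simp add: bz bary(2))
    qed
  qed
  moreover have "x = (1 - (1 - t)) *\<^sub>R v + (1 - t) *\<^sub>R z"
    using t by (simp add: z_def algebra_simps)
  then have "x \<in> open_segment v z"
    using t False by (auto simp: in_segment z_def intro!: exI[of _ "1 - t"])
  ultimately show ?thesis
    using assms(1,2) v vertices_subset unfolding face_of_def by blast
qed (use assms in simp)

end

text \<open>This is what makes the nodal interpolant on a face-to-face mesh well defined.\<close>

lemma bary_agree:
  assumes "full_simplex E" and "full_simplex E'"
    and "(E \<inter> E') face_of E" and "(E \<inter> E') face_of E'" and "x \<in> E \<inter> E'"
  shows "bary E w x = bary E' w x"
proof -
  interpret A: full_simplex E by fact
  interpret B: full_simplex E' by fact
  \<comment> \<open>A vertex with positive coordinate lies in the common face, is extreme there and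
    hence a vertex of \<open>E'\<close>. So the coordinates with respect to \<open>E\<close> also
    represent \<open>x\<close> by vertices of \<open>E'\<close>, and uniqueness applies.\<close>
  have supp: "v \<in> B.V" if "v \<in> A.V" "bary E v x \<noteq> 0" for v
  proof -
    have "0 < bary E v x" using that A.bary_nonneg[of x v] assms(5) by auto
    then have "v \<in> E \<inter> E'" by (rule A.face_contains_support[OF assms(3,5)])
    moreover have "v extreme_point_of E" using that(1) by (simp add: simplex_vertices_def)
    ultimately have "v extreme_point_of (E \<inter> E')" using extreme_point_of_face[OF assms(3)] by blast
    then have "v extreme_point_of E'" using extreme_point_of_face[OF assms(4)] by blast
    then show ?thesis by (simp add: simplex_vertices_def)
  qed
  have z: "bary E v x = 0" if "v \<notin> A.V" for v using that A.bary_not_vertex by blast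
  have eq: "(\<Sum>v\<in>B.V. f v) = (\<Sum>v\<in>A.V. f v)" if "\<And>v. bary E v x = 0 \<Longrightarrow> f v = 0" for f :: "'a \<Rightarrow> 'b::comm_monoid_add"
    using supp z that A.vertices(1) B.vertices(1) by (intro sum.mono_neutral_cong) auto
  have c: "(\<Sum>v\<in>B.V. bary E v x) = 1" "(\<Sum>v\<in>B.V. bary E v x *\<^sub>R v) = x"
    using eq[of "\<lambda>v. bary E v x"] eq[of "\<lambda>v. bary E v x *\<^sub>R v"] by (simp_all add: A.bary_sum A.bary_combination)
  show ?thesis
  proof (cases "w \<in> B.V")
    case True
    then show ?thesis using B.bary_unique[OF c] by simp
  next
    case False
    then show ?thesis using supp[of w] z[of w] B.bary_not_vertex by metis
  qed
qed

subsection \<open>Mass integrals on a simplex\<close>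

abbreviation unit_ind :: "real \<Rightarrow> ennreal" where "unit_ind \<equiv> indicator {0..<1}"

text \<open>Reduction to lines by translation invariance alone.\<close>

lemma nn_integral_line_average:
  fixes F :: "'a::euclidean_space \<Rightarrow> ennreal"
  assumes F[measurable]: "F \<in> borel_measurable borel" and l[measurable]: "l \<in> borel_measurable borel"
    and shift: "\<And>x s. l (x + s *\<^sub>R e) = l x + s"
  shows "(\<integral>\<^sup>+x. F x \<partial>lborel) = (\<integral>\<^sup>+x. unit_ind (l x) * (\<integral>\<^sup>+s. F (x + s *\<^sub>R e) \<partial>lborel) \<partial>lborel)"
proof -
  have "(\<integral>\<^sup>+x. unit_ind (l x) * (\<integral>\<^sup>+s. F (x + s *\<^sub>R e) \<partial>lborel) \<partial>lborel)
      = (\<integral>\<^sup>+x. \<integral>\<^sup>+s. unit_ind (l x) * F (x + s *\<^sub>R e) \<partial>lborel \<partial>lborel)"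
    by (intro nn_integral_cong, subst nn_integral_cmult) auto
  also have "\<dots> = (\<integral>\<^sup>+s. \<integral>\<^sup>+x. unit_ind (l x) * F (x + s *\<^sub>R e) \<partial>lborel \<partial>lborel)"
    by (rule lborel_pair.Fubini') measurable
  also have "\<dots> = (\<integral>\<^sup>+s. \<integral>\<^sup>+x. unit_ind (l x - s) * F x \<partial>lborel \<partial>lborel)"
  proof (rule nn_integral_cong)
    fix s :: real
    define G where "G x = unit_ind (l x - s) * F x" for x
    have G[measurable]: "G \<in> borel_measurable borel" unfolding G_def by measurable
    have "(\<integral>\<^sup>+x. G x \<partial>lborel) = (\<integral>\<^sup>+x. G x \<partial>distr lborel borel ((+) (s *\<^sub>R e)))"
      by (simp add: lborel_distr_plus)
    also have "\<dots> = (\<integral>\<^sup>+x. G (s *\<^sub>R e + x) \<partial>lborel)"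
      by (subst nn_integral_distr) auto
    also have "\<dots> = (\<integral>\<^sup>+x. unit_ind (l x) * F (x + s *\<^sub>R e) \<partial>lborel)"
      by (simp add: G_def shift add.commute[of "s *\<^sub>R e"])
    finally show "(\<integral>\<^sup>+x. unit_ind (l x) * F (x + s *\<^sub>R e) \<partial>lborel) = (\<integral>\<^sup>+x. unit_ind (l x - s) * F x \<partial>lborel)"
      by (simp add: G_def)
  qed
  also have "\<dots> = (\<integral>\<^sup>+x. \<integral>\<^sup>+s. unit_ind (l x - s) * F x \<partial>lborel \<partial>lborel)"
    by (rule lborel_pair.Fubini'[symmetric]) measurable
  also have "\<dots> = (\<integral>\<^sup>+x. F x \<partial>lborel)"
  proof (rule nn_integral_cong)
    \<comment> \<open>For fixed \<open>x\<close> the admissible \<open>s\<close> fill an interval of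
      length one.\<close>
    fix x
    have "(\<integral>\<^sup>+s. unit_ind (l x - s) * F x \<partial>lborel) = (\<integral>\<^sup>+s. indicator {l x - 1<..l x} s * F x \<partial>lborel)"
      by (intro nn_integral_cong) (auto simp: indicator_def)
    also have "\<dots> = F x" by (subst nn_integral_multc) auto
    finally show "(\<integral>\<^sup>+s. unit_ind (l x - s) * F x \<partial>lborel) = F x" .
  qed
  finally show ?thesis ..
qed

text \<open>On a line the two coordinates involved are \<open>p + s\<close> and
  \<open>r - s\<close>, with constant sum \<open>a = p + r\<close>; the integrals are
  \<open>a^3 / 3\<close> and \<open>a^3 / 6\<close>. If the interval is empty, both vanish.\<close>

lemma nn_integral_quadratics:
  fixes p r :: real
  shows "(\<integral>\<^sup>+s. ennreal (indicator {-p..r} s * (p + s)\<^sup>2) \<partial>lborel)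
    = 2 * (\<integral>\<^sup>+s. ennreal (indicator {-p..r} s * ((p + s) * (r - s))) \<partial>lborel)"
proof (cases "- p \<le> r")
  case True
  have "(\<integral>\<^sup>+s. ennreal ((p + s)\<^sup>2) * indicator {-p..r} s \<partial>lborel) = (p + r) ^ 3 / 3 - (p + (- p)) ^ 3 / 3"
    using True by (intro nn_integral_FTC_Icc) (auto intro!: derivative_eq_intros simp: power2_eq_square)
  moreover have "(\<integral>\<^sup>+s. ennreal ((p + s) * (r - s)) * indicator {-p..r} s \<partial>lborel)
      = ((p + r) * (p + r)\<^sup>2 / 2 - (p + r) ^ 3 / 3) - ((p + r) * (p + (- p))\<^sup>2 / 2 - (p + (- p)) ^ 3 / 3)"
  proof (rule nn_integral_FTC_Icc)
    fix s assume "s \<in> {- p..r}"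
    then show "0 \<le> (p + s) * (r - s)" by simp
    show "((\<lambda>s. (p + r) * (p + s)\<^sup>2 / 2 - (p + s) ^ 3 / 3) has_real_derivative (p + s) * (r - s)) (at s)"
      by (auto intro!: derivative_eq_intros simp: power2_eq_square) (simp add: field_simps)
  qed (use True in auto)
  moreover have "(p + r) ^ 3 / 3 - (p + (- p)) ^ 3 / 3 = 2 * (((p + r) * (p + r)\<^sup>2 / 2 - (p + r) ^ 3 / 3) - ((p + r) * (p + (- p))\<^sup>2 / 2 - (p + (- p)) ^ 3 / 3))"
    by (simp add: power2_eq_square power3_eq_cube algebra_simps)
  moreover have "2 * ennreal t = ennreal (2 * t)" for t
    by (simp add: ennreal_mult')
  ultimately have "(\<integral>\<^sup>+s. ennreal ((p + s)\<^sup>2) * indicator {-p..r} s \<partial>lborel) = 2 * (\<integral>\<^sup>+s. ennreal ((p + s) * (r - s)) * indicator {-p..r} s \<partial>lborel)"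
    by (simp only:)
  moreover have "ennreal (indicator {-p..r} s * t) = ennreal t * indicator {-p..r} s" for s t
    by (simp add: indicator_def)
  ultimately show ?thesis by simp
qed simp

context full_simplex
begin

lemma measurable_bary [measurable]: "bary E v \<in> borel_measurable borel"
  using continuous_on_affine_fun[OF bary(1)] by (rule borel_measurable_continuous_onI)

lemma measurable_simplex [measurable]: "E \<in> sets borel"
  using compact by (rule borel_compact)

text \<open>Along the direction \<open>v - w\<close> only the coordinates of \<open>v\<close> and
  \<open>w\<close> change, with opposite speed. A line on which the others are nonnegative meets
  \<open>E\<close> exactly where these two are, so the ratio 2 of the one-dimensional integrals is
  inherited by the simplex without passing to a reference simplex.\<close>

lemma nn_integral_bary_pair:
  assumes "v \<in> V" and "w \<in> V" and "v \<noteq> w"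
  shows "(\<integral>\<^sup>+x. ennreal (indicator E x * (bary E v x * bary E v x)) \<partial>lborel)
    = 2 * (\<integral>\<^sup>+x. ennreal (indicator E x * (bary E v x * bary E w x)) \<partial>lborel)"
proof -
  define e where "e = v - w"
  have shift: "bary E u (x + s *\<^sub>R e) = bary E u x + s * (bary E u v - bary E u w)" for u x s
    using bary_grad[of u "x + s *\<^sub>R e" x] bary_grad[of u v w] by (simp add: e_def)
  define Q where "Q x \<longleftrightarrow> (\<forall>u\<in>V - {v, w}. 0 \<le> bary E u x)" for x
  have mem: "x + s *\<^sub>R e \<in> E \<longleftrightarrow> Q x \<and> s \<in> {- bary E v x..bary E w x}" for x s
  proof -
    have "x + s *\<^sub>R e \<in> E \<longleftrightarrow> (\<forall>u\<in>V - {v, w}. 0 \<le> bary E u (x + s *\<^sub>R e)) \<and> 0 \<le> bary E v (x + s *\<^sub>R e) \<and> 0 \<le> bary E w (x + s *\<^sub>R e)"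
      using assms unfolding mem_iff_bary by blast
    also have "(\<forall>u\<in>V - {v, w}. 0 \<le> bary E u (x + s *\<^sub>R e)) \<longleftrightarrow> Q x"
      unfolding Q_def using assms by (intro ball_cong refl) (auto simp: shift bary(2))
    finally show ?thesis using assms by (auto simp: shift bary(2))
  qed
  have line: "(\<integral>\<^sup>+x. F x \<partial>lborel) = (\<integral>\<^sup>+x. unit_ind (bary E v x) * (\<integral>\<^sup>+s. F (x + s *\<^sub>R e) \<partial>lborel) \<partial>lborel)"
    if "F \<in> borel_measurable borel" for F :: "'a \<Rightarrow> ennreal"
    using that assms by (intro nn_integral_line_average) (auto simp: shift bary(2))
  have inner: "(\<integral>\<^sup>+s. ennreal (indicator E (x + s *\<^sub>R e) * (bary E v (x + s *\<^sub>R e) * bary E v (x + s *\<^sub>R e))) \<partial>lborel)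
    = 2 * (\<integral>\<^sup>+s. ennreal (indicator E (x + s *\<^sub>R e) * (bary E v (x + s *\<^sub>R e) * bary E w (x + s *\<^sub>R e))) \<partial>lborel)" for x
  proof (cases "Q x")
    case True
    then have "indicator E (x + s *\<^sub>R e) = (indicator {- bary E v x..bary E w x} s :: real)" for s
      using mem[of x s] by (simp add: indicator_def)
    then show ?thesis
      using nn_integral_quadratics[of "bary E v x" "bary E w x"] assms
      by (simp add: shift bary(2) power2_eq_square)
  next
    case False
    then have "indicator E (x + s *\<^sub>R e) = (0 :: real)" for s
      using mem[of x s] by (simp add: indicator_def)
    then show ?thesis by simp
  qed
  show ?thesis
    by (subst (1 2) line, measurable)
      (simp add: inner mult.left_commute[of _ 2] nn_integral_cmult)
qed

lemma integral_nonneg_simplex: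
  fixes f :: "'a \<Rightarrow> real"
  assumes [measurable]: "f \<in> borel_measurable borel" and "\<And>x. x \<in> E \<Longrightarrow> 0 \<le> f x"
  shows "(LINT x|lebesgue_on E. f x) = enn2real (\<integral>\<^sup>+x. ennreal (indicator E x * f x) \<partial>lborel)"
proof -
  have "(LINT x|lebesgue_on E. f x) = (LINT x|lebesgue. indicator E x *\<^sub>R f x)"
    by (rule integral_restrict_space) auto
  also have "\<dots> = (LINT x|lborel. indicator E x *\<^sub>R f x)"
    by (rule integral_completion) auto
  also have "\<dots> = enn2real (\<integral>\<^sup>+x. ennreal (indicator E x * f x) \<partial>lborel)"
    using assms(2) by (subst integral_eq_nn_integral) (auto simp: indicator_def)
  finally show ?thesis .
qed

lemma integrable_continuous_simplex:
  fixes f :: "'a \<Rightarrow> real"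
  assumes "continuous_on E f"
  shows "integrable (lebesgue_on E) f"
proof -
  have "integrable lborel (\<lambda>x. indicator E x *\<^sub>R f x)"
    using compact assms by (rule borel_integrable_compact)
  then have "integrable lebesgue (\<lambda>x. indicator E x *\<^sub>R f x)"
    by (subst integrable_completion) auto
  then show ?thesis by (subst integrable_restrict_space) auto
qed

text \<open>The off-diagonal entry of the element mass matrix.\<close>

definition weight :: real where
  "weight = measure lebesgue E / ((real DIM('a) + 1) * (real DIM('a) + 2))"

lemma continuous_bary: "continuous_on S (bary E v)"
  by (rule continuous_on_affine_fun[OF bary(1)])

text \<open>The ratio 2 fixes the element mass matrix up to one factor, since
  \<open>m v v = 2 m v w = 2 m w v = m w w\<close>; the factor follows from the partition of unity,
  whose integral is the volume.\<close>

lemma integral_bary_product: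
  assumes "v \<in> V" and "w \<in> V"
  shows "(LINT x|lebesgue_on E. bary E v x * bary E w x) = weight * (if v = w then 2 else 1)"
    and integral_bary: "(LINT x|lebesgue_on E. bary E v x) = weight * (real DIM('a) + 2)"
proof -
  define m where "m v w = (LINT x|lebesgue_on E. bary E v x * bary E w x)" for v w
  have pair: "m v v = 2 * m v w" if "v \<in> V" "w \<in> V" "v \<noteq> w" for v w
  proof -
    have "m u w = enn2real (\<integral>\<^sup>+x. ennreal (indicator E x * (bary E u x * bary E w x)) \<partial>lborel)" for u w
      unfolding m_def by (rule integral_nonneg_simplex) (auto intro: mult_nonneg_nonneg bary_nonneg)
    then show ?thesis using arg_cong[OF nn_integral_bary_pair[OF that], of enn2real] by (simp add: enn2real_mult)
  qed
  have sym: "m v w = m w v" for v w by (simp add: m_def mult.commute)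
  have int: "integrable (lebesgue_on E) (\<lambda>x. bary E v x * bary E w x)" "integrable (lebesgue_on E) (bary E v)" for v w
    by (intro integrable_continuous_simplex continuous_on_mult continuous_bary)+
  have diag: "m w w = m v v" if "w \<in> V" for w
    using pair[of v w, OF assms(1) that] pair[of w v, OF that assms(1)] sym[of v w] by fastforce
  define c where "c = m v v / 2"
  have m: "m u w = c * (if u = w then 2 else 1)" if "u \<in> V" "w \<in> V" for u w
    using diag[OF that(1)] pair[OF that] unfolding c_def by force
  have I: "(LINT x|lebesgue_on E. bary E u x) = c * (real DIM('a) + 2)" if "u \<in> V" for u
  proof -
    have "(LINT x|lebesgue_on E. bary E u x) = (LINT x|lebesgue_on E. (\<Sum>w\<in>V. bary E u x * bary E w x))"
      by (simp add: sum_distrib_left[symmetric] bary_sum)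
    also have "\<dots> = (\<Sum>w\<in>V. m u w)" unfolding m_def by (intro Bochner_Integration.integral_sum int)
    also have "\<dots> = (\<Sum>w\<in>V. c + (if u = w then c else 0))"
      using m that by (intro sum.cong refl) auto
    also have "\<dots> = c * (real DIM('a) + 2)"
      using that vertices(1,3) by (simp add: sum.distrib algebra_simps)
    finally show ?thesis .
  qed
  have "measure lebesgue E = (LINT x|lebesgue_on E. (\<Sum>u\<in>V. bary E u x))"
    unfolding bary_sum using compact by (simp add: measure_restrict_space)
  also have "\<dots> = (\<Sum>u\<in>V. LINT x|lebesgue_on E. bary E u x)" by (intro Bochner_Integration.integral_sum int)
  also have "\<dots> = (real DIM('a) + 1) * (c * (real DIM('a) + 2))"
    using I vertices(3) by (simp add: algebra_simps)
  finally have "c = weight" by (simp add: weight_def)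
  with m assms I show "(LINT x|lebesgue_on E. bary E v x * bary E w x) = weight * (if v = w then 2 else 1)"
    "(LINT x|lebesgue_on E. bary E v x) = weight * (real DIM('a) + 2)"
    by (simp_all add: m_def)
qed

end

section \<open>Meshes\<close>

lemma open_step:
  fixes x w :: "'a::real_normed_vector"
  assumes "open U" and "x \<in> U" and "0 < r"
  obtains t :: real where "0 < t" "t < r" "x + t *\<^sub>R w \<in> U"
proof -
  have "((\<lambda>t. x + t *\<^sub>R w) \<longlongrightarrow> x + 0 *\<^sub>R w) (at_right 0)" by (intro tendsto_intros)
  then have "eventually (\<lambda>t. x + t *\<^sub>R w \<in> U) (at_right 0)"
    using assms by (intro topological_tendstoD) auto
  moreover have "eventually (\<lambda>t::real. 0 < t \<and> t < r) (at_right 0)"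
    using assms(3) by (auto simp: eventually_at_right_field)
  ultimately have "eventually (\<lambda>t. x + t *\<^sub>R w \<in> U \<and> 0 < t \<and> t < r) (at_right (0::real))"
    by eventually_elim auto
  then show thesis
    using that eventually_happens'[OF trivial_limit_at_right_real] by blast
qed

text \<open>This excludes slits, so that boundary vertices cannot lie in the interior of the meshed set.\<close>

lemma lipschitz_frontier_not_interior_closure:
  fixes \<Omega> :: "'a::euclidean_space set"
  assumes "open \<Omega>" and "lipschitz_boundary \<Omega>" and x: "x \<in> frontier \<Omega>"
  shows "x \<notin> interior (closure \<Omega>)"
proof
  assume int: "x \<in> interior (closure \<Omega>)"
  obtain r e g K where r: "0 < r" and e: "norm e = 1" and g: "K-lipschitz_on {z. z \<bullet> e = 0} g"
    and \<Omega>: "\<Omega> \<inter> ball x r = {y \<in> ball x r. g (y - (y \<bullet> e) *\<^sub>R e) < y \<bullet> e}"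
    using assms(2) x unfolding lipschitz_boundary_def by blast
  define \<pi> where "\<pi> y = y - (y \<bullet> e) *\<^sub>R e" for y
  have ee: "e \<bullet> e = 1" using e by (simp add: dot_square_norm)
  have \<pi>: "\<pi> y \<in> {z. z \<bullet> e = 0}" for y by (simp add: \<pi>_def inner_diff_left ee)
  have "continuous_on UNIV \<pi>" unfolding \<pi>_def by (intro continuous_intros)
  moreover have "continuous_on (\<pi> ` UNIV) g"
    using \<pi> by (intro continuous_on_subset[OF lipschitz_on_continuous_on[OF g]]) auto
  ultimately have cont: "continuous_on UNIV (\<lambda>y. g (\<pi> y) - y \<bullet> e)"
    by (intro continuous_on_diff continuous_on_compose2[of "\<pi> ` UNIV" g UNIV \<pi>] continuous_intros) auto
  have "x \<notin> \<Omega>" using x assms(1) by (auto simp: frontier_def interior_open)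
  then have "x \<notin> \<Omega> \<inter> ball x r" by blast
  then have gx: "x \<bullet> e \<le> g (\<pi> x)" unfolding \<Omega> using r by (simp add: \<pi>_def)
  \<comment> \<open>A small step against \<open>e\<close> leads strictly below the graph, to a point
    with a neighbourhood that misses \<open>\<Omega>\<close>; by assumption it is nevertheless in
    the closure.\<close>
  obtain t where t: "0 < t" "t < r" "x - t *\<^sub>R e \<in> interior (closure \<Omega>)"
    using open_step[OF open_interior int r, of "- e"] by auto
  define y where "y = x - t *\<^sub>R e"
  define U where "U = {z \<in> ball x r. 0 < g (\<pi> z) - z \<bullet> e}"
  have "U = ball x r \<inter> {z. 0 < g (\<pi> z) - z \<bullet> e}" by (auto simp: U_def)
  moreover have "open {z. 0 < g (\<pi> z) - z \<bullet> e}"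
    by (rule open_Collect_less[OF continuous_on_const cont])
  ultimately have "open U" by (simp add: open_Int)
  moreover have "z \<notin> \<Omega>" if "z \<in> U" for z
  proof
    assume "z \<in> \<Omega>"
    then have "z \<in> \<Omega> \<inter> ball x r" using that by (simp add: U_def)
    then have "g (\<pi> z) < z \<bullet> e" unfolding \<Omega> by (simp add: \<pi>_def)
    then show False using that by (simp add: U_def)
  qed
  then have "U \<inter> \<Omega> = {}" by blast
  ultimately have "U \<inter> closure \<Omega> = {}" by (simp add: open_Int_closure_eq_empty)
  moreover have "y \<in> U"
  proof -
    have "y \<bullet> e = x \<bullet> e - t" by (simp add: y_def inner_diff_left ee)
    moreover have "\<pi> y = \<pi> x" by (simp add: \<pi>_def y_def inner_diff_left ee algebra_simps)
    ultimately show ?thesis using gx t e by (simp add: U_def y_def dist_norm)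
  qed
  moreover have "y \<in> closure \<Omega>" using t(3) interior_subset by (auto simp: y_def)
  ultimately show False by blast
qed

locale mesh_domain =
  fixes \<Omega> :: "'a::euclidean_space set"
  assumes lip: "lipschitz_polyhedral_domain \<Omega>"
begin

lemma domain: "open \<Omega>" "bounded \<Omega>" "\<Omega> \<noteq> {}" "lipschitz_boundary \<Omega>"
  using lip by (auto simp: lipschitz_polyhedral_domain_def)

lemma frontier_not_interior_closure: "x \<in> frontier \<Omega> \<Longrightarrow> x \<notin> interior (closure \<Omega>)"
  using lipschitz_frontier_not_interior_closure domain by blast

end

locale mesh = mesh_domain \<Omega> for \<Omega> :: "'a::euclidean_space set" +
  fixes T :: "'a set set"
  assumes adm: "admissible_mesh \<Omega> T"
begin

lemma finite_T: "finite T" and union_T: "\<Union>T = closure \<Omega>" and full: "E \<in> T \<Longrightarrow> full_simplex E"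
  and face: "E \<in> T \<Longrightarrow> E' \<in> T \<Longrightarrow> (E \<inter> E') face_of E"
  using adm by (auto simp: admissible_mesh_def triangulation_def full_simplex_def)

abbreviation vs where "vs \<equiv> simplex_vertices"

lemma finite_vertices: "finite (mesh_vertices T)"
  unfolding mesh_vertices_def using finite_T full_simplex.vertices(1)[OF full] by blast

abbreviation I where "I \<equiv> interior_vertices \<Omega> T"
abbreviation fe where "fe \<equiv> fe_function \<Omega> T"

lemma finite_interior_vertices: "finite I"
  using finite_vertices by (simp add: interior_vertices_def)

lemma vertices_mesh: "E \<in> T \<Longrightarrow> vs E \<subseteq> mesh_vertices T"
  by (auto simp: mesh_vertices_def)

lemma bary_eq: "E \<in> T \<Longrightarrow> E' \<in> T \<Longrightarrow> x \<in> E \<Longrightarrow> x \<in> E' \<Longrightarrow> bary E v x = bary E' v x"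
  using face[of E E'] face[of E' E] by (intro bary_agree full) (auto simp: Int_commute)

lemma P1_bary:
  assumes "u \<in> P1_functions T" and "E \<in> T" and "x \<in> E"
  shows "u x = (\<Sum>v\<in>vs E. bary E v x * u v)"
proof -
  interpret full_simplex E using full assms(2) .
  obtain a \<beta> where u: "\<And>y. y \<in> E \<Longrightarrow> u y = a \<bullet> y + \<beta>"
    using assms(1,2) unfolding P1_functions_def by blast
  have "affine_fun (\<lambda>y. a \<bullet> y + \<beta>)" by (rule affine_funI) simp
  from affine_bary[OF this, of x] show ?thesis
    using u assms(3) vertices_subset by (simp add: subset_iff)
qed

lemma P1_eqI:
  assumes "u \<in> P1_functions T" and "w \<in> P1_functions T" and "\<And>v. v \<in> mesh_vertices T \<Longrightarrow> u v = w v"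
  shows "u = w"
proof
  fix x
  show "u x = w x"
  proof (cases "x \<in> \<Union>T")
    case True
    then obtain E where E: "E \<in> T" "x \<in> E" by blast
    show ?thesis
      unfolding P1_bary[OF assms(1) E] P1_bary[OF assms(2) E]
      using assms(3) vertices_mesh[OF E(1)] by (intro sum.cong) auto
  qed (use assms in \<open>simp add: P1_functions_def\<close>)
qed

text \<open>Justifies the definite description in \<open>hat\<close>. Existence glues the
  barycentric coordinates of the elements, which agree on intersections by
  \<open>bary_eq\<close>.\<close>

lemma hat_unique: "\<exists>!\<phi>. \<phi> \<in> P1_functions T \<and> (\<forall>w\<in>mesh_vertices T. \<phi> w = (if w = v then 1 else 0))"
proof (rule ex_ex1I)
  define \<phi> where "\<phi> x = (if x \<in> \<Union>T then bary (SOME E. E \<in> T \<and> x \<in> E) v x else 0)" for x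
  have \<phi>: "\<phi> x = bary E v x" if "E \<in> T" "x \<in> E" for E x
  proof -
    define E' where "E' = (SOME E. E \<in> T \<and> x \<in> E)"
    have "E' \<in> T \<and> x \<in> E'"
      unfolding E'_def using that by (intro someI_ex[of "\<lambda>E. E \<in> T \<and> x \<in> E"]) blast
    then have "bary E' v x = bary E v x" using that by (intro bary_eq) auto
    moreover have "x \<in> \<Union>T" using that by blast
    ultimately show ?thesis by (simp add: \<phi>_def E'_def)
  qed
  have "continuous_on E \<phi>" if "E \<in> T" for E
    using full_simplex.continuous_bary[OF full[OF that], of E v] \<phi>[OF that]
    by (simp cong: continuous_on_cong)
  then have "continuous_on (\<Union>E\<in>T. E) \<phi>"
    using finite_T full_simplex.compact[OF full] by (intro continuous_on_closed_Union) (auto simp: compact_imp_closed)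
  moreover have "\<exists>a \<beta>. \<forall>x\<in>E. \<phi> x = a \<bullet> x + \<beta>" if "E \<in> T" for E
    using full_simplex.bary(1)[OF full[OF that], of v] \<phi>[OF that] unfolding affine_fun_def by auto
  ultimately have "\<phi> \<in> P1_functions T"
    unfolding P1_functions_def by (simp add: \<phi>_def)
  moreover have "\<phi> w = (if w = v then 1 else 0)" if w: "w \<in> mesh_vertices T" for w
  proof -
    obtain E where "E \<in> T" "w \<in> vs E" using w by (auto simp: mesh_vertices_def)
    then show ?thesis
      using \<phi>[of E w] full_simplex.bary(2)[OF full, of E w v] full_simplex.vertices_subset[OF full, of E] by auto
  qed
  ultimately show "\<exists>\<phi>. \<phi> \<in> P1_functions T \<and> (\<forall>w\<in>mesh_vertices T. \<phi> w = (if w = v then 1 else 0))" by blast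
qed (auto intro: P1_eqI)

lemma hat_P1: "hat T v \<in> P1_functions T"
  and hat_vertex: "w \<in> mesh_vertices T \<Longrightarrow> hat T v w = (if w = v then 1 else 0)"
  using theI'[OF hat_unique, of v] by (simp_all add: hat_def)

lemma hat_eq: "E \<in> T \<Longrightarrow> x \<in> E \<Longrightarrow> hat T v x = bary E v x"
proof -
  assume E: "E \<in> T" "x \<in> E"
  interpret full_simplex E using full E(1) .
  have "hat T v x = (\<Sum>w\<in>V. bary E w x * hat T v w)" by (rule P1_bary[OF hat_P1 E])
  also have "\<dots> = (\<Sum>w\<in>V. bary E w x * bary E v w)"
    using hat_vertex vertices_mesh[OF E(1)] by (intro sum.cong refl) (auto simp: bary(2))
  also have "\<dots> = bary E v x" by (rule affine_bary[OF bary(1), symmetric])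
  finally show ?thesis .
qed

lemma hat_outside: "x \<notin> closure \<Omega> \<Longrightarrow> hat T v x = 0"
  using hat_P1 by (simp add: P1_functions_def union_T)

text \<open>A homothety centred at \<open>v\<close> maps a neighbourhood of \<open>x\<close> into \<open>\<Omega>\<close>; if the value were positive, the
  elements there would cover a neighbourhood of \<open>x\<close>.\<close>

lemma hat_frontier:
  assumes x: "x \<in> frontier \<Omega>" and v: "v \<in> \<Omega>"
  shows "hat T v x = 0"
proof (rule ccontr)
  assume ne: "hat T v x \<noteq> 0"
  have "x \<in> \<Union>T" using x by (simp add: union_T frontier_def)
  then obtain E where E: "E \<in> T" "x \<in> E" by blast
  interpret A: full_simplex E using full E(1) .
  have bx: "0 < bary E v x" using ne E A.bary_nonneg[of x v] by (simp add: hat_eq)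
  have vV: "v \<in> A.V" using bx A.bary_not_vertex by force
  define \<phi> where "\<phi> t z = v + t *\<^sub>R (z - v)" for t :: real and z
  obtain t where t: "\<phi> t x \<in> \<Omega>" "0 < t" "t < 1"
    using open_step[OF domain(1) v, of 1 "x - v"] by (auto simp: \<phi>_def)
  define S where "S = {E'\<in>T. \<phi> t x \<in> E'}"
  have b\<phi>: "bary E' w (\<phi> t z) = bary E' w v + t * (bary E' w z - bary E' w v)" if "E' \<in> T" for E' w z
    using full_simplex.bary_grad[OF full[OF that], of w "\<phi> t z" v] full_simplex.bary_grad[OF full[OF that], of w z v]
    by (simp add: \<phi>_def)
  have \<phi>E: "\<phi> t x \<in> E"
  proof -
    have "\<phi> t x = (1 - t) *\<^sub>R v + t *\<^sub>R x" by (simp add: \<phi>_def algebra_simps)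
    then show ?thesis using A.convex E(2) vV A.vertices_subset t by (auto intro: convexD_alt)
  qed
  \<comment> \<open>The contracted point lies in both \<open>E\<close> and \<open>E'\<close>, so the
    two coordinates belonging to \<open>v\<close> agree there. Their common value is positive, which
    forces \<open>v\<close> to be a vertex of \<open>E'\<close>; as both coordinates are 1 at
    \<open>v\<close>, they then agree at \<open>x\<close> too.\<close>
  have S: "v \<in> vs E' \<and> 0 < bary E' v x" if "E' \<in> S" for E'
  proof -
    have E': "E' \<in> T" "\<phi> t x \<in> E'" using that by (auto simp: S_def)
    interpret B: full_simplex E' using full E'(1) .
    have eq: "bary E' v (\<phi> t x) = 1 + t * (bary E v x - 1)"
      using bary_eq[OF E'(1) E(1) E'(2) \<phi>E, of v] b\<phi>[OF E(1), of v x] vV by (simp add: A.bary(2))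
    have "t * (1 - bary E v x) \<le> t * 1" using bx t by (intro mult_left_mono) auto
    then have "0 < bary E' v (\<phi> t x)" using eq t by (simp add: algebra_simps)
    then have vB: "v \<in> B.V" using B.bary_not_vertex by force
    then have "1 + t * (bary E' v x - 1) = 1 + t * (bary E v x - 1)"
      using eq b\<phi>[OF E'(1), of v x] by (simp add: B.bary(2))
    then have "bary E' v x = bary E v x" using t by simp
    then show ?thesis using bx vB by simp
  qed
  \<comment> \<open>On \<open>N\<close> the homothety reaches only elements of \<open>S\<close>, and
    their coordinate of \<open>v\<close> stays positive. All other coordinates are merely scaled by
    \<open>t\<close>, so a point whose image lies in an element of \<open>S\<close> lies in that
    element itself.\<close>
  define N where "N = (\<phi> t -` (\<Omega> - \<Union>(T - S))) \<inter> (\<Inter>E'\<in>S. {z. 0 < bary E' v z})"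
  have "open N" unfolding N_def
  proof (intro open_Int open_INT ballI)
    show "open (\<phi> t -` (\<Omega> - \<Union>(T - S)))"
      unfolding \<phi>_def using domain(1) finite_T full_simplex.compact[OF full]
      by (intro continuous_open_vimage open_Diff closed_Union continuous_intros) (auto intro: compact_imp_closed)
    show "finite S" using finite_T by (simp add: S_def)
    show "open {z. 0 < bary E' v z}" if "E' \<in> S" for E'
      using that full_simplex.continuous_bary[OF full, of E' UNIV v]
      by (intro open_Collect_less continuous_intros) (auto simp: S_def)
  qed
  moreover have "x \<in> N" using t S by (auto simp: N_def S_def)
  moreover have "N \<subseteq> \<Union>T"
  proof
    fix z assume z: "z \<in> N"
    then have "\<phi> t z \<in> \<Omega>" "\<phi> t z \<notin> \<Union>(T - S)" by (auto simp: N_def)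
    moreover have "\<Omega> \<subseteq> \<Union>T" by (simp add: union_T closure_subset)
    ultimately obtain E' where E': "E' \<in> S" "\<phi> t z \<in> E'" by blast
    then have E'T: "E' \<in> T" by (simp add: S_def)
    interpret B: full_simplex E' using full E'T .
    have "0 \<le> bary E' w z" if w: "w \<in> B.V" for w
    proof (cases "w = v")
      case True
      then show ?thesis using z E'(1) by (auto simp: N_def less_imp_le)
    next
      case False
      then have "bary E' w (\<phi> t z) = t * bary E' w z"
        using b\<phi>[OF E'T, of w z] S[OF E'(1)] by (simp add: B.bary(2))
      then show ?thesis using B.bary_nonneg[OF E'(2), of w] t by (simp add: zero_le_mult_iff)
    qed
    then show "z \<in> \<Union>T" using E'T B.mem_iff_bary[of z] by blast
  qed
  ultimately have "x \<in> interior (closure \<Omega>)" unfolding union_T[symmetric] by (rule interiorI)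
  then show False using frontier_not_interior_closure[OF x] by simp
qed

lemma fe_function_P1: "fe y \<in> P1_functions T"
proof -
  have "continuous_on (\<Union>T) (fe y)"
    unfolding fe_function_def using hat_P1 by (intro continuous_intros) (auto simp: P1_functions_def)
  moreover have "\<exists>a \<beta>. \<forall>x\<in>E. fe y x = a \<bullet> x + \<beta>" if "E \<in> T" for E
  proof -
    have "affine_fun (\<lambda>x. \<Sum>v\<in>I. y v * bary E v x)"
      by (intro affine_fun_sum affine_fun_cmult full_simplex.bary(1)[OF full[OF that]])
    then obtain a \<beta> where "\<forall>x. (\<Sum>v\<in>I. y v * bary E v x) = a \<bullet> x + \<beta>"
      unfolding affine_fun_def by blast
    then have "\<forall>x\<in>E. fe y x = a \<bullet> x + \<beta>"
      unfolding fe_function_def using hat_eq[OF that] by simp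
    then show ?thesis by blast
  qed
  moreover have "fe y x = 0" if "x \<notin> \<Union>T" for x
    using that hat_outside by (simp add: fe_function_def union_T)
  ultimately show ?thesis unfolding P1_functions_def by blast
qed

lemma fe_function_vertex: "v \<in> I \<Longrightarrow> fe y v = y v"
proof -
  assume v: "v \<in> I"
  then have "y u * hat T u v = (if u = v then y u else 0)" for u
    using hat_vertex[of v u] by (simp add: interior_vertices_def)
  then show ?thesis using finite_interior_vertices v by (simp add: fe_function_def)
qed

lemma fe_function_frontier: "x \<in> frontier \<Omega> \<Longrightarrow> fe y x = 0"
  using hat_frontier by (simp add: fe_function_def interior_vertices_def)

lemma vertices_closure: "mesh_vertices T \<subseteq> closure \<Omega>"
  unfolding mesh_vertices_def union_T[symmetric] using full_simplex.vertices_subset[OF full] by blast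

lemma P1_eq_fe_function:
  assumes "u \<in> P1_functions T" and "\<And>v. v \<in> frontier \<Omega> \<Longrightarrow> u v = 0"
  shows "u = fe u"
proof (rule P1_eqI[OF assms(1) fe_function_P1])
  fix v assume v: "v \<in> mesh_vertices T"
  show "u v = fe u v"
  proof (cases "v \<in> \<Omega>")
    case True
    then show ?thesis using v by (subst fe_function_vertex) (auto simp: interior_vertices_def)
  next
    case False
    then have "v \<in> frontier \<Omega>"
      using v vertices_closure domain(1) by (auto simp: frontier_def interior_open)
    then show ?thesis by (simp add: assms(2) fe_function_frontier)
  qed
qed

end

text \<open>The inclusion of the coarse space in the fine one, with nodal values as coefficients:
  the coarse function is again piecewise linear, and it vanishes on the frontier, so boundary
  vertices of the fine mesh contribute nothing. As a function, the initial guess is therefore the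
  coarse iterate itself.\<close>

lemma fe_function_refine:
  assumes "mesh \<Omega> T" and "mesh \<Omega> T'" and "uniform_refinement T T'"
  shows "fe_function \<Omega> T' (fe_function \<Omega> T y) = fe_function \<Omega> T y"
proof -
  interpret A: mesh \<Omega> T by fact
  interpret B: mesh \<Omega> T' by fact
  have "fe_function \<Omega> T y \<in> P1_functions T'"
    unfolding P1_functions_def
  proof (intro CollectI conjI ballI allI impI)
    show "continuous_on (\<Union>T') (fe_function \<Omega> T y)"
      using A.fe_function_P1[of y] unfolding P1_functions_def A.union_T B.union_T by blast
    show "fe_function \<Omega> T y x = 0" if "x \<notin> \<Union>T'" for x
      using A.fe_function_P1[of y] that unfolding P1_functions_def A.union_T B.union_T by blast
    fix E' assume "E' \<in> T'"
    then obtain E where "E \<in> T" "E' \<subseteq> E" using assms(3) by (auto simp: uniform_refinement_def)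
    moreover from this(1) obtain a \<beta> where "\<forall>x\<in>E. fe_function \<Omega> T y x = a \<bullet> x + \<beta>"
      using A.fe_function_P1[of y] unfolding P1_functions_def by blast
    ultimately show "\<exists>a \<beta>. \<forall>x\<in>E'. fe_function \<Omega> T y x = a \<bullet> x + \<beta>" by blast
  qed
  from B.P1_eq_fe_function[OF this A.fe_function_frontier] show ?thesis by simp
qed

section \<open>Integration over a mesh\<close>

context full_simplex
begin

lemma AE_interior: "AE x in lebesgue_on E. x \<in> interior E"
proof -
  have "frontier E \<in> null_sets lebesgue"
    using negligible_convex_frontier[OF convex] by (simp add: negligible_iff_null_sets)
  then have "AE x in lebesgue. x \<notin> frontier E" by (rule AE_not_in)
  moreover have "E - interior E = frontier E"
    using compact by (simp add: frontier_def compact_imp_closed)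
  ultimately have "AE x in lebesgue. x \<in> E \<longrightarrow> x \<in> interior E"
    by (auto elim!: eventually_mono)
  then show ?thesis by (subst AE_restrict_space_iff) (auto simp: compact compact_imp_closed)
qed

lemma grad_affine:
  assumes "\<And>y. y \<in> E \<Longrightarrow> u y = a \<bullet> y + \<beta>" and "x \<in> interior E"
  shows "grad u x = a"
proof -
  have "((\<lambda>y. a \<bullet> y + \<beta>) has_derivative (\<lambda>h. a \<bullet> h)) (at x)"
    by (auto intro!: derivative_eq_intros)
  then have "(u has_derivative (\<lambda>h. a \<bullet> h)) (at x)"
    by (rule has_derivative_transform_within_open[of _ _ _ _ "interior E"])
      (use assms(2) assms(1)[OF subsetD[OF interior_subset]] in auto)
  then have "frechet_derivative u (at x) = (\<lambda>h. a \<bullet> h)" by (rule frechet_derivative_at[symmetric])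
  then show ?thesis by (simp add: grad_def euclidean_representation)
qed

end

context mesh
begin

abbreviation vol where "vol \<equiv> measure lebesgue"

lemma measurable_elem: "E \<in> T \<Longrightarrow> E \<in> lmeasurable"
  using full_simplex.compact[OF full] by (rule lmeasurable_compact)

lemma negligible_Int_elems:
  assumes "E \<in> T" and "E' \<in> T" and "E \<noteq> E'"
  shows "negligible (E \<inter> E')"
proof -
  have *: "negligible (E \<inter> E')" if "E \<in> T" "E' \<in> T" "E \<inter> E' \<noteq> E" for E E'
  proof -
    interpret full_simplex E using full that(1) .
    have "(E \<inter> E') \<inter> interior E = {}"
      using face[OF that(1,2)] that(3) by (rule face_of_disjoint_interior)
    then have "E \<inter> E' \<subseteq> frontier E"
      using closure_subset[of E] by (auto simp: frontier_def)
    then show ?thesis using negligible_convex_frontier[OF convex] negligible_subset by blast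
  qed
  show ?thesis
  proof (cases "E \<inter> E' = E")
    case True
    then have "E' \<inter> E \<noteq> E'" using assms(3) by blast
    from *[OF assms(2,1) this] show ?thesis by (simp add: Int_commute)
  qed (use * assms in blast)
qed

text \<open>A frontier point lies in some element but not in its interior, because the frontier
  misses the interior of the closure. So finitely many frontiers of convex sets cover it.\<close>

lemma negligible_frontier: "negligible (frontier \<Omega>)"
proof (rule negligible_subset)
  show "negligible (\<Union>E\<in>T. frontier E)"
    using finite_T full_simplex.convex[OF full] negligible_convex_frontier by (intro negligible_Union) auto
  show "frontier \<Omega> \<subseteq> (\<Union>E\<in>T. frontier E)"
  proof
    fix x assume x: "x \<in> frontier \<Omega>"
    then have "x \<in> \<Union>T" by (simp add: union_T frontier_def)
    then obtain E where E: "E \<in> T" "x \<in> E" by blast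
    have "x \<notin> interior E"
    proof
      assume "x \<in> interior E"
      moreover have "interior E \<subseteq> interior (\<Union>T)" using E(1) by (intro interior_mono) blast
      ultimately show False using frontier_not_interior_closure[OF x] by (auto simp: union_T)
    qed
    then show "x \<in> (\<Union>E\<in>T. frontier E)" using E closure_subset by (auto simp: frontier_def)
  qed
qed

text \<open>Makes integrals over \<open>\<Omega>\<close> additive over the elements: their overlaps
  and the frontier of \<open>\<Omega>\<close> are null sets.\<close>

lemma AE_indicator: "AE x in lebesgue. indicator \<Omega> x = (\<Sum>E\<in>T. indicator E x :: real)"
proof -
  define N where "N = frontier \<Omega> \<union> (\<Union>p\<in>{p \<in> T \<times> T. fst p \<noteq> snd p}. fst p \<inter> snd p)"
  have "negligible N"
    unfolding N_def using finite_T
    by (intro negligible_Un negligible_frontier negligible_Union) (auto intro: negligible_Int_elems)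
  then have "AE x in lebesgue. x \<notin> N" by (intro AE_not_in) (simp add: negligible_iff_null_sets)
  then show ?thesis
  proof (rule eventually_mono)
    fix x assume x: "x \<notin> N"
    show "indicator \<Omega> x = (\<Sum>E\<in>T. indicator E x :: real)"
    proof (cases "x \<in> \<Omega>")
      case True
      then have "x \<in> \<Union>T" using closure_subset by (auto simp: union_T)
      then obtain E where E: "E \<in> T" "x \<in> E" by blast
      then have "x \<notin> E'" if "E' \<in> T" "E' \<noteq> E" for E' using x that by (force simp: N_def)
      then have "(\<Sum>E'\<in>T. indicator E' x :: real) = (\<Sum>E'\<in>T. if E' = E then 1 else 0)"
        using E by (intro sum.cong) (auto simp: indicator_def)
      then show ?thesis using True E(1) finite_T by simp
    next
      case False
      then have "x \<notin> closure \<Omega>" using x domain(1) by (simp add: N_def frontier_def interior_open)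
      then have "x \<notin> E" if "E \<in> T" for E using that by (auto simp flip: union_T)
      then show ?thesis using False by simp
    qed
  qed
qed

lemma
  fixes f :: "'a \<Rightarrow> real"
  assumes "\<And>E. E \<in> T \<Longrightarrow> integrable (lebesgue_on E) f"
  shows integrable_mesh: "integrable (lebesgue_on \<Omega>) f"
    and integral_mesh: "(LINT x|lebesgue_on \<Omega>. f x) = (\<Sum>E\<in>T. LINT x|lebesgue_on E. f x)"
proof -
  have sets: "E \<in> sets lebesgue" if "E \<in> T" for E using measurable_elem[OF that] by blast
  have \<Omega>: "\<Omega> \<in> sets lebesgue" using domain(1) by auto
  have int: "integrable lebesgue (\<lambda>x. indicator E x *\<^sub>R f x)" if "E \<in> T" for E
    using assms[OF that] sets[OF that] by (subst (asm) integrable_restrict_space) auto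
  have "set_integrable lebesgue (\<Union>E\<in>T. E) f"
    using finite_T int sets by (intro set_integrable_UN) (auto simp: set_integrable_def)
  then have "set_integrable lebesgue \<Omega> f"
    using closure_subset[of \<Omega>] \<Omega> by (elim set_integrable_subset) (simp_all add: union_T)
  then have i\<Omega>: "integrable lebesgue (\<lambda>x. indicator \<Omega> x *\<^sub>R f x)" by (simp add: set_integrable_def)
  then show "integrable (lebesgue_on \<Omega>) f" using \<Omega> by (subst integrable_restrict_space) auto
  have "(LINT x|lebesgue_on \<Omega>. f x) = (LINT x|lebesgue. indicator \<Omega> x *\<^sub>R f x)"
    using \<Omega> by (intro integral_restrict_space) auto
  also have "\<dots> = (LINT x|lebesgue. (\<Sum>E\<in>T. indicator E x *\<^sub>R f x))"
  proof (rule integral_cong_AE)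
    show "AE x in lebesgue. indicator \<Omega> x *\<^sub>R f x = (\<Sum>E\<in>T. indicator E x *\<^sub>R f x)"
      using AE_indicator by (rule eventually_mono) (simp add: sum_distrib_right)
    show "(\<lambda>x. indicator \<Omega> x *\<^sub>R f x) \<in> borel_measurable lebesgue"
      using i\<Omega> by (rule borel_measurable_integrable)
    show "(\<lambda>x. \<Sum>E\<in>T. indicator E x *\<^sub>R f x) \<in> borel_measurable lebesgue"
      by (intro borel_measurable_sum borel_measurable_integrable int)
  qed
  also have "\<dots> = (\<Sum>E\<in>T. LINT x|lebesgue. indicator E x *\<^sub>R f x)"
    by (intro Bochner_Integration.integral_sum int)
  also have "\<dots> = (\<Sum>E\<in>T. LINT x|lebesgue_on E. f x)"
    using sets by (intro sum.cong refl integral_restrict_space[symmetric]) auto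
  finally show "(LINT x|lebesgue_on \<Omega>. f x) = (\<Sum>E\<in>T. LINT x|lebesgue_on E. f x)" .
qed

end

section \<open>Counting elements and vertices by volume\<close>

locale qu_mesh = mesh \<Omega> T for \<Omega> :: "'a::euclidean_space set" and T +
  fixes \<sigma> \<gamma> h :: real
  assumes regular: "shape_regular \<sigma> T" and quasi: "quasi_uniform \<gamma> h T"
begin

lemma T_nonempty: "T \<noteq> {}"
  using union_T domain(3) closure_subset[of \<Omega>] by auto

lemma h_pos: "0 < h"
  using quasi by (simp add: quasi_uniform_def)

lemma diam: "E \<in> T \<Longrightarrow> h \<le> \<gamma> * diameter E" "E \<in> T \<Longrightarrow> diameter E \<le> \<gamma> * h"
  using quasi by (auto simp: quasi_uniform_def)

lemma diameter_nonneg: "E \<in> T \<Longrightarrow> 0 \<le> diameter E"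
  using full_simplex.compact[OF full] by (intro diameter_ge_0 compact_imp_bounded)

lemma \<gamma>_pos: "0 < \<gamma>" and \<sigma>_pos: "0 < \<sigma>"
proof -
  obtain E where E: "E \<in> T" using T_nonempty by blast
  have "0 < \<gamma> * diameter E" using diam(1)[OF E] h_pos by simp
  then have "0 < \<gamma>" and d: "0 < diameter E"
    using diameter_nonneg[OF E] by (auto simp: zero_less_mult_iff)
  then show "0 < \<gamma>" by simp
  obtain x r where "0 < r" "cball x r \<subseteq> E" "diameter E \<le> \<sigma> * r"
    using regular E by (auto simp: shape_regular_def)
  then have "0 < \<sigma> * r" using d by simp
  then show "0 < \<sigma>" using \<open>0 < r\<close> by (simp add: zero_less_mult_iff)
qed

text \<open>A common lower bound for the radii \<open>r\<close> of balls inside the elements, from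
  \<open>h \<le> \<gamma> * diameter E \<le> \<gamma> * \<sigma> * r\<close>.\<close>

definition inrad :: real where "inrad = h / (\<gamma> * \<sigma>)"

lemma inrad_pos: "0 < inrad"
  using h_pos \<gamma>_pos \<sigma>_pos by (simp add: inrad_def)

lemma measure_elem_ge: "E \<in> T \<Longrightarrow> unit_ball_vol (real DIM('a)) * inrad ^ DIM('a) \<le> vol E"
proof -
  assume E: "E \<in> T"
  obtain x r where r: "0 < r" "cball x r \<subseteq> E" "diameter E \<le> \<sigma> * r"
    using regular E by (auto simp: shape_regular_def)
  have "h \<le> \<gamma> * (\<sigma> * r)"
    using order_trans[OF diam(1)[OF E] mult_left_mono[OF r(3)]] \<gamma>_pos by simp
  then have "inrad \<le> r" using \<gamma>_pos \<sigma>_pos by (simp add: inrad_def field_simps)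
  then have "unit_ball_vol (real DIM('a)) * inrad ^ DIM('a) \<le> unit_ball_vol (real DIM('a)) * r ^ DIM('a)"
    using inrad_pos by (intro mult_left_mono power_mono) (auto intro: less_imp_le)
  also have "\<dots> = vol (cball x r)" using r(1) by (simp add: content_cball)
  also have "\<dots> \<le> vol E"
    using r(2) measurable_elem[OF E] by (intro measure_mono_fmeasurable) auto
  finally show ?thesis .
qed

lemma measure_elem_pos: "E \<in> T \<Longrightarrow> 0 < vol E"
  using measure_elem_ge[of E] inrad_pos by (smt (verit) mult_pos_pos of_nat_0_le_iff unit_ball_vol_pos zero_less_power)

lemma elem_subset_cball: "E \<in> T \<Longrightarrow> x \<in> E \<Longrightarrow> E \<subseteq> cball x (\<gamma> * h)"
proof
  fix y assume "E \<in> T" "x \<in> E" "y \<in> E"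
  then have "dist x y \<le> diameter E"
    using full_simplex.compact[OF full] by (intro diameter_bounded_bound compact_imp_bounded)
  then show "y \<in> cball x (\<gamma> * h)" using diam(2)[OF \<open>E \<in> T\<close>] by simp
qed

text \<open>Elements overlap only in null sets and each contains a ball of radius
  \<open>inrad\<close>, so their volumes add up inside \<open>cball x R\<close>; the volume of the
  unit ball cancels.\<close>

lemma packing:
  assumes "S \<subseteq> T" and "\<And>E. E \<in> S \<Longrightarrow> E \<subseteq> cball x R" and "0 \<le> R"
  shows "real (card S) * inrad ^ DIM('a) \<le> R ^ DIM('a)"
proof -
  have fin: "finite S" using assms(1) finite_T by (rule finite_subset)
  have meas: "E \<in> lmeasurable" if "E \<in> S" for E using measurable_elem that assms(1) by blast
  define \<omega> where "\<omega> = unit_ball_vol (real DIM('a))"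
  have "real (card S) * (\<omega> * inrad ^ DIM('a)) = (\<Sum>E\<in>S. \<omega> * inrad ^ DIM('a))" by simp
  also have "\<dots> \<le> (\<Sum>E\<in>S. vol E)"
    using measure_elem_ge assms(1) unfolding \<omega>_def by (intro sum_mono) auto
  also have "\<dots> = vol (\<Union>S)"
    using fin meas negligible_Int_elems assms(1)
    by (intro measure_negligible_finite_Union[symmetric]) (auto simp: pairwise_def)
  also have "\<dots> \<le> vol (cball x R)"
    using assms(2) fin meas by (intro measure_mono_fmeasurable) auto
  also have "\<dots> = \<omega> * R ^ DIM('a)" using assms(3) by (simp add: content_cball \<omega>_def)
  finally have "\<omega> * (real (card S) * inrad ^ DIM('a)) \<le> \<omega> * R ^ DIM('a)" by (simp add: mult_ac)
  then show ?thesis by (simp add: \<omega>_def)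
qed

lemma card_elems_at: "real (card {E \<in> T. x \<in> E}) \<le> (\<gamma>\<^sup>2 * \<sigma>) ^ DIM('a)"
proof -
  have "real (card {E \<in> T. x \<in> E}) * inrad ^ DIM('a) \<le> (\<gamma> * h) ^ DIM('a)"
    using elem_subset_cball \<gamma>_pos h_pos by (intro packing[of _ x]) auto
  also have "\<gamma> * h = (\<gamma>\<^sup>2 * \<sigma>) * inrad"
    using \<gamma>_pos \<sigma>_pos by (simp add: inrad_def power2_eq_square)
  finally show ?thesis using inrad_pos by (simp add: power_mult_distrib)
qed

text \<open>Defined for arbitrary points, as it bounds the rows of the matrices (at vertices of the
  mesh) as well as those of the prolongation (at vertices of the next finer mesh).\<close>

definition neighbours :: "'a \<Rightarrow> 'a set" where
  "neighbours x = (\<Union>E\<in>{E\<in>T. x \<in> E}. vs E)"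

lemma finite_neighbours: "finite (neighbours x)"
  unfolding neighbours_def using finite_T full_simplex.vertices(1)[OF full] by auto

lemma card_neighbours: "real (card (neighbours x)) \<le> (real DIM('a) + 1) * (\<gamma>\<^sup>2 * \<sigma>) ^ DIM('a)"
proof -
  have "card (neighbours x) \<le> (\<Sum>E\<in>{E\<in>T. x \<in> E}. card (vs E))"
    unfolding neighbours_def using finite_T by (intro card_UN_le) auto
  also have "\<dots> = (\<Sum>E\<in>{E\<in>T. x \<in> E}. DIM('a) + 1)"
    using full_simplex.vertices(3)[OF full] by (intro sum.cong) auto
  finally have "card (neighbours x) \<le> card {E \<in> T. x \<in> E} * (DIM('a) + 1)" by simp
  from of_nat_mono[OF this] have "real (card (neighbours x)) \<le> real (card {E \<in> T. x \<in> E}) * (real DIM('a) + 1)"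
    by (simp only: of_nat_mult of_nat_add of_nat_1)
  also have "\<dots> \<le> (\<gamma>\<^sup>2 * \<sigma>) ^ DIM('a) * (real DIM('a) + 1)"
    by (intro mult_right_mono card_elems_at) auto
  finally show ?thesis by (simp add: mult.commute)
qed

lemma card_interior_vertices_le:
  assumes "\<Omega> \<subseteq> cball 0 R" and "0 \<le> R"
  shows "real (card I) \<le> (real DIM('a) + 1) * (R * \<gamma> * \<sigma>) ^ DIM('a) * h powr (- real DIM('a))"
proof -
  have "closure \<Omega> \<subseteq> cball 0 R" using assms(1) by (intro closure_minimal) auto
  then have "real (card T) * inrad ^ DIM('a) \<le> R ^ DIM('a)"
    using assms(2) union_T by (intro packing[of _ 0]) auto
  moreover have "R = (R * \<gamma> * \<sigma> / h) * inrad" using h_pos \<gamma>_pos \<sigma>_pos by (simp add: inrad_def)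
  ultimately have "real (card T) * inrad ^ DIM('a) \<le> (R * \<gamma> * \<sigma> / h) ^ DIM('a) * inrad ^ DIM('a)"
    by (metis power_mult_distrib)
  then have T: "real (card T) \<le> (R * \<gamma> * \<sigma> / h) ^ DIM('a)" using inrad_pos by simp
  have "card I \<le> card (mesh_vertices T)"
    using finite_vertices by (intro card_mono) (auto simp: interior_vertices_def)
  also have "\<dots> \<le> (\<Sum>E\<in>T. card (vs E))"
    unfolding mesh_vertices_def using finite_T by (intro card_UN_le)
  also have "\<dots> = (\<Sum>E\<in>T. DIM('a) + 1)"
    using full_simplex.vertices(3)[OF full] by (intro sum.cong) auto
  finally have "card I \<le> card T * (DIM('a) + 1)" by simp
  from of_nat_mono[OF this] have "real (card I) \<le> real (card T) * (real DIM('a) + 1)"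
    by (simp only: of_nat_mult of_nat_add of_nat_1)
  also have "\<dots> \<le> (R * \<gamma> * \<sigma> / h) ^ DIM('a) * (real DIM('a) + 1)"
    by (intro mult_right_mono T) auto
  also have "\<dots> = (real DIM('a) + 1) * (R * \<gamma> * \<sigma>) ^ DIM('a) * h powr (- real DIM('a))"
    using h_pos by (simp add: power_divide powr_minus powr_realpow field_simps)
  finally show ?thesis .
qed

text \<open>If \<open>h\<close> is not small compared with \<open>R\<close>, the left side is
  bounded by a constant and a single interior vertex suffices. Otherwise every element that meets
  the ball of radius \<open>R / 2\<close> about \<open>x0\<close> lies in \<open>\<Omega>\<close>,
  so all its vertices are interior; these elements cover that ball, and each vertex serves boundedly
  many of them.\<close>

lemma card_interior_vertices_ge:
  assumes "cball x0 R \<subseteq> \<Omega>" and "0 < R" and "I \<noteq> {}"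
  shows "h powr (- real DIM('a)) \<le> (2 * \<gamma> / R) ^ DIM('a) * max 1 ((\<gamma>\<^sup>2 * \<sigma>) ^ DIM('a)) * real (card I)"
proof -
  let ?P = "max 1 ((\<gamma>\<^sup>2 * \<sigma>) ^ DIM('a))"
  let ?Q = "(2 * \<gamma> / R) ^ DIM('a)"
  let ?V = "(R / 2) ^ DIM('a)"
  define n where "n = card I"
  have n: "1 \<le> n" using assms(3) finite_interior_vertices by (simp add: n_def Suc_le_eq card_gt_0_iff)
  have pw: "h powr (- real DIM('a)) = (1 / h) ^ DIM('a)"
    using h_pos by (simp add: power_divide powr_minus powr_realpow field_simps)
  show ?thesis
  proof (cases "\<gamma> * h \<le> R / 2")
    case False
    then have "(1 / h) ^ DIM('a) \<le> ?Q"
      using h_pos assms(2) by (intro power_mono) (auto simp: field_simps)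
    also have "\<dots> \<le> ?Q * (?P * real n)"
    proof -
      have "1 * 1 \<le> ?P * real n" using n by (intro mult_mono) auto
      then show ?thesis using \<gamma>_pos assms(2) mult_left_mono[of 1 _ "?Q"] by simp
    qed
    finally show ?thesis by (simp add: pw n_def mult.assoc)
  next
    case True
    define S where "S = {E \<in> T. E \<inter> cball x0 (R / 2) \<noteq> {}}"
    have fin: "finite S" using finite_T by (simp add: S_def)
    have sub: "E \<subseteq> \<Omega>" if elem: "E \<in> S" for E
    proof -
      obtain y where y: "E \<in> T" "y \<in> E" "y \<in> cball x0 (R / 2)" using elem unfolding S_def by blast
      have "E \<subseteq> cball y (\<gamma> * h)" using elem_subset_cball y by blast
      also have "\<dots> \<subseteq> cball x0 R"
      proof
        fix z assume "z \<in> cball y (\<gamma> * h)"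
        then show "z \<in> cball x0 R" using y(3) True dist_triangle[of x0 z y] by simp
      qed
      finally show ?thesis using assms(1) by blast
    qed
    define \<omega> where "\<omega> = unit_ball_vol (real DIM('a))"
    have "\<omega> * ?V = vol (cball x0 (R / 2))"
      using assms(2) by (simp add: content_cball \<omega>_def)
    also have "\<dots> \<le> vol (\<Union>E\<in>S. E)"
    proof (rule measure_mono_fmeasurable)
      show "(\<Union>E\<in>S. E) \<in> lmeasurable" using fin measurable_elem by (auto simp: S_def)
      show "cball x0 (R / 2) \<subseteq> (\<Union>E\<in>S. E)"
      proof
        fix y assume y: "y \<in> cball x0 (R / 2)"
        then have "y \<in> \<Omega>" using assms(1,2) by auto
        then have "y \<in> \<Union>T" using closure_subset by (auto simp: union_T)
        then show "y \<in> (\<Union>E\<in>S. E)" using y unfolding S_def by blast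
      qed
    qed auto
    also have "\<dots> \<le> (\<Sum>E\<in>S. vol E)"
      using fin measurable_elem by (intro measure_UNION_le) (auto simp: S_def)
    also have "\<dots> \<le> (\<Sum>E\<in>S. \<omega> * (\<gamma> * h) ^ DIM('a))"
    proof (rule sum_mono)
      fix E assume "E \<in> S"
      then have E: "E \<in> T" by (simp add: S_def)
      obtain y where "y \<in> E" using full_simplex.nonempty[OF full[OF E]] by blast
      have "vol E \<le> vol (cball y (\<gamma> * h))"
        using elem_subset_cball[OF E \<open>y \<in> E\<close>] measurable_elem[OF E] by (intro measure_mono_fmeasurable) auto
      then show "vol E \<le> \<omega> * (\<gamma> * h) ^ DIM('a)"
        using \<gamma>_pos h_pos by (simp add: content_cball \<omega>_def)
    qed
    finally have "\<omega> * ?V \<le> \<omega> * (real (card S) * (\<gamma> * h) ^ DIM('a))" by (simp add: mult_ac)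
    then have "?V \<le> real (card S) * (\<gamma> * h) ^ DIM('a)" by (simp add: \<omega>_def)
    then have "?V / (\<gamma> * h) ^ DIM('a) \<le> real (card S)"
      using \<gamma>_pos h_pos by (simp add: divide_le_eq)
    also have "?V / (\<gamma> * h) ^ DIM('a) = (1 / h) ^ DIM('a) / ?Q"
      using assms(2) \<gamma>_pos h_pos by (simp add: power_divide[symmetric] mult_ac)
    finally have S: "(1 / h) ^ DIM('a) \<le> ?Q * real (card S)"
      using assms(2) \<gamma>_pos by (simp add: pos_divide_le_eq mult.commute)
    have "S \<subseteq> (\<Union>v\<in>I. {E \<in> T. v \<in> E})"
    proof
      fix E assume E: "E \<in> S"
      then have ET: "E \<in> T" by (simp add: S_def)
      interpret full_simplex E using full ET .
      obtain v where "v \<in> V" using vertices(3) by fastforce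
      then have "v \<in> I" "v \<in> E"
        using sub[OF E] vertices_subset vertices_mesh[OF ET] by (auto simp: interior_vertices_def)
      then show "E \<in> (\<Union>v\<in>I. {E \<in> T. v \<in> E})" using ET by blast
    qed
    then have "card S \<le> card (\<Union>v\<in>I. {E \<in> T. v \<in> E})"
      using finite_interior_vertices finite_T by (intro card_mono) auto
    also have "\<dots> \<le> (\<Sum>v\<in>I. card {E \<in> T. v \<in> E})"
      using finite_interior_vertices by (rule card_UN_le)
    finally have "real (card S) \<le> (\<Sum>v\<in>I. real (card {E \<in> T. v \<in> E}))"
      by (simp flip: of_nat_sum)
    also have "\<dots> \<le> (\<Sum>v\<in>I. ?P)"
      by (intro sum_mono) (simp add: card_elems_at le_max_iff_disj)
    finally have "real (card S) \<le> ?P * real n" by (simp add: n_def mult.commute)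
    then have "?Q * real (card S) \<le> ?Q * (?P * real n)"
      using \<gamma>_pos assms(2) by (intro mult_left_mono) auto
    with S show ?thesis by (simp add: pw n_def mult.assoc)
  qed
qed

end

section \<open>Norms and matrices\<close>

lemma L2_space_mult_integrable:
  assumes "u \<in> L2_space \<Omega>" and "v \<in> L2_space \<Omega>"
  shows "integrable (lebesgue_on \<Omega>) (\<lambda>x. u x * v x)"
proof (rule Bochner_Integration.integrable_bound[of _ "\<lambda>x. (u x)\<^sup>2 + (v x)\<^sup>2"])
  show "integrable (lebesgue_on \<Omega>) (\<lambda>x. (u x)\<^sup>2 + (v x)\<^sup>2)"
    using assms by (auto simp: L2_space_def)
  show "(\<lambda>x. u x * v x) \<in> borel_measurable (lebesgue_on \<Omega>)"
    using assms by (auto simp: L2_space_def)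
  have "\<bar>u x * v x\<bar> \<le> (u x)\<^sup>2 + (v x)\<^sup>2" for x
  proof -
    have "2 * (\<bar>u x\<bar> * \<bar>v x\<bar>) \<le> (u x)\<^sup>2 + (v x)\<^sup>2"
      using sum_squares_bound[of "\<bar>u x\<bar>" "\<bar>v x\<bar>"] by simp
    moreover have "0 \<le> \<bar>u x\<bar> * \<bar>v x\<bar>" by simp
    ultimately show ?thesis unfolding abs_mult by linarith
  qed
  then show "AE x in lebesgue_on \<Omega>. norm (u x * v x) \<le> norm ((u x)\<^sup>2 + (v x)\<^sup>2)" by simp
qed

lemma L2_space_lincomb:
  assumes "u \<in> L2_space \<Omega>" and "v \<in> L2_space \<Omega>"
  shows "(\<lambda>x. u x + c * v x) \<in> L2_space \<Omega>"
    and "(LINT x|lebesgue_on \<Omega>. (u x + c * v x)\<^sup>2) = (LINT x|lebesgue_on \<Omega>. (u x)\<^sup>2)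
      + 2 * c * (LINT x|lebesgue_on \<Omega>. u x * v x) + c\<^sup>2 * (LINT x|lebesgue_on \<Omega>. (v x)\<^sup>2)"
proof -
  have i: "integrable (lebesgue_on \<Omega>) (\<lambda>x. (u x)\<^sup>2)" "integrable (lebesgue_on \<Omega>) (\<lambda>x. (v x)\<^sup>2)"
    and m: "u \<in> borel_measurable (lebesgue_on \<Omega>)" "v \<in> borel_measurable (lebesgue_on \<Omega>)"
    using assms by (auto simp: L2_space_def)
  note uv = L2_space_mult_integrable[OF assms]
  have eq: "(u x + c * v x)\<^sup>2 = (u x)\<^sup>2 + (2 * c) * (u x * v x) + c\<^sup>2 * (v x)\<^sup>2" for x
    by (simp add: power2_eq_square algebra_simps)
  show "(\<lambda>x. u x + c * v x) \<in> L2_space \<Omega>"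
    using m i uv by (simp add: L2_space_def eq)
  show "(LINT x|lebesgue_on \<Omega>. (u x + c * v x)\<^sup>2) = (LINT x|lebesgue_on \<Omega>. (u x)\<^sup>2)
      + 2 * c * (LINT x|lebesgue_on \<Omega>. u x * v x) + c\<^sup>2 * (LINT x|lebesgue_on \<Omega>. (v x)\<^sup>2)"
    unfolding eq using i uv by simp
qed

lemma L2_norm_power2: "(L2_norm \<Omega> u)\<^sup>2 = (LINT x|lebesgue_on \<Omega>. (u x)\<^sup>2)" for u :: "'a::euclidean_space \<Rightarrow> real"
  by (simp add: L2_norm_def)

lemma L2_norm_nonneg: "0 \<le> L2_norm \<Omega> u"
  by (simp add: L2_norm_def)

lemma L2_norm_minus_commute: "L2_norm \<Omega> (\<lambda>x. u x - v x) = L2_norm \<Omega> (\<lambda>x. v x - u x)"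
  by (simp add: L2_norm_def norm_minus_commute)

lemma L2_norm_triangle:
  fixes u v :: "'a::euclidean_space \<Rightarrow> real"
  assumes "u \<in> L2_space \<Omega>" and "v \<in> L2_space \<Omega>"
  shows "L2_norm \<Omega> (\<lambda>x. u x + v x) \<le> L2_norm \<Omega> u + L2_norm \<Omega> v"
proof -
  define b where "b = (LINT x|lebesgue_on \<Omega>. u x * v x)"
  have "b\<^sup>2 \<le> (L2_norm \<Omega> u)\<^sup>2 * (L2_norm \<Omega> v)\<^sup>2"
  proof (rule nonneg_quadratic_discriminant)
    fix t
    have "0 \<le> (LINT x|lebesgue_on \<Omega>. (u x + t * v x)\<^sup>2)" by simp
    also note L2_space_lincomb(2)[OF assms, of t]
    finally show "0 \<le> (L2_norm \<Omega> u)\<^sup>2 + 2 * t * b + t\<^sup>2 * (L2_norm \<Omega> v)\<^sup>2"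
      unfolding L2_norm_power2 b_def .
  qed simp
  then have "b \<le> L2_norm \<Omega> u * L2_norm \<Omega> v"
    by (intro power2_le_imp_le[of b]) (simp_all add: power_mult_distrib L2_norm_nonneg)
  moreover have "(L2_norm \<Omega> (\<lambda>x. u x + v x))\<^sup>2 = (L2_norm \<Omega> u)\<^sup>2 + 2 * b + (L2_norm \<Omega> v)\<^sup>2"
    using L2_space_lincomb(2)[OF assms, of 1] by (simp add: L2_norm_power2 b_def)
  ultimately have "(L2_norm \<Omega> (\<lambda>x. u x + v x))\<^sup>2 \<le> (L2_norm \<Omega> u + L2_norm \<Omega> v)\<^sup>2"
    by (simp add: power2_sum)
  then show ?thesis by (rule power2_le_imp_le) (simp add: L2_norm_nonneg)
qed

lemma L2_norm_pos:
  fixes u :: "'a::euclidean_space \<Rightarrow> real"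
  assumes "u \<in> L2_space \<Omega>" and "\<not> (AE x in lebesgue_on \<Omega>. u x = 0)"
  shows "0 < L2_norm \<Omega> u"
proof -
  have "(LINT x|lebesgue_on \<Omega>. (u x)\<^sup>2) \<noteq> 0"
    using assms integral_nonneg_eq_0_iff_AE[of "lebesgue_on \<Omega>" "\<lambda>x. (u x)\<^sup>2"] by (auto simp: L2_space_def)
  then have "(L2_norm \<Omega> u)\<^sup>2 \<noteq> 0" by (simp add: L2_norm_power2)
  then show ?thesis using L2_norm_nonneg[of \<Omega> u] by (simp add: less_le)
qed

subsection \<open>Element-wise representation of the matrices\<close>

context full_simplex
begin

text \<open>Gradients of finite element functions are known only in the interiors of the elements,
  so measurability on all of \<open>E\<close> has to come from completeness of Lebesgue measure on
  the null set \<open>frontier E\<close>.\<close>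

lemma integral_const_interior:
  fixes f :: "'a \<Rightarrow> real"
  assumes f: "\<And>x. x \<in> interior E \<Longrightarrow> f x = c"
  shows "integrable (lebesgue_on E) f" and "(LINT x|lebesgue_on E. f x) = c * measure lebesgue E"
proof -
  have meas: "f \<in> borel_measurable (lebesgue_on E)"
  proof (rule measurableI)
    fix A :: "real set"
    have "E - interior E = frontier E"
      using compact by (simp add: frontier_def compact_imp_closed)
    then have "negligible (f -` A \<inter> (E - interior E))"
      using negligible_convex_frontier[OF convex] by (metis inf_le2 negligible_subset)
    then have "f -` A \<inter> (E - interior E) \<in> sets lebesgue" by (rule negligible_imp_sets)
    moreover have "f -` A \<inter> E = (if c \<in> A then interior E else {}) \<union> (f -` A \<inter> (E - interior E))"
      using f interior_subset by auto
    ultimately have "f -` A \<inter> E \<in> sets lebesgue" by auto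
    then show "f -` A \<inter> space (lebesgue_on E) \<in> sets (lebesgue_on E)"
      using compact by (auto simp: sets_restrict_space_iff)
  qed auto
  have ae: "AE x in lebesgue_on E. f x = c" using AE_interior by (rule eventually_mono) (rule f)
  have int: "integrable (lebesgue_on E) (\<lambda>x. c)" by (rule integrable_continuous_simplex) (rule continuous_on_const)
  show "integrable (lebesgue_on E) f"
    by (rule integrable_cong_AE_imp[OF int meas]) (use ae in \<open>auto elim: eventually_mono\<close>)
  have "(LINT x|lebesgue_on E. f x) = (LINT x|lebesgue_on E. c)"
    by (rule integral_cong_AE[OF meas _ ae]) simp
  also have "\<dots> = c * measure lebesgue E" using compact by (simp add: measure_restrict_space)
  finally show "(LINT x|lebesgue_on E. f x) = c * measure lebesgue E" .
qed

lemma bary_grad_not_vertex: "v \<notin> V \<Longrightarrow> bary_grad E v = 0"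
  using bary_grad[of v "bary_grad E v" 0] by (simp add: bary_not_vertex)

lemma bary_affine: "bary E v x = bary_grad E v \<bullet> x + bary E v 0"
  using bary_grad[of v x 0] by simp

end

context qu_mesh
begin

abbreviation form where "form A x y \<equiv> inner_on I x (mat_vec I A y)"
abbreviation M where "M \<equiv> mass_matrix \<Omega> T"
abbreviation K where "K \<equiv> stiffness_matrix \<Omega> T"
abbreviation D where "D \<equiv> lumped_matrix \<Omega> T"

abbreviation wt :: "'a set \<Rightarrow> real" where "wt E \<equiv> full_simplex.weight E"

lemma wt_pos: "E \<in> T \<Longrightarrow> 0 < wt E"
  using measure_elem_pos by (simp add: full_simplex.weight_def[OF full] add_pos_pos)

definition elem_mass :: "'a set \<Rightarrow> 'a \<Rightarrow> 'a \<Rightarrow> real" where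
  "elem_mass E v w = (if v \<in> vs E \<and> w \<in> vs E then wt E * (if v = w then 2 else 1) else 0)"

lemma integral_hat_elem:
  assumes "E \<in> T"
  shows "integrable (lebesgue_on E) (\<lambda>x. hat T v x * hat T w x)"
    and "(LINT x|lebesgue_on E. hat T v x * hat T w x) = elem_mass E v w"
proof -
  interpret full_simplex E using full assms .
  have eq: "hat T v x * hat T w x = bary E v x * bary E w x" if "x \<in> space (lebesgue_on E)" for x
    using that hat_eq[OF assms] by simp
  show "integrable (lebesgue_on E) (\<lambda>x. hat T v x * hat T w x)"
    by (subst Bochner_Integration.integrable_cong[OF refl eq])
      (auto intro: integrable_continuous_simplex continuous_on_mult continuous_bary)
  show "(LINT x|lebesgue_on E. hat T v x * hat T w x) = elem_mass E v w"
    using integral_bary_product(1)[of v w]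
    by (subst Bochner_Integration.integral_cong[OF refl eq]) (auto simp: bary_not_vertex elem_mass_def)
qed

lemma mass_matrix_eq: "M v w = (\<Sum>E\<in>T. elem_mass E v w)"
proof -
  have "M v w = (\<Sum>E\<in>T. LINT x|lebesgue_on E. hat T w x * hat T v x)"
    unfolding mass_matrix_def by (rule integral_mesh) (rule integral_hat_elem)
  also have "\<dots> = (\<Sum>E\<in>T. elem_mass E v w)"
    by (intro sum.cong refl) (subst mult.commute, rule integral_hat_elem)
  finally show ?thesis .
qed

text \<open>Row sums of the element mass matrices: 2 from \<open>v\<close> itself and 1 from each of
  the \<open>d\<close> other vertices of the element, boundary vertices included.\<close>

lemma lumped_matrix_eq: "D v v = (\<Sum>E\<in>T. if v \<in> vs E then wt E * (real DIM('a) + 2) else 0)"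
proof -
  have "D v v = (\<Sum>u\<in>mesh_vertices T. M v u)"
    by (simp add: lumped_matrix_def mass_matrix_def)
  also have "\<dots> = (\<Sum>E\<in>T. \<Sum>u\<in>mesh_vertices T. elem_mass E v u)"
    unfolding mass_matrix_eq by (rule sum.swap)
  also have "\<dots> = (\<Sum>E\<in>T. if v \<in> vs E then wt E * (real DIM('a) + 2) else 0)"
  proof (rule sum.cong[OF refl])
    fix E assume E: "E \<in> T"
    interpret full_simplex E using full E .
    have "(\<Sum>u\<in>mesh_vertices T. elem_mass E v u) = (\<Sum>u\<in>V. elem_mass E v u)"
      using finite_vertices vertices_mesh[OF E] by (intro sum.mono_neutral_right) (auto simp: elem_mass_def)
    also have "\<dots> = (if v \<in> V then \<Sum>u\<in>V. wt E + (if v = u then wt E else 0) else 0)"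
      by (auto simp: elem_mass_def intro!: sum.cong)
    also have "\<dots> = (if v \<in> V then wt E * (real DIM('a) + 2) else 0)"
      using vertices(1,3) by (simp add: sum.distrib algebra_simps)
    finally show "(\<Sum>u\<in>mesh_vertices T. elem_mass E v u) = (if v \<in> V then wt E * (real DIM('a) + 2) else 0)" .
  qed
  finally show ?thesis .
qed

lemma grad_hat: "E \<in> T \<Longrightarrow> x \<in> interior E \<Longrightarrow> grad (hat T v) x = bary_grad E v"
proof (rule full_simplex.grad_affine[OF full])
  fix z assume "E \<in> T" "z \<in> E"
  then show "hat T v z = bary_grad E v \<bullet> z + bary E v 0"
    using full_simplex.bary_affine[OF full, of E v z] by (simp add: hat_eq)
qed

lemma stiffness_matrix_eq: "K v w = (\<Sum>E\<in>T. vol E * (bary_grad E v \<bullet> bary_grad E w))"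
proof -
  have "K v w = (\<Sum>E\<in>T. LINT x|lebesgue_on E. grad (hat T w) x \<bullet> grad (hat T v) x)"
    unfolding stiffness_matrix_def
    by (rule integral_mesh) (rule full_simplex.integral_const_interior[OF full], auto simp: grad_hat)
  also have "\<dots> = (\<Sum>E\<in>T. vol E * (bary_grad E v \<bullet> bary_grad E w))"
    by (intro sum.cong refl, subst full_simplex.integral_const_interior(2)[OF full])
      (auto simp: grad_hat inner_commute)
  finally show ?thesis .
qed

text \<open>The constant gradient of \<open>fe y\<close> on the element \<open>E\<close>.\<close>

definition G :: "'a set \<Rightarrow> ('a \<Rightarrow> real) \<Rightarrow> 'a" where
  "G E y = (\<Sum>v\<in>I. y v *\<^sub>R bary_grad E v)"

lemma grad_fe_function: "E \<in> T \<Longrightarrow> x \<in> interior E \<Longrightarrow> grad (fe y) x = G E y"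
proof (rule full_simplex.grad_affine[OF full])
  fix z assume "E \<in> T" "z \<in> E"
  then have "fe y z = (\<Sum>v\<in>I. y v * (bary_grad E v \<bullet> z + bary E v 0))"
    using full_simplex.bary_affine[OF full, of E _ z] by (simp add: fe_function_def hat_eq)
  also have "\<dots> = G E y \<bullet> z + (\<Sum>v\<in>I. y v * bary E v 0)"
    by (simp add: G_def inner_sum_left algebra_simps sum.distrib)
  finally show "fe y z = G E y \<bullet> z + (\<Sum>v\<in>I. y v * bary E v 0)" .
qed

lemma stiffness_form: "form K x y = (\<Sum>E\<in>T. vol E * (G E x \<bullet> G E y))"
proof -
  have "form K x y = (\<Sum>v\<in>I. \<Sum>w\<in>I. \<Sum>E\<in>T. vol E * (x v * (y w * (bary_grad E v \<bullet> bary_grad E w))))"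
    by (simp add: inner_on_def mat_vec_def stiffness_matrix_eq sum_distrib_left sum_distrib_right mult_ac)
  also have "\<dots> = (\<Sum>v\<in>I. \<Sum>E\<in>T. \<Sum>w\<in>I. vol E * (x v * (y w * (bary_grad E v \<bullet> bary_grad E w))))"
    by (intro sum.cong refl sum.swap)
  also have "\<dots> = (\<Sum>E\<in>T. \<Sum>v\<in>I. \<Sum>w\<in>I. vol E * (x v * (y w * (bary_grad E v \<bullet> bary_grad E w))))"
    by (rule sum.swap)
  also have "\<dots> = (\<Sum>E\<in>T. vol E * (G E x \<bullet> G E y))"
  proof (rule sum.cong[OF refl])
    fix E
    have "G E x \<bullet> G E y = (\<Sum>v\<in>I. x v * (bary_grad E v \<bullet> G E y))"
      by (simp add: G_def[of E x] inner_sum_left)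
    also have "\<dots> = (\<Sum>v\<in>I. \<Sum>w\<in>I. x v * (y w * (bary_grad E v \<bullet> bary_grad E w)))"
      by (simp add: G_def inner_sum_right sum_distrib_left)
    finally show "(\<Sum>v\<in>I. \<Sum>w\<in>I. vol E * (x v * (y w * (bary_grad E v \<bullet> bary_grad E w)))) = vol E * (G E x \<bullet> G E y)"
      by (simp add: sum_distrib_left)
  qed
  finally show ?thesis .
qed

text \<open>The element mass matrix is \<open>wt E\<close> times the sum of the identity and the
  all-ones matrix, which gives the sum of squares and the square of the sum; boundary vertices carry
  no coefficient.\<close>

definition elem_sq :: "'a set \<Rightarrow> ('a \<Rightarrow> real) \<Rightarrow> real" where
  "elem_sq E y = wt E * ((\<Sum>v\<in>I \<inter> vs E. y v)\<^sup>2 + (\<Sum>v\<in>I \<inter> vs E. (y v)\<^sup>2))"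

lemma elem_sq_eq: "(\<Sum>v\<in>I. \<Sum>w\<in>I. y v * y w * elem_mass E v w) = elem_sq E y"
proof -
  let ?J = "I \<inter> vs E"
  have "(\<Sum>v\<in>I. \<Sum>w\<in>I. y v * y w * elem_mass E v w) = (\<Sum>v\<in>?J. \<Sum>w\<in>I. y v * y w * elem_mass E v w)"
    using finite_interior_vertices by (intro sum.mono_neutral_right) (auto simp: elem_mass_def)
  also have "\<dots> = (\<Sum>v\<in>?J. \<Sum>w\<in>?J. y v * y w * elem_mass E v w)"
    using finite_interior_vertices by (intro sum.cong refl sum.mono_neutral_right) (auto simp: elem_mass_def)
  also have "\<dots> = (\<Sum>v\<in>?J. \<Sum>w\<in>?J. wt E * (y v * y w) + (if v = w then wt E * (y v)\<^sup>2 else 0))"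
    by (intro sum.cong refl) (auto simp: elem_mass_def power2_eq_square)
  also have "\<dots> = wt E * (\<Sum>v\<in>?J. \<Sum>w\<in>?J. y v * y w) + (\<Sum>v\<in>?J. wt E * (y v)\<^sup>2)"
    using finite_interior_vertices by (simp add: sum.distrib sum_distrib_left)
  also have "(\<Sum>v\<in>?J. \<Sum>w\<in>?J. y v * y w) = (\<Sum>v\<in>?J. y v)\<^sup>2"
    by (simp add: power2_eq_square sum_product)
  finally show ?thesis by (simp add: elem_sq_def sum_distrib_left distrib_left)
qed

lemma integral_fe_elem:
  assumes E: "E \<in> T"
  shows "integrable (lebesgue_on E) (\<lambda>x. (fe y x)\<^sup>2)"
    and "(LINT x|lebesgue_on E. (fe y x)\<^sup>2) = elem_sq E y"
proof -
  have eq: "(fe y x)\<^sup>2 = (\<Sum>v\<in>I. \<Sum>w\<in>I. y v * y w * (hat T v x * hat T w x))" for x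
    by (simp add: fe_function_def power2_eq_square sum_product mult_ac)
  show "integrable (lebesgue_on E) (\<lambda>x. (fe y x)\<^sup>2)" "(LINT x|lebesgue_on E. (fe y x)\<^sup>2) = elem_sq E y"
    unfolding eq elem_sq_eq[symmetric] by (simp_all add: integral_hat_elem[OF E])
qed

lemma fe_function_L2: "fe y \<in> L2_space \<Omega>"
proof -
  have "continuous_on \<Omega> (fe y)"
    using fe_function_P1[of y] closure_subset[of \<Omega>] continuous_on_subset
    unfolding P1_functions_def union_T by blast
  then have "fe y \<in> borel_measurable (lebesgue_on \<Omega>)"
    using domain(1) by (intro continuous_imp_measurable_on_sets_lebesgue) auto
  moreover have "integrable (lebesgue_on \<Omega>) (\<lambda>x. (fe y x)\<^sup>2)"
    by (rule integrable_mesh) (rule integral_fe_elem)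
  ultimately show ?thesis by (simp add: L2_space_def)
qed

lemma mass_form: "form M y y = (\<Sum>E\<in>T. elem_sq E y)"
proof -
  have "form M y y = (\<Sum>v\<in>I. \<Sum>w\<in>I. \<Sum>E\<in>T. y v * y w * elem_mass E v w)"
    by (simp add: inner_on_def mat_vec_def mass_matrix_eq sum_distrib_left sum_distrib_right mult_ac)
  also have "\<dots> = (\<Sum>v\<in>I. \<Sum>E\<in>T. \<Sum>w\<in>I. y v * y w * elem_mass E v w)"
    by (intro sum.cong refl sum.swap)
  also have "\<dots> = (\<Sum>E\<in>T. \<Sum>v\<in>I. \<Sum>w\<in>I. y v * y w * elem_mass E v w)"
    by (rule sum.swap)
  finally show ?thesis by (simp add: elem_sq_eq)
qed

lemma L2_norm_fe_function: "(L2_norm \<Omega> (fe y))\<^sup>2 = form M y y"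
proof -
  have "(LINT x|lebesgue_on \<Omega>. (fe y x)\<^sup>2) = (\<Sum>E\<in>T. LINT x|lebesgue_on E. (fe y x)\<^sup>2)"
    by (rule integral_mesh) (rule integral_fe_elem)
  then show ?thesis by (simp add: L2_norm_power2 mass_form integral_fe_elem(2))
qed

section \<open>Spectral equivalence of mass, lumped mass and Schur complement\<close>

lemma lumped_form: "(\<Sum>v\<in>I. D v v * (y v)\<^sup>2)
  = (\<Sum>E\<in>T. wt E * (real DIM('a) + 2) * (\<Sum>v\<in>I \<inter> vs E. (y v)\<^sup>2))"
proof -
  have "(\<Sum>v\<in>I. D v v * (y v)\<^sup>2) = (\<Sum>v\<in>I. \<Sum>E\<in>T. if v \<in> vs E then wt E * (real DIM('a) + 2) * (y v)\<^sup>2 else 0)"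
    unfolding lumped_matrix_eq sum_distrib_right by (intro sum.cong refl) simp
  also have "\<dots> = (\<Sum>E\<in>T. \<Sum>v\<in>I. if v \<in> vs E then wt E * (real DIM('a) + 2) * (y v)\<^sup>2 else 0)"
    by (rule sum.swap)
  also have "\<dots> = (\<Sum>E\<in>T. wt E * (real DIM('a) + 2) * (\<Sum>v\<in>I \<inter> vs E. (y v)\<^sup>2))"
    using finite_interior_vertices by (simp add: sum.inter_restrict sum_distrib_left if_distrib cong: if_cong)
  finally show ?thesis .
qed

lemma lumped_pos: "v \<in> I \<Longrightarrow> 0 < D v v"
proof -
  assume "v \<in> I"
  then obtain E where E: "E \<in> T" "v \<in> vs E"
    by (auto simp: interior_vertices_def mesh_vertices_def)
  then have "0 < (if v \<in> vs E then wt E * (real DIM('a) + 2) else 0)"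
    using wt_pos by (simp add: add_pos_pos)
  also have "\<dots> \<le> D v v"
    unfolding lumped_matrix_eq using E(1) finite_T wt_pos
    by (intro member_le_sum[of E T "\<lambda>E. if v \<in> vs E then wt E * (real DIM('a) + 2) else 0"])
      (auto intro: less_imp_le)
  finally show ?thesis .
qed

text \<open>Element by element: there are at most \<open>d + 1\<close> summands, so Cauchy-Schwarz
  bounds the square of the sum by \<open>d + 1\<close> times the sum of squares.\<close>

lemma mass_le_lumped: "form M y y \<le> (\<Sum>v\<in>I. D v v * (y v)\<^sup>2)"
  unfolding mass_form lumped_form
proof (rule sum_mono)
  fix E assume E: "E \<in> T"
  interpret full_simplex E using full E .
  let ?J = "I \<inter> V"
  have "(\<Sum>v\<in>?J. y v)\<^sup>2 \<le> (\<Sum>v\<in>?J. (y v)\<^sup>2) * real (card ?J)"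
    by (rule sum_squared_le_sum_of_squares)
  also have "\<dots> \<le> (\<Sum>v\<in>?J. (y v)\<^sup>2) * (real DIM('a) + 1)"
    using card_mono[of V ?J] vertices(1,3) by (intro mult_left_mono sum_nonneg) auto
  finally have "(\<Sum>v\<in>?J. y v)\<^sup>2 + (\<Sum>v\<in>?J. (y v)\<^sup>2) \<le> (real DIM('a) + 2) * (\<Sum>v\<in>?J. (y v)\<^sup>2)"
    by (simp add: algebra_simps)
  then have "wt E * ((\<Sum>v\<in>?J. y v)\<^sup>2 + (\<Sum>v\<in>?J. (y v)\<^sup>2)) \<le> wt E * ((real DIM('a) + 2) * (\<Sum>v\<in>?J. (y v)\<^sup>2))"
    using wt_pos[OF E] by (intro mult_left_mono) auto
  then show "elem_sq E y \<le> wt E * (real DIM('a) + 2) * (\<Sum>v\<in>?J. (y v)\<^sup>2)"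
    unfolding elem_sq_def by (simp only: mult.assoc)
qed

text \<open>Dropping the square of the sum from \<open>elem_sq\<close> leaves the lumped form
  divided by \<open>d + 2\<close>.\<close>

lemma lumped_le_mass: "1 / (real DIM('a) + 2) * (\<Sum>v\<in>I. D v v * (y v)\<^sup>2) \<le> form M y y"
proof -
  have "1 / (real DIM('a) + 2) * (wt E * (real DIM('a) + 2) * t) = wt E * t" for E t
    by simp
  then have "1 / (real DIM('a) + 2) * (\<Sum>v\<in>I. D v v * (y v)\<^sup>2) = (\<Sum>E\<in>T. wt E * (\<Sum>v\<in>I \<inter> vs E. (y v)\<^sup>2))"
    unfolding lumped_form by (subst sum_distrib_left) (simp only:)
  also have "\<dots> \<le> (\<Sum>E\<in>T. elem_sq E y)"
    unfolding elem_sq_def using wt_pos by (intro sum_mono mult_left_mono) (auto intro: less_imp_le)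
  finally show ?thesis unfolding mass_form .
qed

lemma stiffness_Cauchy_Schwarz:
  "(form K x y)\<^sup>2 \<le> form K x x * form K y y"
proof (rule nonneg_quadratic_discriminant)
  fix t
  have "0 \<le> (\<Sum>E\<in>T. vol E * ((G E x + t *\<^sub>R G E y) \<bullet> (G E x + t *\<^sub>R G E y)))"
    by (intro sum_nonneg mult_nonneg_nonneg) auto
  also have "\<dots> = (\<Sum>E\<in>T. vol E * (G E x \<bullet> G E x) + 2 * t * (vol E * (G E x \<bullet> G E y))
      + t\<^sup>2 * (vol E * (G E y \<bullet> G E y)))"
    by (intro sum.cong refl) (simp add: inner_add_left inner_add_right inner_commute[of "G _ y" "G _ x"] power2_eq_square algebra_simps)
  also have "\<dots> = form K x x + 2 * t * form K x y + t\<^sup>2 * form K y y"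
    unfolding stiffness_form by (simp add: sum.distrib sum_distrib_left)
  finally show "0 \<le> form K x x + 2 * t * form K x y + t\<^sup>2 * form K y y" .
qed (auto simp: stiffness_form intro!: sum_nonneg)

definition inverse_estimate :: "real \<Rightarrow> bool" where
  "inverse_estimate cinv \<longleftrightarrow> (\<forall>w\<in>fe_space \<Omega> T. \<forall>E\<in>T. L2_norm E (grad w) \<le> cinv * inverse h * L2_norm E w)"

lemma stiffness_le_mass:
  assumes "inverse_estimate cinv" and "0 < cinv"
  shows "form K y y \<le> (cinv / h)\<^sup>2 * form M y y"
  unfolding stiffness_form mass_form sum_distrib_left
proof (rule sum_mono)
  fix E assume E: "E \<in> T"
  let ?u = "fe y"
  have "L2_norm E (grad ?u) \<le> cinv * inverse h * L2_norm E ?u"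
    using assms(1) E by (auto simp: inverse_estimate_def fe_space_def)
  then have "(L2_norm E (grad ?u))\<^sup>2 \<le> (cinv * inverse h * L2_norm E ?u)\<^sup>2"
    by (intro power_mono) (simp_all add: L2_norm_nonneg)
  moreover have "(L2_norm E (grad ?u))\<^sup>2 = vol E * (G E y \<bullet> G E y)"
  proof -
    have "(LINT x|lebesgue_on E. (norm (grad ?u x))\<^sup>2) = (norm (G E y))\<^sup>2 * vol E"
      using grad_fe_function[OF E] by (intro full_simplex.integral_const_interior(2)[OF full[OF E]]) auto
    then show ?thesis by (simp add: L2_norm_def power2_norm_eq_inner mult.commute)
  qed
  moreover have "(L2_norm E ?u)\<^sup>2 = elem_sq E y"
    by (simp add: L2_norm_power2 integral_fe_elem(2)[OF E])
  ultimately show "vol E * (G E y \<bullet> G E y) \<le> (cinv / h)\<^sup>2 * elem_sq E y"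
    by (simp add: power_mult_distrib divide_inverse)
qed

lemma mass_nonneg: "0 \<le> form M y y"
  unfolding L2_norm_fe_function[symmetric] by simp

abbreviation S where "S \<equiv> schur_matrix \<Omega> T (h ^ 4)"

lemma K_sym: "K v w = K w v"
  by (simp add: stiffness_matrix_eq inner_commute)

lemma M_sym: "M v w = M w v"
  by (simp add: mass_matrix_def mult.commute)

lemma S_sym: "S v w = S w v"
  by (simp add: schur_matrix_def M_sym[of v w] K_sym[of v] K_sym[of _ w] mult_ac)

text \<open>Written with \<open>K x\<close> weighted by the inverse of \<open>D\<close>, the
  stiffness part is visibly nonnegative and takes the shape that \<open>schur_le_mass\<close>
  estimates.\<close>

lemma schur_form: "form S x x
  = h ^ 4 * (\<Sum>v\<in>I. D v v * (mat_vec I K x v / D v v)\<^sup>2) + form M x x"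
proof -
  define z where "z = mat_vec I K x"
  have S: "mat_vec I S x v = h ^ 4 * mat_vec I K (\<lambda>u. z u / D u u) v + mat_vec I M x v" for v
  proof -
    have "(\<Sum>u\<in>I. K v u * (z u / D u u)) = (\<Sum>u\<in>I. \<Sum>w\<in>I. K v u * inverse (D u u) * K u w * x w)"
      by (simp add: z_def mat_vec_def sum_distrib_left divide_inverse mult_ac)
    also have "\<dots> = (\<Sum>w\<in>I. \<Sum>u\<in>I. K v u * inverse (D u u) * K u w * x w)"
      by (rule sum.swap)
    finally show ?thesis
      by (simp add: mat_vec_def schur_matrix_def distrib_right sum.distrib sum_distrib_left sum_distrib_right mult.assoc)
  qed
  have "form S x x = h ^ 4 * inner_on I x (mat_vec I K (\<lambda>u. z u / D u u)) + form M x x"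
    unfolding S inner_on_linear ..
  also have "inner_on I x (mat_vec I K (\<lambda>u. z u / D u u)) = inner_on I z (\<lambda>u. z u / D u u)"
    unfolding z_def by (rule inner_on_mat_vec_commute) (rule K_sym)
  also have "\<dots> = (\<Sum>v\<in>I. D v v * (z v / D v v)\<^sup>2)"
    unfolding inner_on_def using lumped_pos by (intro sum.cong refl) (force simp: power2_eq_square)
  finally show ?thesis by (simp add: z_def)
qed

lemma mass_le_schur: "form M x x \<le> form S x x"
  unfolding schur_form using lumped_pos h_pos
  by (simp add: sum_nonneg less_imp_le)

text \<open>With \<open>w = D^(-1) K x\<close> the stiffness part is
  \<open>a = (D w, w) = (K w, x)\<close>. Cauchy-Schwarz for \<open>K\<close>, the inverse
  inequality for \<open>w\<close> and for \<open>x\<close>, and \<open>M \<le> D\<close> give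
  \<open>a^2 \<le> \<mu>^2 * a * m\<close>, hence \<open>a \<le> (cinv / h)^4 * m\<close>; the
  regularisation \<open>h ^ 4\<close> cancels the mesh size and leaves
  \<open>cinv ^ 4\<close>.\<close>

lemma schur_le_mass:
  assumes "inverse_estimate cinv" and "0 < cinv"
  shows "form S x x \<le> c_SM cinv * form M x x"
proof -
  define w where "w = (\<lambda>v. mat_vec I K x v / D v v)"
  define a where "a = (\<Sum>v\<in>I. D v v * (w v)\<^sup>2)"
  define m where "m = form M x x"
  define \<mu> where "\<mu> = (cinv / h)\<^sup>2"
  have a0: "0 \<le> a" unfolding a_def using lumped_pos by (intro sum_nonneg) (simp add: less_imp_le)
  have m0: "0 \<le> m" unfolding m_def by (rule mass_nonneg)
  have \<mu>0: "0 \<le> \<mu>" by (simp add: \<mu>_def)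
  have a: "a = form K w x"
    unfolding a_def w_def inner_on_def using lumped_pos by (intro sum.cong refl) (force simp: power2_eq_square)
  have "a\<^sup>2 \<le> form K w w * form K x x"
    unfolding a by (rule stiffness_Cauchy_Schwarz)
  also have "\<dots> \<le> (\<mu> * form M w w) * (\<mu> * m)"
  proof (rule mult_mono)
    show "form K w w \<le> \<mu> * form M w w" "form K x x \<le> \<mu> * m"
      unfolding \<mu>_def m_def by (rule stiffness_le_mass[OF assms])+
    show "0 \<le> \<mu> * form M w w" using \<mu>0 mass_nonneg by simp
    show "0 \<le> form K x x" unfolding stiffness_form by (intro sum_nonneg mult_nonneg_nonneg) auto
  qed
  also have "\<dots> \<le> (\<mu> * a) * (\<mu> * m)"
    using mass_le_lumped[of w] \<mu>0 m0 unfolding a_def by (intro mult_right_mono mult_left_mono) auto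
  finally have "a * a \<le> (\<mu>\<^sup>2 * m) * a" by (simp add: power2_eq_square mult_ac)
  then have "a \<le> \<mu>\<^sup>2 * m"
    using a0 \<mu>0 m0 by (cases "a = 0") auto
  then have "h ^ 4 * a \<le> h ^ 4 * (\<mu>\<^sup>2 * m)" using h_pos by (intro mult_left_mono) auto
  also have "\<dots> = cinv ^ 4 * m"
    using h_pos by (simp add: \<mu>_def power_divide power_mult[symmetric])
  finally show ?thesis
    unfolding schur_form by (simp add: a_def w_def m_def c_SM_def distrib_right)
qed

text \<open>The quotient of the two bounds is \<open>\<kappa>\<close>, so that \<open>rate\<close>
  becomes \<open>q_pcg\<close>.\<close>

lemma schur_pencil:
  assumes "inverse_estimate cinv" and "0 < cinv"
  shows "spd_pencil I S D (1 / (real DIM('a) + 2)) (c_SM cinv)"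
proof
  show "finite I" by (rule finite_interior_vertices)
  show "S v w = S w v" for v w by (rule S_sym)
  show "0 < D v v" if "v \<in> I" for v using that by (rule lumped_pos)
  show "0 < 1 / (real DIM('a) + 2)" by (simp add: add_pos_pos)
  have "1 / (real DIM('a) + 2) < 1" by simp
  also have "1 < c_SM cinv" using assms(2) by (simp add: c_SM_def)
  finally show "1 / (real DIM('a) + 2) < c_SM cinv" .
  show "1 / (real DIM('a) + 2) * (\<Sum>v\<in>I. D v v * (x v)\<^sup>2) \<le> form S x x" for x
    using lumped_le_mass mass_le_schur by (rule order_trans)
  have "form S x x \<le> c_SM cinv * form M x x" for x by (rule schur_le_mass[OF assms])
  also have "c_SM cinv * form M x x \<le> c_SM cinv * (\<Sum>v\<in>I. D v v * (x v)\<^sup>2)" for x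
    using assms(2) by (intro mult_left_mono mass_le_lumped) (simp add: c_SM_def)
  finally show "form S x x \<le> c_SM cinv * (\<Sum>v\<in>I. D v v * (x v)\<^sup>2)" for x .
qed

lemma schur_solution_exists:
  assumes "inverse_estimate cinv" and "0 < cinv"
  obtains y where "schur_solution \<Omega> T (h ^ 4) yd y"
proof -
  interpret spd_pencil I S D "1 / (real DIM('a) + 2)" "c_SM cinv" by (rule schur_pencil[OF assms])
  have "\<exists>y. \<forall>v\<in>I. mat_vec I S y v = load_vector \<Omega> T yd v"
    using finite_I energy_pos by (intro positive_definite_solvable) (auto simp: energy_def)
  then show thesis using that by (auto simp: schur_solution_def)
qed

lemma fe_function_diff: "fe (\<lambda>v. y v - z v) = (\<lambda>x. fe y x - fe z x)"
  by (simp add: fe_function_def left_diff_distrib sum_subtractf)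

lemma pcg_L2_error:
  assumes "inverse_estimate cinv" and "0 < cinv" and "schur_solution \<Omega> T (h ^ 4) yd y"
  shows "L2_norm \<Omega> (\<lambda>x. fe y x - fe (pcg I S D (load_vector \<Omega> T yd) x0 k) x)
    \<le> 2 * q_pcg DIM('a) cinv ^ k * sqrt (c_SM cinv) * L2_norm \<Omega> (\<lambda>x. fe y x - fe x0 x)"
proof -
  interpret spd_pencil I S D "1 / (real DIM('a) + 2)" "c_SM cinv" by (rule schur_pencil[OF assms(1,2)])
  define e where "e = (\<lambda>v. y v - pcg I S D (load_vector \<Omega> T yd) x0 k v)"
  define e0 where "e0 = (\<lambda>v. y v - x0 v)"
  have rate: "rate = q_pcg DIM('a) cinv"
    by (subst rate_def) (simp add: q_pcg_def \<kappa>_def c_SM_def mult.commute)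
  have "(L2_norm \<Omega> (fe e))\<^sup>2 \<le> energy e e"
    unfolding L2_norm_fe_function energy_def by (rule mass_le_schur)
  also have "\<dots> \<le> (2 * rate ^ k)\<^sup>2 * energy e0 e0"
    unfolding e_def e0_def using assms(3) by (intro pcg_error) (auto simp: schur_solution_def)
  also have "\<dots> \<le> (2 * rate ^ k)\<^sup>2 * (c_SM cinv * (L2_norm \<Omega> (fe e0))\<^sup>2)"
    unfolding L2_norm_fe_function energy_def by (intro mult_left_mono schur_le_mass assms) simp
  also have "\<dots> = (2 * rate ^ k * sqrt (c_SM cinv) * L2_norm \<Omega> (fe e0))\<^sup>2"
    using assms(2) by (simp add: power_mult_distrib c_SM_def)
  finally have "L2_norm \<Omega> (fe e) \<le> 2 * rate ^ k * sqrt (c_SM cinv) * L2_norm \<Omega> (fe e0)"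
    using rate_pos assms(2) by (elim power2_le_imp_le) (simp add: L2_norm_nonneg c_SM_def)
  then show ?thesis by (simp add: e_def e0_def fe_function_diff rate)
qed

lemma sparse:
  assumes "v \<in> I"
  shows "{w \<in> I. K v w \<noteq> 0} \<subseteq> neighbours v" and "{w \<in> I. M v w \<noteq> 0} \<subseteq> neighbours v"
proof -
  have *: "v \<notin> vs E \<or> w \<notin> vs E" if "E \<in> T" "w \<notin> neighbours v" for w E
    using that full_simplex.vertices_subset[OF full] by (auto simp: neighbours_def)
  have "K v w = 0" if "w \<notin> neighbours v" for w
    unfolding stiffness_matrix_eq using *[OF _ that] full_simplex.bary_grad_not_vertex[OF full]
    by (intro sum.neutral ballI) (metis inner_zero_left inner_zero_right mult_zero_right)
  then show "{w \<in> I. K v w \<noteq> 0} \<subseteq> neighbours v" by blast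
  have "M v w = 0" if "w \<notin> neighbours v" for w
    unfolding mass_matrix_eq elem_mass_def using *[OF _ that] by (intro sum.neutral ballI) auto
  then show "{w \<in> I. M v w \<noteq> 0} \<subseteq> neighbours v" by blast
qed

lemma hat_sparse: "{w. hat T w x \<noteq> 0} \<subseteq> neighbours x"
proof
  fix w assume w: "w \<in> {w. hat T w x \<noteq> 0}"
  then have "x \<in> \<Union>T" using hat_outside[of x w] by (auto simp: union_T)
  then obtain E where E: "E \<in> T" "x \<in> E" by blast
  then have "w \<in> vs E"
    using w full_simplex.bary_not_vertex[OF full, of E w x] by (auto simp: hat_eq)
  then show "w \<in> neighbours x" using E by (auto simp: neighbours_def)
qed

end

section \<open>The nested iteration\<close>

lemma mesh_hierarchy_level:
  assumes "lipschitz_polyhedral_domain \<Omega>" and "mesh_hierarchy \<Omega> \<sigma> \<gamma> L T h" and "1 \<le> l" and "l \<le> L"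
  shows "qu_mesh \<Omega> (T l) \<sigma> \<gamma> (h l)"
  using assms by unfold_locales (auto simp: mesh_hierarchy_def)

lemma mesh_hierarchy_Suc:
  assumes "mesh_hierarchy \<Omega> \<sigma> \<gamma> L T h" and "1 \<le> l" and "Suc l \<le> L"
  shows "uniform_refinement (T l) (T (Suc l))" and "h l = 2 * h (Suc l)"
proof -
  have "Suc l \<in> {2..L}" using assms by auto
  then have "uniform_refinement (T (Suc l - 1)) (T (Suc l)) \<and> h (Suc l) = h (Suc l - 1) / 2"
    using assms(1) unfolding mesh_hierarchy_def by blast
  then show "uniform_refinement (T l) (T (Suc l))" "h l = 2 * h (Suc l)" by simp_all
qed

subsection \<open>Convergence of the nested iteration\<close>

lemma data_space_subset_L2: "yd \<in> data_space \<Omega> s \<Longrightarrow> yd \<in> L2_space \<Omega>"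
  by (auto simp: data_space_def H0s_space_def Hs_space_def H1_zero_space_def H1_space_def split: if_splits)

lemma Hs_norm_nonneg: "0 \<le> Hs_norm \<Omega> s yd"
  by (simp add: Hs_norm_def L2_norm_nonneg H1_norm_def sum_nonneg)

lemma q_pcg_bounds:
  assumes "0 < cinv"
  shows "0 < q_pcg d cinv" and "q_pcg d cinv < 1"
proof -
  have "1 * 1 < (real d + 2) * (cinv ^ 4 + 1)"
    using assms by (intro mult_strict_mono) auto
  then have "1 < sqrt (\<kappa> d cinv)" by (simp add: \<kappa>_def)
  moreover have "0 < (x - 1) / (x + 1) \<and> (x - 1) / (x + 1) < 1" if "1 < x" for x :: real
    using that by simp
  ultimately show "0 < q_pcg d cinv" "q_pcg d cinv < 1" unfolding q_pcg_def by blast+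
qed

lemma power_le_of_ln_ratio:
  fixes q Q :: real
  assumes "0 < q" and "q < 1" and "0 < Q" and "ln (inverse Q) / ln (inverse q) \<le> real k"
  shows "q ^ k \<le> Q"
proof -
  have pos: "0 < ln (inverse q)" using assms(1,2) by (simp add: ln_inverse ln_less_zero)
  have "ln (inverse Q) \<le> real k * ln (inverse q)"
    using assms(4) pos by (simp add: pos_divide_le_eq)
  then have "ln (q ^ k) \<le> ln Q"
    using assms(1,3) by (simp add: ln_inverse ln_realpow)
  then show ?thesis using assms(1,3) by simp
qed

text \<open>The origin of \<open>q_data\<close>: with \<open>a = c * Hs_norm\<close>,
  \<open>b = L2_norm\<close> and \<open>C = sqrt c_SM\<close> its denominator \<open>E\<close> is
  such that \<open>h^s * E\<close> bounds the initial error on the fine level, namely the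
  discretisation error \<open>h^s * a\<close> plus the coarse error
  \<open>(2 h)^s * (a + 2 C b)\<close>. The step number makes \<open>q^k * E \<le> b\<close>, so the
  PCG error is at most \<open>2 C h^s b\<close>, and one more discretisation error restores
  \<open>c_data\<close>.\<close>

lemma nested_step:
  fixes \<Omega> :: "'a::euclidean_space set"
  assumes "qu_mesh \<Omega> T \<sigma> \<gamma> H" and "qu_mesh \<Omega> T' \<sigma> \<gamma> h" and "uniform_refinement T T'" and H: "H = 2 * h"
    and inv: "qu_mesh.inverse_estimate \<Omega> T' h cinv" and cinv: "0 < cinv"
    and yd: "yd \<in> L2_space \<Omega>" and n: "0 < L2_norm \<Omega> yd" and c: "0 < c"
    and discr: "\<And>y. schur_solution \<Omega> T' (h ^ 4) yd y \<Longrightarrow>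
      L2_norm \<Omega> (\<lambda>x. fe_function \<Omega> T' y x - yd x) \<le> c * h powr s * Hs_norm \<Omega> s yd"
    and coarse: "L2_norm \<Omega> (\<lambda>x. yd x - fe_function \<Omega> T y0 x) \<le> H powr s * c_data \<Omega> s c cinv yd"
    and k: "ln (inverse (q_data \<Omega> s c cinv yd)) / ln (inverse (q_pcg DIM('a) cinv)) \<le> real k"
  shows "L2_norm \<Omega> (\<lambda>x. yd x - fe_function \<Omega> T' (pcg (interior_vertices \<Omega> T') (schur_matrix \<Omega> T' (h ^ 4))
      (lumped_matrix \<Omega> T') (load_vector \<Omega> T' yd) (fe_function \<Omega> T y0) k) x) \<le> h powr s * c_data \<Omega> s c cinv yd"
    (is "L2_norm \<Omega> (\<lambda>x. yd x - fe_function \<Omega> T' ?y' x) \<le> _")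
proof -
  let ?nrm = "L2_norm \<Omega>"
  interpret A: qu_mesh \<Omega> T \<sigma> \<gamma> H by fact
  interpret B: qu_mesh \<Omega> T' \<sigma> \<gamma> h by fact
  define u0 where "u0 = fe_function \<Omega> T y0"
  have u0: "fe_function \<Omega> T' u0 = u0"
    unfolding u0_def by (rule fe_function_refine) (use assms A.mesh_axioms B.mesh_axioms in auto)
  obtain y where y: "schur_solution \<Omega> T' (h ^ 4) yd y"
    using B.schur_solution_exists[OF inv cinv] .
  define u u' where "u = fe_function \<Omega> T' y" and "u' = fe_function \<Omega> T' ?y'"
  have L2: "u \<in> L2_space \<Omega>" "u' \<in> L2_space \<Omega>" "u0 \<in> L2_space \<Omega>"
    unfolding u_def u'_def u0_def by (rule A.fe_function_L2 B.fe_function_L2)+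
  have diff: "(\<lambda>x. f x - g x) \<in> L2_space \<Omega>" if "f \<in> L2_space \<Omega>" "g \<in> L2_space \<Omega>" for f g
    using L2_space_lincomb(1)[OF that, of "-1"] by simp
  have tri: "?nrm (\<lambda>x. f x - g x) \<le> ?nrm (\<lambda>x. f x - w x) + ?nrm (\<lambda>x. w x - g x)"
    if "f \<in> L2_space \<Omega>" "g \<in> L2_space \<Omega>" "w \<in> L2_space \<Omega>" for f g w
    using L2_norm_triangle[OF diff[of f w] diff[of w g]] that by simp
  define a b C q where "a = c * Hs_norm \<Omega> s yd" and "b = L2_norm \<Omega> yd" and "C = sqrt (c_SM cinv)"
    and "q = q_pcg DIM('a) cinv"
  define E where "E = (1 + 2 powr s) * a + 2 powr (1 + s) * C * b"
  define \<eta> where "\<eta> = h powr s"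
  have C: "0 < C" using cinv by (simp add: C_def c_SM_def add_pos_pos)
  have a: "0 \<le> a" using c by (simp add: a_def Hs_norm_nonneg)
  have b: "0 < b" using n by (simp add: b_def)
  have \<eta>: "0 < \<eta>" using B.h_pos by (simp add: \<eta>_def)
  have E: "0 < E" using a b C unfolding E_def by (intro add_nonneg_pos mult_nonneg_nonneg mult_pos_pos) auto
  have Q: "q_data \<Omega> s c cinv yd = b / E" by (simp add: q_data_def E_def a_def b_def C_def mult.assoc)
  have "q ^ k \<le> b / E"
    unfolding Q[symmetric] q_def
    by (rule power_le_of_ln_ratio[OF q_pcg_bounds[OF cinv] _ k]) (use Q b E in simp)
  then have qE: "q ^ k * E \<le> b" using E by (simp add: pos_le_divide_eq)
  have cd: "c_data \<Omega> s c cinv yd = a + 2 * C * b" by (simp add: c_data_def a_def b_def C_def)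
  have e1: "?nrm (\<lambda>x. u x - yd x) \<le> \<eta> * a"
    using discr[OF y] by (simp add: u_def \<eta>_def a_def mult_ac)
  have "?nrm (\<lambda>x. u x - u0 x) \<le> \<eta> * a + H powr s * (a + 2 * C * b)"
    using tri[OF L2(1,3) yd] e1 coarse unfolding cd u0_def by linarith
  also have "\<dots> = \<eta> * E"
    using B.h_pos by (simp add: H powr_mult powr_add E_def \<eta>_def algebra_simps)
  finally have e0: "?nrm (\<lambda>x. u x - u0 x) \<le> \<eta> * E" .
  have "?nrm (\<lambda>x. u x - u' x) \<le> 2 * q ^ k * C * ?nrm (\<lambda>x. u x - u0 x)"
    using B.pcg_L2_error[OF inv cinv y, of u0 k] u0 unfolding u_def u'_def u0_def q_def C_def by simp
  also have "\<dots> \<le> 2 * q ^ k * C * (\<eta> * E)"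
    using e0 C q_pcg_bounds[OF cinv, of "DIM('a)"] by (intro mult_left_mono) (auto simp: q_def)
  also have "\<dots> = (2 * C * \<eta>) * (q ^ k * E)" by (simp add: mult_ac)
  also have "\<dots> \<le> (2 * C * \<eta>) * b" using qE C \<eta> by (intro mult_left_mono) auto
  finally have e2: "?nrm (\<lambda>x. u x - u' x) \<le> (2 * C * \<eta>) * b" .
  have "?nrm (\<lambda>x. yd x - u' x) \<le> ?nrm (\<lambda>x. yd x - u x) + ?nrm (\<lambda>x. u x - u' x)"
    by (rule tri[OF yd L2(2,1)])
  also have "\<dots> \<le> \<eta> * (a + 2 * C * b)"
    using e1 e2 unfolding L2_norm_minus_commute[of \<Omega> yd u] by (simp add: algebra_simps)
  finally show ?thesis by (simp add: cd u'_def \<eta>_def)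
qed

lemma nested_convergence:
  fixes \<Omega> :: "'a::euclidean_space set"
  assumes dom: "lipschitz_polyhedral_domain \<Omega>" and hier: "mesh_hierarchy \<Omega> \<sigma> \<gamma> L T h"
    and kstar: "\<forall>l\<ge>2. k l = kstar" and yd: "yd \<in> data_space \<Omega> s" and ne: "\<not> (AE x in lebesgue_on \<Omega>. yd x = 0)"
    and cinv: "0 < cinv" and inv: "inverse_inequality \<Omega> L T h cinv"
    and c: "0 < c" and discr: "discretization_error_estimate \<Omega> L T h s c yd"
    and start: "L2_norm \<Omega> (\<lambda>x. yd x - fe_function \<Omega> (T 1) (nested_iterate \<Omega> T h k yd 1) x)
      \<le> h 1 powr s * c_data \<Omega> s c cinv yd"
    and k: "real kstar \<ge> ln (inverse (q_data \<Omega> s c cinv yd)) / ln (inverse (q_pcg DIM('a) cinv))"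
    and l: "1 \<le> l" "l \<le> L"
  shows "L2_norm \<Omega> (\<lambda>x. yd x - fe_function \<Omega> (T l) (nested_iterate \<Omega> T h k yd l) x)
      \<le> h l powr s * c_data \<Omega> s c cinv yd"
  using l
proof (induction l rule: nat_induct_at_least)
  case base
  then show ?case using start by simp
next
  case (Suc l)
  have lL: "l \<le> L" "Suc l \<in> {1..L}" using Suc by auto
  note L2 = data_space_subset_L2[OF yd]
  have A: "qu_mesh \<Omega> (T l) \<sigma> \<gamma> (h l)" and B: "qu_mesh \<Omega> (T (Suc l)) \<sigma> \<gamma> (h (Suc l))"
    using mesh_hierarchy_level[OF dom hier] Suc lL by auto
  have inv': "qu_mesh.inverse_estimate \<Omega> (T (Suc l)) (h (Suc l)) cinv"
    using inv lL(2) unfolding qu_mesh.inverse_estimate_def[OF B] inverse_inequality_def by blast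
  have discr': "L2_norm \<Omega> (\<lambda>x. fe_function \<Omega> (T (Suc l)) y x - yd x) \<le> c * h (Suc l) powr s * Hs_norm \<Omega> s yd"
    if "schur_solution \<Omega> (T (Suc l)) (h (Suc l) ^ 4) yd y" for y
    using discr lL(2) that unfolding discretization_error_estimate_def by blast
  have "k (Suc l) = kstar" using kstar Suc.hyps by simp
  then show ?case
    using nested_step[OF A B mesh_hierarchy_Suc[OF hier Suc.hyps Suc.prems] inv' cinv L2 L2_norm_pos[OF L2 ne] c discr' Suc.IH[OF lL(1)] k] Suc.hyps
    by simp
qed

subsection \<open>Cost of the nested iteration\<close>

text \<open>Per unknown of a level: \<open>2 * \<Delta>\<close> operations for the prolongation of
  the coarse iterate and \<open>6 * \<Delta> + 3 + 16\<close> for each of \<open>k + 1\<close> PCG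
  units. Counts are integers, so a real bound strictly below \<open>Suc \<Delta>\<close> yields at
  most \<open>\<Delta>\<close> entries per row. Level 0 only starts the induction.\<close>

lemma nested_iterate_avail:
  fixes \<Omega> :: "'a::euclidean_space set" and J :: "('a \<Rightarrow> real) set"
  assumes dom: "lipschitz_polyhedral_domain \<Omega>" and hier: "mesh_hierarchy \<Omega> \<sigma> \<gamma> L T h"
    and \<Delta>: "(real DIM('a) + 1) * (\<gamma>\<^sup>2 * \<sigma>) ^ DIM('a) < real (Suc \<Delta>)"
  shows "l \<le> L \<Longrightarrow> \<exists>F. straight_line.avail (\<lambda>yd. input_memory \<Omega> T h yd) J
      (\<Sum>i\<in>{1..l}. card (interior_vertices \<Omega> (T i)) * (2 * \<Delta> + (k i + 1) * (6 * \<Delta> + 19))) F \<and>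
    straight_line.inputs (\<lambda>yd. input_memory \<Omega> T h yd) \<subseteq> F \<and>
    (l \<noteq> 0 \<longrightarrow> straight_line.vec (interior_vertices \<Omega> (T l)) (\<lambda>yd. nested_iterate \<Omega> T h k yd l) \<subseteq> F)"
proof (induction l)
  case 0
  then show ?case using straight_line.avail_inputs by auto
next
  case (Suc l)
  interpret straight_line "\<lambda>yd. input_memory \<Omega> T h yd" J .
  let ?I = "\<lambda>l. interior_vertices \<Omega> (T l)"
  let ?I' = "?I (Suc l)"
  let ?N = "card ?I'"
  let ?n = "\<Sum>i\<in>{1..l}. card (?I i) * (2 * \<Delta> + (k i + 1) * (6 * \<Delta> + 19))"
  let ?n1 = "?n + ?N * (2 * \<Delta>)"
  let ?m = "?n1 + (k (Suc l) + 1) * (?N * (6 * \<Delta> + 3 + 16))"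
  have B: "qu_mesh \<Omega> (T (Suc l)) \<sigma> \<gamma> (h (Suc l))" by (rule mesh_hierarchy_level[OF dom hier]) (use Suc in auto)
  interpret B: qu_mesh \<Omega> "T (Suc l)" \<sigma> \<gamma> "h (Suc l)" by (rule B)
  have card_le: "card S \<le> \<Delta>" if "S \<subseteq> qu_mesh.neighbours (T l') x" "qu_mesh \<Omega> (T l') \<sigma> \<gamma> (h l')" for S l' x
  proof -
    interpret C: qu_mesh \<Omega> "T l'" \<sigma> \<gamma> "h l'" by (rule that(2))
    have "card S \<le> card (C.neighbours x)" using that(1) C.finite_neighbours by (rule card_mono[rotated])
    moreover have "real (card (C.neighbours x)) < real (Suc \<Delta>)" using C.card_neighbours \<Delta> by (rule le_less_trans)
    ultimately show ?thesis by simp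
  qed
  have inp: "(\<lambda>yd. input_memory \<Omega> T h yd cl) \<in> inputs" if "untouched 0 cl" for cl
    using that by (auto simp: inputs_def)
  have zero: "(\<lambda>yd. 0) \<in> inputs" using inp[of "Work 0"] by (simp add: untouched_def)
  obtain F where F: "avail ?n F" "inputs \<subseteq> F" "l \<noteq> 0 \<Longrightarrow> vec (?I l) (\<lambda>yd. nested_iterate \<Omega> T h k yd l) \<subseteq> F"
    using Suc by auto
  define x0 where "x0 yd = (if l = 0 then (\<lambda>v. 0) else fe_function \<Omega> (T l) (nested_iterate \<Omega> T h k yd l))" for yd
  have "\<exists>F1. avail ?n1 F1 \<and> F \<subseteq> F1 \<and> vec ?I' x0 \<subseteq> F1"
  proof (cases "l = 0")
    case True
    then have "vec ?I' x0 \<subseteq> F"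
      using zero F(2) by (intro vec_subset) (auto simp: x0_def)
    then show ?thesis using avail_mono[OF F(1) _ order_refl] by (intro exI[of _ F]) auto
  next
    case False
    then have A: "qu_mesh \<Omega> (T l) \<sigma> \<gamma> (h l)" using Suc.prems by (intro mesh_hierarchy_level[OF dom hier]) auto
    interpret A: qu_mesh \<Omega> "T l" \<sigma> \<gamma> "h l" by (rule A)
    have entry: "(\<lambda>yd. hat (T l) w v) \<in> F" for v w
      using inp[of "Transfer (Suc l) v w"] F(2) by (auto simp: untouched_def)
    have sp: "card {w \<in> ?I l. hat (T l) w v \<noteq> 0} \<le> \<Delta>" for v
      using A.hat_sparse[of v] by (intro card_le[OF _ A]) auto
    obtain F1 where "avail ?n1 F1" "F \<subseteq> F1"
      "vec ?I' (\<lambda>yd v. \<Sum>w\<in>?I l. hat (T l) w v * nested_iterate \<Omega> T h k yd l w) \<subseteq> F1"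
      by (rule extend_matrix[OF B.finite_interior_vertices F(1) A.finite_interior_vertices F(3)[OF False], where A = "\<lambda>v w. hat (T l) w v" and \<Delta> = \<Delta>])
        (use entry sp zero F(2) in auto)
    moreover have "(\<lambda>yd v. \<Sum>w\<in>?I l. hat (T l) w v * nested_iterate \<Omega> T h k yd l w) = x0"
      using False by (simp add: x0_def fe_function_def fun_eq_iff mult.commute)
    ultimately show ?thesis by auto
  qed
  then obtain F1 where F1: "avail ?n1 F1" "F \<subseteq> F1" "vec ?I' x0 \<subseteq> F1" by blast
  have in1: "inputs \<subseteq> F1" using F(2) F1(2) by (rule order_trans)
  have entries: "(\<lambda>yd. B.M v w) \<in> F1" "(\<lambda>yd. B.K v w) \<in> F1" "(\<lambda>yd. B.D v v) \<in> F1" "(\<lambda>yd. h (Suc l) ^ 4) \<in> F1"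
    "(\<lambda>yd. load_vector \<Omega> (T (Suc l)) yd v) \<in> F1" "(\<lambda>yd. 0) \<in> F1" for v w
    using inp[of "Mass (Suc l) v w"] inp[of "Stiffness (Suc l) v w"] inp[of "Lumped (Suc l) v"] inp[of "Rho (Suc l)"]
      inp[of "Load (Suc l) v"] zero in1 by (auto simp: untouched_def)
  have spK: "card {w \<in> ?I'. B.K v w \<noteq> 0} \<le> \<Delta>" and spM: "card {w \<in> ?I'. B.M v w \<noteq> 0} \<le> \<Delta>"
    if "v \<in> ?I'" for v
    using B.sparse[OF that] by (auto intro: card_le[OF _ B])
  have schur_eq: "B.S = (\<lambda>v w. h (Suc l) ^ 4 * (\<Sum>u\<in>?I'. B.K v u * inverse (B.D u u) * B.K u w) + B.M v w)"
    by (simp add: schur_matrix_def fun_eq_iff)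
  have "\<exists>F2. avail ?m F2 \<and> F1 \<subseteq> F2 \<and>
      vec ?I' (\<lambda>yd. pcg ?I' B.S B.D (load_vector \<Omega> (T (Suc l)) yd) (x0 yd) (k (Suc l))) \<subseteq> F2"
  proof (rule extend_pcg[OF B.finite_interior_vertices F1(1) F1(3) _ entries(6) entries(3)])
    show "vec ?I' (load_vector \<Omega> (T (Suc l))) \<subseteq> F1"
      using entries(5) by (rule vec_subset)
    fix n F' x
    assume F': "F1 \<subseteq> F'" "vec ?I' x \<subseteq> F'" "avail n F'"
    obtain F'' where "avail (n + ?N * (6 * \<Delta> + 3)) F''" "F' \<subseteq> F''" "vec ?I' (\<lambda>j. mat_vec ?I' B.S (x j)) \<subseteq> F''"
      unfolding schur_eq
      by (rule extend_schur[OF B.finite_interior_vertices F'(3,2) subsetD[OF F'(1) entries(6)]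
            subsetD[OF F'(1) entries(2)] subsetD[OF F'(1) entries(1)] subsetD[OF F'(1) entries(3)] subsetD[OF F'(1) entries(4)] spK spM])
    then show "\<exists>F''. avail (n + ?N * (6 * \<Delta> + 3)) F'' \<and> F' \<subseteq> F'' \<and> vec ?I' (\<lambda>j. mat_vec ?I' B.S (x j)) \<subseteq> F''"
      by blast
  qed
  then obtain F2 where F2: "avail ?m F2"
    "F1 \<subseteq> F2" "vec ?I' (\<lambda>yd. pcg ?I' B.S B.D (load_vector \<Omega> (T (Suc l)) yd) (x0 yd) (k (Suc l))) \<subseteq> F2"
    by blast
  have "?m = (\<Sum>i\<in>{1..Suc l}. card (?I i) * (2 * \<Delta> + (k i + 1) * (6 * \<Delta> + 19)))"
    by (simp add: algebra_simps)
  moreover have "nested_iterate \<Omega> T h k yd (Suc l) = pcg ?I' B.S B.D (load_vector \<Omega> (T (Suc l)) yd) (x0 yd) (k (Suc l))" for yd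
    by (simp add: x0_def)
  ultimately show ?case
    using F2 order_trans[OF in1 F2(2)] by (intro exI[of _ F2]) (simp only: simp_thms)
qed

lemma nested_iterate_program:
  fixes \<Omega> :: "'a::euclidean_space set"
  assumes dom: "lipschitz_polyhedral_domain \<Omega>" and hier: "mesh_hierarchy \<Omega> \<sigma> \<gamma> L T h" and L: "1 \<le> L"
    and \<Delta>: "(real DIM('a) + 1) * (\<gamma>\<^sup>2 * \<sigma>) ^ DIM('a) < real (Suc \<Delta>)"
    and k: "\<And>i. k i \<le> m"
  obtains p where "computes_nested_iterate \<Omega> L T h k p"
    and "operations p \<le> (2 * \<Delta> + (m + 1) * (6 * \<Delta> + 19)) * (\<Sum>i\<in>{1..L}. card (interior_vertices \<Omega> (T i))) + card (interior_vertices \<Omega> (T L))"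
proof -
  interpret straight_line "\<lambda>yd. input_memory \<Omega> T h yd" "L2_space \<Omega>" .
  let ?I = "\<lambda>l. interior_vertices \<Omega> (T l)"
  let ?n = "\<Sum>i\<in>{1..L}. card (?I i) * (2 * \<Delta> + (k i + 1) * (6 * \<Delta> + 19))"
  obtain F where F: "avail ?n F" "vec (?I L) (\<lambda>yd. nested_iterate \<Omega> T h k yd L) \<subseteq> F"
  proof -
    have "L \<noteq> 0" using L by simp
    with nested_iterate_avail[OF dom hier \<Delta> order_refl, where k = k and J = "L2_space \<Omega>"] that show thesis
      by blast
  qed
  interpret A: qu_mesh \<Omega> "T L" \<sigma> \<gamma> "h L" by (rule mesh_hierarchy_level[OF dom hier]) (use L in auto)
  obtain p where p: "length p \<le> ?n + card (?I L)"
    "\<And>yd v. yd \<in> L2_space \<Omega> \<Longrightarrow> v \<in> ?I L \<Longrightarrow> run p (input_memory \<Omega> T h yd) (Output v) = nested_iterate \<Omega> T h k yd L v"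
    by (rule avail_program[OF F(1) A.finite_interior_vertices F(2)]) auto
  have "?n \<le> (\<Sum>i\<in>{1..L}. card (?I i) * (2 * \<Delta> + (m + 1) * (6 * \<Delta> + 19)))"
    using k by (intro sum_mono mult_le_mono add_mono order_refl) auto
  also have "\<dots> = (2 * \<Delta> + (m + 1) * (6 * \<Delta> + 19)) * (\<Sum>i\<in>{1..L}. card (?I i))"
    by (simp only: sum_distrib_right[symmetric] mult.commute)
  finally show thesis
    using p by (intro that[of p]) (auto simp: computes_nested_iterate_def operations_def)
qed

lemma mesh_hierarchy_size:
  assumes hier: "mesh_hierarchy \<Omega> \<sigma> \<gamma> L T h" and "1 \<le> L" and "j < L"
  shows "h (L - j) = 2 ^ j * h L"
  using assms(3)
proof (induction j)
  case (Suc j)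
  then have "h (L - Suc j) = 2 * h (Suc (L - Suc j))"
    using assms(2) by (intro mesh_hierarchy_Suc(2)[OF hier]) auto
  also have "Suc (L - Suc j) = L - j" using Suc.prems by simp
  finally show ?case using Suc by simp
qed simp

text \<open>Level \<open>L - j\<close> has at most \<open>C * 2^(-j d) * h_L^(-d)\<close> unknowns,
  and since \<open>d \<ge> 1\<close> the geometric series with ratio 1/2 dominates, whence the
  factor 2.\<close>

lemma sum_interior_vertices_le:
  fixes \<Omega> :: "'a::euclidean_space set"
  assumes dom: "lipschitz_polyhedral_domain \<Omega>" and hier: "mesh_hierarchy \<Omega> \<sigma> \<gamma> L T h" and L: "1 \<le> L"
    and R: "\<Omega> \<subseteq> cball 0 R" "0 \<le> R"
  shows "(\<Sum>i\<in>{1..L}. real (card (interior_vertices \<Omega> (T i))))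
    \<le> 2 * ((real DIM('a) + 1) * (R * \<gamma> * \<sigma>) ^ DIM('a)) * h L powr (- real DIM('a))"
proof -
  define C where "C = (real DIM('a) + 1) * (R * \<gamma> * \<sigma>) ^ DIM('a)"
  interpret A: qu_mesh \<Omega> "T L" \<sigma> \<gamma> "h L" by (rule mesh_hierarchy_level[OF dom hier]) (use L in auto)
  have C: "0 \<le> C" using A.\<gamma>_pos A.\<sigma>_pos R(2) by (simp add: C_def)
  have "(\<Sum>i\<in>{1..L}. real (card (interior_vertices \<Omega> (T i)))) = (\<Sum>j<L. real (card (interior_vertices \<Omega> (T (L - j)))))"
    by (rule sum.reindex_bij_witness[of _ "\<lambda>j. L - j" "\<lambda>i. L - i"]) auto
  also have "\<dots> \<le> (\<Sum>j<L. C * h L powr (- real DIM('a)) * (1 / 2) ^ j)"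
  proof (rule sum_mono)
    fix j assume j: "j \<in> {..<L}"
    interpret B: qu_mesh \<Omega> "T (L - j)" \<sigma> \<gamma> "h (L - j)" by (rule mesh_hierarchy_level[OF dom hier]) (use j in auto)
    have "(2 ^ j) powr (- real DIM('a)) \<le> (2 ^ j) powr (- 1 :: real)"
      using DIM_positive[where 'a = 'a] by (intro powr_mono) auto
    then have p: "(2 ^ j) powr (- real DIM('a)) \<le> (1 / 2) ^ j"
      by (simp add: powr_minus power_one_over inverse_eq_divide)
    have "real (card (interior_vertices \<Omega> (T (L - j)))) \<le> C * h (L - j) powr (- real DIM('a))"
      unfolding C_def by (rule B.card_interior_vertices_le[OF R])
    also have "h (L - j) powr (- real DIM('a)) = (2 ^ j) powr (- real DIM('a)) * h L powr (- real DIM('a))"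
      using mesh_hierarchy_size[OF hier L, of j] j A.h_pos by (simp add: powr_mult)
    also have "C * \<dots> \<le> C * ((1 / 2) ^ j * h L powr (- real DIM('a)))"
      using C p by (intro mult_left_mono mult_right_mono) auto
    finally show "real (card (interior_vertices \<Omega> (T (L - j)))) \<le> C * h L powr (- real DIM('a)) * (1 / 2) ^ j"
      by (simp add: mult_ac)
  qed
  also have "\<dots> = C * h L powr (- real DIM('a)) * (\<Sum>j<L. (1 / 2) ^ j)"
    by (simp add: sum_distrib_left)
  also have "(\<Sum>j<L. (1 / 2 :: real) ^ j) = 2 - 2 * (1 / 2) ^ L"
    using geometric_sum[of "1 / 2 :: real" L] by (simp add: field_simps)
  also have "C * h L powr (- real DIM('a)) * (2 - 2 * (1 / 2) ^ L) \<le> C * h L powr (- real DIM('a)) * 2"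
    using C by (intro mult_left_mono) auto
  finally show ?thesis by (simp add: C_def mult_ac)
qed

theorem theorem5:
  fixes \<Omega> :: "'a::euclidean_space set" and \<sigma> \<gamma> :: real
    and k :: "nat \<Rightarrow> nat" and kstar :: nat
  assumes "DIM('a) \<in> {1, 2, 3}"
    and "lipschitz_polyhedral_domain \<Omega>"
    and "\<forall>l\<ge>2. k l = kstar"
  shows "\<exists>C>0. \<forall>L T h s yd c cinv.
    1 \<le> L \<and> mesh_hierarchy \<Omega> \<sigma> \<gamma> L T h \<and>
    0 \<le> s \<and> s \<le> 2 \<and> yd \<in> data_space \<Omega> s \<and> \<not> (AE x in lebesgue_on \<Omega>. yd x = 0) \<and>
    0 < cinv \<and> inverse_inequality \<Omega> L T h cinv \<and>
    0 < c \<and> discretization_error_estimate \<Omega> L T h s c yd \<and>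
    L2_norm \<Omega> (\<lambda>x. yd x - fe_function \<Omega> (T 1) (nested_iterate \<Omega> T h k yd 1) x)
      \<le> h 1 powr s * c_data \<Omega> s c cinv yd \<and>
    real kstar \<ge> ln (inverse (q_data \<Omega> s c cinv yd)) / ln (inverse (q_pcg DIM('a) cinv))
    \<longrightarrow>
    L2_norm \<Omega> (\<lambda>x. yd x - fe_function \<Omega> (T L) (nested_iterate \<Omega> T h k yd L) x)
      \<le> h L powr s * c_data \<Omega> s c cinv yd \<and>
    (\<exists>p. computes_nested_iterate \<Omega> L T h k p \<and>
       real (operations p) \<le> C * real (card (interior_vertices \<Omega> (T L))) \<and>
       real (memory p) \<le> C * real (card (interior_vertices \<Omega> (T L)))) \<and>
    real (card (interior_vertices \<Omega> (T L))) \<le> C * h L powr (- real DIM('a)) \<and>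
    (interior_vertices \<Omega> (T L) \<noteq> {} \<longrightarrow>
       h L powr (- real DIM('a)) \<le> C * real (card (interior_vertices \<Omega> (T L))))"
    (is "\<exists>C>0. \<forall>L T h s yd c cinv. ?hyps L T h s yd c cinv \<longrightarrow> ?error L T h s yd c cinv \<and> ?cost C L T h")
proof -
  have dom: "open \<Omega>" "bounded \<Omega>" "\<Omega> \<noteq> {}" using assms(2) by (auto simp: lipschitz_polyhedral_domain_def)
  obtain R where "0 < R" "\<forall>x\<in>\<Omega>. norm x \<le> R" using dom(2) by (auto simp: bounded_pos)
  then have R: "0 \<le> R" "\<Omega> \<subseteq> cball 0 R" by auto
  obtain x0 R0 where R0: "0 < R0" "cball x0 R0 \<subseteq> \<Omega>"
    using dom(1,3) open_contains_cball by (metis ex_in_conv)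
  define b where "b = (real DIM('a) + 1) * (\<gamma>\<^sup>2 * \<sigma>) ^ DIM('a)"
  obtain \<Delta> :: nat where \<Delta>: "b < real (Suc \<Delta>)"
    using reals_Archimedean2[of b] by (metis le_less_trans less_imp_le of_nat_Suc of_nat_less_iff lessI less_trans)
  \<comment> \<open>Bounds all step numbers, as these equal \<open>kstar\<close> from level 2 on.
    The number of steps on level 1 thus enters the cost constant.\<close>
  define m where "m = max (max (k 0) (k 1)) kstar"
  have m: "k i \<le> m" for i
  proof -
    consider "i = 0" | "i = 1" | "2 \<le> i" by linarith
    then show ?thesis using assms(3) by cases (auto simp: m_def)
  qed
  define C1 where "C1 = (real DIM('a) + 1) * (R * \<gamma> * \<sigma>) ^ DIM('a)"
  define C2 where "C2 = (2 * \<gamma> / R0) ^ DIM('a) * max 1 ((\<gamma>\<^sup>2 * \<sigma>) ^ DIM('a))"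
  define W where "W = real (2 * \<Delta> + (m + 1) * (6 * \<Delta> + 19))"
  \<comment> \<open>The factor 3 passes from operations to memory cells,
    \<open>W * (2 * C1 * C2)\<close> is the work on all levels measured in unknowns of the finest
    one, and the added 1 pays for writing the output. The maximum with 1 keeps \<open>C\<close>
    positive although the signs of \<open>\<sigma>\<close> and \<open>\<gamma>\<close> are known
    only once a mesh exists.\<close>
  define C where "C = max 1 (max (max C1 C2) (3 * (W * (2 * C1 * C2) + 1)))"
  have Cpos: "0 < C" and C: "C1 \<le> C" "C2 \<le> C" "3 * (W * (2 * C1 * C2) + 1) \<le> C"
    unfolding C_def by auto
  have main: "?cost C L T h"
    if L: "1 \<le> L" and hier: "mesh_hierarchy \<Omega> \<sigma> \<gamma> L T h" for L T h
  proof -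
    interpret A: qu_mesh \<Omega> "T L" \<sigma> \<gamma> "h L" by (rule mesh_hierarchy_level[OF assms(2) hier]) (use L in auto)
    let ?I = "interior_vertices \<Omega> (T L)"
    let ?H = "h L powr (- real DIM('a))"
    have pos: "0 \<le> C1" "0 \<le> C2" "0 \<le> W"
      using A.\<gamma>_pos A.\<sigma>_pos R(1) R0(1) by (simp_all add: C1_def C2_def W_def)
    have "real (card ?I) \<le> C1 * ?H" unfolding C1_def by (rule A.card_interior_vertices_le[OF R(2,1)])
    also have "\<dots> \<le> C * ?H" using C(1) by (intro mult_right_mono) auto
    finally have upper: "real (card ?I) \<le> C * ?H" .
    have lower2: "?H \<le> C2 * real (card ?I)" if "?I \<noteq> {}"
      unfolding C2_def by (rule A.card_interior_vertices_ge[OF R0(2,1) that])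
    then have lower: "?H \<le> C * real (card ?I)" if "?I \<noteq> {}"
      using that mult_right_mono[OF C(2), of "real (card ?I)"] by fastforce
    have "\<exists>p. computes_nested_iterate \<Omega> L T h k p \<and> 3 * real (operations p) \<le> C * real (card ?I)"
    proof (cases "?I = {}")
      \<comment> \<open>Without unknowns there is no output, so the empty program is correct and
        costs nothing.\<close>
      case True
      then show ?thesis by (intro exI[of _ "[]"]) (simp add: computes_nested_iterate_def operations_def)
    next
      case False
      obtain p where p: "computes_nested_iterate \<Omega> L T h k p"
        "operations p \<le> (2 * \<Delta> + (m + 1) * (6 * \<Delta> + 19)) * (\<Sum>i\<in>{1..L}. card (interior_vertices \<Omega> (T i))) + card ?I"
        by (rule nested_iterate_program[OF assms(2) hier L \<Delta>[unfolded b_def] m])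
      have "real (operations p) \<le> W * (\<Sum>i\<in>{1..L}. real (card (interior_vertices \<Omega> (T i)))) + real (card ?I)"
        using of_nat_mono[OF p(2), where 'a = real] unfolding W_def by (simp only: of_nat_add of_nat_mult of_nat_sum)
      also have "(\<Sum>i\<in>{1..L}. real (card (interior_vertices \<Omega> (T i)))) \<le> 2 * C1 * ?H"
        unfolding C1_def by (rule sum_interior_vertices_le[OF assms(2) hier L R(2,1)])
      \<comment> \<open>This comparison needs an interior vertex on the finest level, hence the case
        distinction.\<close>
      also have "2 * C1 * ?H \<le> 2 * C1 * (C2 * real (card ?I))"
        using lower2[OF False] pos by (intro mult_left_mono) auto
      finally have "real (operations p) \<le> W * (2 * C1 * (C2 * real (card ?I))) + real (card ?I)"
        using pos(3) by (simp add: mult_left_mono)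
      then have "3 * real (operations p) \<le> (3 * (W * (2 * C1 * C2) + 1)) * real (card ?I)"
        by (simp add: algebra_simps)
      also have "\<dots> \<le> C * real (card ?I)" using C(3) by (intro mult_right_mono) auto
      finally show ?thesis using p(1) by blast
    qed
    then obtain p where p: "computes_nested_iterate \<Omega> L T h k p" "3 * real (operations p) \<le> C * real (card ?I)" by blast
    have "real (memory p) \<le> 3 * real (operations p)"
      using of_nat_mono[OF memory_le_operations[of p], where 'a = real] by simp
    with p have "computes_nested_iterate \<Omega> L T h k p \<and> real (operations p) \<le> C * real (card ?I) \<and> real (memory p) \<le> C * real (card ?I)"
      by (smt (verit) of_nat_0_le_iff)
    with upper lower show ?thesis by blast
  qed
  show ?thesis
  proof (intro exI[of _ C] conjI Cpos allI impI)
  qed (use main nested_convergence[OF assms(2) _ assms(3)] in blast)+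
qed

end
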